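(* Let $m\ge1$ and $n>2m+1$. Assume that there exists one elliptic operator $L_{n-1}$ of order $2m$ in $\mathbb{R}^{n-1}$ (with constant coefficients and only highest order derivatives), with John's corresponding fundamental solution $K_{n-1}$, for which one finds a vector $x'\in\mathbb{R}^{n-1}\setminus\{0\}$ such that $K_{n-1}(x')<0$. Then there exists one elliptic operator $L_n$ of order $2m$ in $\mathbb{R}^n$ (with constant coefficients and only highest order derivatives), with John's corresponding fundamental solution $K_n$, for which one finds a vector $x=(x',x_n)\in\mathbb{R}^n\setminus\{0\}$ such that $K_n(x)<0$.
   Context: For $d\in\{n-1,n\}$, an elliptic operator $L_d$ of order $2m$ in $\mathbb{R}^d$ means $L_d=(-1)^m Q_d\left(\frac{\partial}{\partial x_1},\dots,\frac{\partial}{\partial x_d}\right)$, where $Q_d(\xi)=\sum_{i_1,\dots,i_{2m}=1}^d A_{i_1,\dots,i_{2m}}\xi_{i_1}\cdots\xi_{i_{2m}}$ is a real $2m$-homogeneous polynomial on $\mathbb{R}^d$ such that for some $\lambda>0$, $Q_d(\xi)\ge\lambda|\xi|^{2m}$ for all $\xi\in\mathbb{R}^d$. John's fundamental solution $K_d$ (with pole $0$) of $L_d$, for $d>2m$ and $x\in\mathbb{R}^d\setminus\{0\}$, is $$K_d(x)=-\frac{1}{4(2\pi)^{d-1}}(-\Delta_x)^{\frac{d+1-2m}{2}}\int_{|\xi|=1}\frac{|x\cdot\xi|}{Q_d(\xi)}\,d\mathcal{H}^{d-1}(\xi)\quad (d\text{ odd}),$$ $$K_d(x)=-\frac{1}{(2\pi)^{d}}(-\Delta_x)^{\frac{d-2m}{2}}\int_{|\xi|=1}\frac{\log|x\cdot\xi|}{Q_d(\xi)}\,d\mathcal{H}^{d-1}(\xi)\quad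 (d\text{ even}).$$ It satisfies $\int_{\mathbb{R}^d}K_d(x)\,L_d\varphi(x)\,dx=\varphi(0)$ for all $\varphi\in C_0^\infty(\mathbb{R}^d)$. $\mathcal{H}^k$ is the $k$-dimensional Hausdorff measure. *)

theory Defs
  imports "HOL-Analysis.Analysis"
begin

section \<open>Hausdorff measure\<close>

text \<open>
  The weight of a covering set is normalised so that the \<open>k\<close>-dimensional Hausdorff measure on
  a \<open>k\<close>-dimensional Euclidean space is Lebesgue measure. The empty set gets weight 0 also for
  \<open>k = 0\<close>, where \<open>0 ^ 0 = 1\<close>.
\<close>

definition hausdorff_weight :: "nat \<Rightarrow> 'a::metric_space set \<Rightarrow> ennreal" where
  "hausdorff_weight k C =
     (if C = {} then 0 else ennreal (unit_ball_vol (real k) * (diameter C / 2) ^ k))"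

text \<open>The boundedness requirement is needed because \<^const>\<open>diameter\<close> is unspecified on unbounded sets.\<close>

definition hausdorff_content :: "nat \<Rightarrow> real \<Rightarrow> 'a::metric_space set \<Rightarrow> ennreal" where
  "hausdorff_content k \<delta> A =
     (INF C \<in> {C :: nat \<Rightarrow> 'a set. A \<subseteq> (\<Union>i. C i) \<and> (\<forall>i. bounded (C i) \<and> diameter (C i) \<le> \<delta>)}.
        \<Sum>i. hausdorff_weight k (C i))"

definition hausdorff_outer :: "nat \<Rightarrow> 'a::metric_space set \<Rightarrow> ennreal" where
  "hausdorff_outer k A = (SUP \<delta> \<in> {0<..}. hausdorff_content k \<delta> A)"

definition hausdorff_measure :: "nat \<Rightarrow> 'a::metric_space measure" where
  "hausdorff_measure k = measure_of UNIV (sets borel) (hausdorff_outer k)"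

text \<open>
  As \<^const>\<open>measure_of\<close> yields the zero measure when its argument is not countably additive, we
  verify with Caratheodory's criterion that the Hausdorff outer measure is a measure on the Borel
  sets.
\<close>

lemma hausdorff_content_mono: "A \<subseteq> B \<Longrightarrow> hausdorff_content k \<delta> A \<le> hausdorff_content k \<delta> B"
  unfolding hausdorff_content_def by (rule INF_superset_mono) auto

lemma hausdorff_content_empty: "\<delta> > 0 \<Longrightarrow> hausdorff_content k \<delta> {} = 0"
proof -
  assume "\<delta> > 0"
  have "hausdorff_content k \<delta> ({}::'a set) \<le> (\<Sum>i::nat. hausdorff_weight k ({}::'a set))"
    unfolding hausdorff_content_def
    by (rule INF_lower2[of "\<lambda>_. {}"]) (use \<open>\<delta> > 0\<close> in auto)
  then show ?thesis by (simp add: hausdorff_weight_def)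
qed

lemma hausdorff_content_countably_subadditive:
  fixes A :: "nat \<Rightarrow> 'a::metric_space set"
  shows "hausdorff_content k \<delta> (\<Union>i. A i) \<le> (\<Sum>i. hausdorff_content k \<delta> (A i))"
proof (rule ennreal_le_epsilon)
  fix e :: real assume fin: "(\<Sum>i. hausdorff_content k \<delta> (A i)) < top" and e: "0 < e"
  have lt: "hausdorff_content k \<delta> (A i) < hausdorff_content k \<delta> (A i) + ennreal (e * (1/2) ^ Suc i)" for i
  proof -
    have "hausdorff_content k \<delta> (A i) \<le> (\<Sum>i. hausdorff_content k \<delta> (A i))"
      using sum_le_suminf[of "\<lambda>i. hausdorff_content k \<delta> (A i)" "{i}"] by simp
    with fin have "hausdorff_content k \<delta> (A i) \<noteq> top" by auto
    moreover have "0 < ennreal (e * (1/2) ^ Suc i)" using e by (simp add: ennreal_zero_less_mult_iff)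
    ultimately show ?thesis by (simp add: ennreal_lessI top.not_eq_extremum)
  qed
  have "\<exists>C :: nat \<Rightarrow> 'a set. A i \<subseteq> (\<Union>j. C j) \<and> (\<forall>j. bounded (C j) \<and> diameter (C j) \<le> \<delta>)
      \<and> (\<Sum>j. hausdorff_weight k (C j)) < hausdorff_content k \<delta> (A i) + ennreal (e * (1/2) ^ Suc i)" for i
    using lt[of i] unfolding hausdorff_content_def[of k \<delta> "A i"] INF_less_iff by auto
  then obtain C :: "nat \<Rightarrow> nat \<Rightarrow> 'a set" where C: "\<And>i. A i \<subseteq> (\<Union>j. C i j)"
      "\<And>i j. bounded (C i j)" "\<And>i j. diameter (C i j) \<le> \<delta>"
      "\<And>i. (\<Sum>j. hausdorff_weight k (C i j)) < hausdorff_content k \<delta> (A i) + ennreal (e * (1/2) ^ Suc i)"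
    by metis
  define D where "D = (\<lambda>p. C (fst (prod_decode p)) (snd (prod_decode p)))"
  have D: "(\<Union>i. A i) \<subseteq> (\<Union>p. D p)"
  proof clarify
    fix x i assume "x \<in> A i"
    with C(1) obtain j where "x \<in> C i j" by blast
    then have "x \<in> D (prod_encode (i, j))" by (simp add: D_def)
    then show "x \<in> (\<Union>p. D p)" by blast
  qed
  have "hausdorff_content k \<delta> (\<Union>i. A i) \<le> (\<Sum>p. hausdorff_weight k (D p))"
    unfolding hausdorff_content_def by (rule INF_lower) (use D C in \<open>auto simp: D_def\<close>)
  also have "\<dots> = (\<Sum>i. \<Sum>j. hausdorff_weight k (C i j))"
    using suminf_ennreal_2dimen[of "\<lambda>i. \<Sum>j. hausdorff_weight k (C i j)"
        "\<lambda>p. hausdorff_weight k (C (fst p) (snd p))"] by (simp add: D_def)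
  also have "\<dots> \<le> (\<Sum>i. hausdorff_content k \<delta> (A i) + ennreal (e * (1/2) ^ Suc i))"
    by (intro suminf_le less_imp_le C) auto
  also have "\<dots> = (\<Sum>i. hausdorff_content k \<delta> (A i)) + (\<Sum>i. ennreal (e * (1/2) ^ Suc i))"
    by (rule suminf_add[symmetric]) auto
  also have "(\<Sum>i. ennreal (e * (1/2) ^ Suc i)) = ennreal e"
    using sums_mult[OF power_half_series, of e] e by (intro suminf_ennreal_eq) auto
  finally show "hausdorff_content k \<delta> (\<Union>i. A i) \<le> (\<Sum>i. hausdorff_content k \<delta> (A i)) + ennreal e" .
qed

lemma hausdorff_content_le_outer: "\<delta> > 0 \<Longrightarrow> hausdorff_content k \<delta> A \<le> hausdorff_outer k A"
  unfolding hausdorff_outer_def by (rule SUP_upper) auto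

lemma hausdorff_outer_mono: "A \<subseteq> B \<Longrightarrow> hausdorff_outer k A \<le> hausdorff_outer k B"
  unfolding hausdorff_outer_def by (rule SUP_mono) (use hausdorff_content_mono in blast)

lemma hausdorff_outer_empty [simp]: "hausdorff_outer k {} = 0"
  unfolding hausdorff_outer_def by (simp add: hausdorff_content_empty)

lemma hausdorff_outer_countably_subadditive:
  "hausdorff_outer k (\<Union>i. A i) \<le> (\<Sum>i. hausdorff_outer k (A i))"
  unfolding hausdorff_outer_def[of k "\<Union>i. A i"]
proof (rule SUP_least)
  fix \<delta> :: real assume "\<delta> \<in> {0<..}"
  then show "hausdorff_content k \<delta> (\<Union>i. A i) \<le> (\<Sum>i. hausdorff_outer k (A i))"
    by (intro order.trans[OF hausdorff_content_countably_subadditive] suminf_le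
        hausdorff_content_le_outer) auto
qed

lemma outer_measure_space_hausdorff_outer: "outer_measure_space (Pow UNIV) (hausdorff_outer k)"
  unfolding outer_measure_space_def positive_def increasing_def countably_subadditive_def
  by (simp add: hausdorff_outer_mono hausdorff_outer_countably_subadditive)

lemma hausdorff_outer_subadditive: "hausdorff_outer k (A \<union> B) \<le> hausdorff_outer k A + hausdorff_outer k B"
proof -
  have "subadditive (Pow UNIV) (hausdorff_outer k :: 'a set \<Rightarrow> ennreal)"
    using outer_measure_space_hausdorff_outer[of k, where 'a='a]
    unfolding outer_measure_space_def
    by (metis ring_of_sets.countably_subadditive_subadditive ring_of_sets_Pow)
  then show ?thesis
  proof -
    have "hausdorff_outer k (A \<union> (B - A)) \<le> hausdorff_outer k A + hausdorff_outer k (B - A)"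
      using \<open>subadditive _ _\<close> unfolding subadditive_def by blast
    also have "\<dots> \<le> hausdorff_outer k A + hausdorff_outer k B"
      by (intro add_left_mono hausdorff_outer_mono) auto
    finally show ?thesis by simp
  qed
qed

lemma hausdorff_outer_separated:
  fixes A B :: "'a::metric_space set"
  assumes e: "e > 0" and sep: "\<And>x y. x \<in> A \<Longrightarrow> y \<in> B \<Longrightarrow> e \<le> dist x y"
  shows "hausdorff_outer k A + hausdorff_outer k B \<le> hausdorff_outer k (A \<union> B)"
proof -
  have small: "hausdorff_content k \<delta> A + hausdorff_content k \<delta> B \<le> hausdorff_content k \<delta> (A \<union> B)"
    if \<delta>: "\<delta> > 0" "\<delta> < e" for \<delta>
    unfolding hausdorff_content_def[of k \<delta> "A \<union> B"]
  proof (rule INF_greatest, clarsimp)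
    fix C :: "nat \<Rightarrow> 'a set"
    assume A: "A \<subseteq> (\<Union>i. C i)" and B: "B \<subseteq> (\<Union>i. C i)" and C: "\<forall>i. bounded (C i) \<and> diameter (C i) \<le> \<delta>"
    define CA where "CA i = (if C i \<inter> A = {} then {} else C i)" for i
    define CB where "CB i = (if C i \<inter> B = {} then {} else C i)" for i
    have disj: "C i \<inter> A = {} \<or> C i \<inter> B = {}" for i
    proof (rule ccontr)
      assume "\<not> ?thesis"
      then obtain x y where "x \<in> C i" "x \<in> A" "y \<in> C i" "y \<in> B" by blast
      then have "e \<le> dist x y" "dist x y \<le> diameter (C i)"
        using sep C diameter_bounded_bound by blast+
      with C \<delta> show False by (smt (verit))
    qed
    have "hausdorff_content k \<delta> A \<le> (\<Sum>i. hausdorff_weight k (CA i))"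
      unfolding hausdorff_content_def
      by (rule INF_lower) (use A C \<delta> in \<open>fastforce simp: CA_def\<close>)
    moreover have "hausdorff_content k \<delta> B \<le> (\<Sum>i. hausdorff_weight k (CB i))"
      unfolding hausdorff_content_def
      by (rule INF_lower) (use B C \<delta> in \<open>fastforce simp: CB_def\<close>)
    ultimately have "hausdorff_content k \<delta> A + hausdorff_content k \<delta> B \<le>
        (\<Sum>i. hausdorff_weight k (CA i)) + (\<Sum>i. hausdorff_weight k (CB i))"
      by (rule add_mono)
    also have "\<dots> = (\<Sum>i. hausdorff_weight k (CA i) + hausdorff_weight k (CB i))"
      by (rule suminf_add) auto
    also have "\<dots> \<le> (\<Sum>i. hausdorff_weight k (C i))"
    proof (rule suminf_le)
      fix i show "hausdorff_weight k (CA i) + hausdorff_weight k (CB i) \<le> hausdorff_weight k (C i)"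
        using disj[of i] by (auto simp: CA_def CB_def hausdorff_weight_def)
    qed auto
    finally show "hausdorff_content k \<delta> A + hausdorff_content k \<delta> B \<le> (\<Sum>i. hausdorff_weight k (C i))" .
  qed
  have anti: "hausdorff_content k \<delta>' S \<le> hausdorff_content k \<delta> S" if "\<delta> \<le> \<delta>'" for \<delta> \<delta>' and S :: "'a set"
    unfolding hausdorff_content_def
    by (rule INF_superset_mono) (auto intro: order.trans[OF _ that])
  have "hausdorff_content k \<delta>1 A + hausdorff_content k \<delta>2 B \<le> hausdorff_outer k (A \<union> B)"
    if "\<delta>1 > 0" "\<delta>2 > 0" for \<delta>1 \<delta>2
  proof -
    define \<delta> where "\<delta> = min (e/2) (min \<delta>1 \<delta>2)"
    have \<delta>: "\<delta> > 0" "\<delta> < e" "\<delta> \<le> \<delta>1" "\<delta> \<le> \<delta>2" using that e by (auto simp: \<delta>_def)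
    have "hausdorff_content k \<delta>1 A + hausdorff_content k \<delta>2 B \<le> hausdorff_content k \<delta> A + hausdorff_content k \<delta> B"
      by (intro add_mono anti \<delta>)
    also have "\<dots> \<le> hausdorff_outer k (A \<union> B)"
      using small[OF \<delta>(1,2)] hausdorff_content_le_outer[OF \<delta>(1)] by (rule order.trans)
    finally show ?thesis .
  qed
  then have "hausdorff_content k \<delta>1 A + hausdorff_outer k B \<le> hausdorff_outer k (A \<union> B)"
    if "\<delta>1 > 0" for \<delta>1
    unfolding hausdorff_outer_def[of k B] using that
    by (subst ennreal_SUP_add_right) (auto intro!: SUP_least)
  then show ?thesis
    unfolding hausdorff_outer_def[of k A]
    by (subst ennreal_SUP_add_left[symmetric]) (auto intro!: SUP_least)
qed

lemma closed_in_lambda_system_hausdorff_outer: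
  fixes F :: "'a::metric_space set"
  assumes F: "closed F"
  shows "F \<in> lambda_system UNIV (Pow UNIV) (hausdorff_outer k)"
proof -
  let ?h = "hausdorff_outer k :: 'a set \<Rightarrow> ennreal"
  have "?h (T \<inter> F) + ?h (T - F) \<le> ?h T" for T
  proof (cases "F = {} \<or> ?h T = top")
    case True
    then show ?thesis by auto
  next
    case False
    then have ne: "F \<noteq> {}" and fin: "?h T < top" by (auto simp: top.not_eq_extremum)
    define G where "G j = {x \<in> T. 1 / real (Suc j) \<le> infdist x F}" for j
    define R where "R j = {x \<in> T. 1 / real (Suc (Suc j)) \<le> infdist x F \<and> infdist x F < 1 / real (Suc j)}" for j
    have dist_ge: "b - a \<le> dist x y" if "b \<le> infdist x F" "infdist y F \<le> a" for x y a b
      using infdist_triangle[of x F y] that by linarith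
    have G: "?h (T \<inter> F) + ?h (G j) \<le> ?h T" for j
    proof -
      have "?h (G j) + ?h (T \<inter> F) \<le> ?h (G j \<union> (T \<inter> F))"
      proof (rule hausdorff_outer_separated[of "1 / real (Suc j)"])
        fix x y assume "x \<in> G j" "y \<in> T \<inter> F"
        then show "1 / real (Suc j) \<le> dist x y"
          using dist_ge[of "1 / real (Suc j)" x y 0] by (auto simp: G_def)
      qed simp
      also have "\<dots> \<le> ?h T" by (rule hausdorff_outer_mono) (auto simp: G_def)
      finally show ?thesis by (simp add: add.commute)
    qed
    have Rsum: "(\<Sum>j<N. ?h (R (2 * j + c))) \<le> ?h (\<Union>j<N. R (2 * j + c))" for N c
    proof (induction N)
      case (Suc N)
      let ?U = "\<Union>j<N. R (2 * j + c)"
      let ?b = "1 / real (2 * N + c)" and ?a = "1 / real (Suc (2 * N + c))"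
      show ?case
      proof (cases "N = 0")
        case True
        then have "{..<Suc N} = {0}" by auto
        with True show ?thesis by simp
      next
        case False
        have "?h ?U + ?h (R (2 * N + c)) \<le> ?h (?U \<union> R (2 * N + c))"
        proof (rule hausdorff_outer_separated[of "?b - ?a"])
          have "?a < ?b" using False by (intro divide_strict_left_mono) auto
          then show "0 < ?b - ?a" by simp
        next
          fix x y assume "x \<in> ?U" and y: "y \<in> R (2 * N + c)"
          then obtain j where j: "j < N" "x \<in> R (2 * j + c)" by auto
          have "?b \<le> 1 / real (Suc (Suc (2 * j + c)))"
            using j False by (intro divide_left_mono) auto
          also have "\<dots> \<le> infdist x F" using j by (simp add: R_def)
          finally show "?b - ?a \<le> dist x y"
            by (rule dist_ge) (use y in \<open>simp add: R_def\<close>)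
        qed
        moreover have "(\<Union>j<Suc N. R (2 * j + c)) = ?U \<union> R (2 * N + c)"
          by (auto simp: less_Suc_eq)
        ultimately show ?thesis
          using Suc.IH by (simp add: order.trans[OF add_right_mono])
      qed
    qed simp
    have Rfin: "(\<Sum>j. ?h (R (2 * j + c))) \<le> ?h T" for c
    proof (rule suminf_le_const)
      fix N
      have "?h (\<Union>j<N. R (2 * j + c)) \<le> ?h T" by (rule hausdorff_outer_mono) (auto simp: R_def)
      with Rsum[of c N] show "(\<Sum>j<N. ?h (R (2 * j + c))) \<le> ?h T" by (rule order.trans)
    qed auto
    have "(\<Sum>j<N. ?h (R j)) \<le> ?h T + ?h T" for N
    proof -
      have "(\<Sum>j<N. ?h (R j)) \<le> (\<Sum>j<2 * N. ?h (R j))" by (rule sum_mono2) auto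
      also have "\<dots> = (\<Sum>j<N. ?h (R (2 * j + 0))) + (\<Sum>j<N. ?h (R (2 * j + 1)))"
        by (induction N) (auto simp: ac_simps)
      also have "\<dots> \<le> (\<Sum>j. ?h (R (2 * j + 0))) + (\<Sum>j. ?h (R (2 * j + 1)))"
        by (intro add_mono sum_le_suminf) auto
      also have "\<dots> \<le> ?h T + ?h T" by (intro add_mono Rfin)
      finally show ?thesis .
    qed
    then have "(\<Sum>j. ?h (R j)) \<le> ?h T + ?h T" by (intro suminf_le_const) auto
    with fin have Rtop: "(\<Sum>j. ?h (R j)) < top" by (auto intro: le_less_trans simp: ennreal_add_less_top)
    have cover: "T - F \<subseteq> G n \<union> (\<Union>j. R (j + n))" for n
    proof
      fix x assume x: "x \<in> T - F"
      then have "infdist x F > 0"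
        using F ne in_closed_iff_infdist_zero infdist_nonneg by (metis DiffE order.not_eq_order_implies_strict)
      then obtain m where m: "1 / real (Suc m) \<le> infdist x F"
        by (metis nat_approx_posE less_imp_le)
      define l where "l = (LEAST m. 1 / real (Suc m) \<le> infdist x F)"
      have l: "1 / real (Suc l) \<le> infdist x F" unfolding l_def by (rule LeastI[of _ m]) (fact m)
      show "x \<in> G n \<union> (\<Union>j. R (j + n))"
      proof (cases "l \<le> n")
        case True
        then have "1 / real (Suc n) \<le> 1 / real (Suc l)" by (simp add: field_simps)
        with l x show ?thesis by (auto simp: G_def)
      next
        case False
        then obtain i where i: "l = Suc (i + n)"
          by (metis add.commute less_imp_Suc_add not_le)
        have "\<not> 1 / real (Suc (i + n)) \<le> infdist x F"
          using not_less_Least[of "i + n" "\<lambda>m. 1 / real (Suc m) \<le> infdist x F"] i by (simp add: l_def)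
        then have "x \<in> R (i + n)" using l i x by (auto simp: R_def)
        then show ?thesis by blast
      qed
    qed
    have bound: "?h (T \<inter> F) + ?h (T - F) \<le> ?h T + (\<Sum>j. ?h (R (j + n)))" for n
    proof -
      have "?h (T - F) \<le> ?h (G n) + ?h (\<Union>j. R (j + n))"
        using hausdorff_outer_mono[OF cover] hausdorff_outer_subadditive by (rule order.trans)
      also have "\<dots> \<le> ?h (G n) + (\<Sum>j. ?h (R (j + n)))"
        by (intro add_left_mono hausdorff_outer_countably_subadditive)
      finally have "?h (T \<inter> F) + ?h (T - F) \<le> (?h (T \<inter> F) + ?h (G n)) + (\<Sum>j. ?h (R (j + n)))"
        by (simp add: add.assoc add_left_mono)
      also have "\<dots> \<le> ?h T + (\<Sum>j. ?h (R (j + n)))" by (intro add_right_mono G)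
      finally show ?thesis .
    qed
    define r where "r j = enn2real (?h (R j))" for j
    have r0: "r j \<ge> 0" for j by (simp add: r_def)
    have hr: "?h (R j) = ennreal (r j)" for j
    proof -
      have "?h (R j) \<le> ?h T" by (rule hausdorff_outer_mono) (auto simp: R_def)
      with fin show ?thesis by (simp add: r_def)
    qed
    have sr: "summable r"
      by (rule summable_suminf_not_top) (use Rtop r0 in \<open>auto simp: hr\<close>)
    have "(\<lambda>n. ennreal (\<Sum>j. r (j + n))) \<longlonglongrightarrow> ennreal 0"
      by (intro tendsto_ennrealI suminf_exist_split2 sr)
    moreover have "(\<Sum>j. ?h (R (j + n))) = ennreal (\<Sum>j. r (j + n))" for n
      unfolding hr by (intro suminf_ennreal2 r0 summable_ignore_initial_segment sr)
    ultimately have "(\<lambda>n. \<Sum>j. ?h (R (j + n))) \<longlonglongrightarrow> 0" by simp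
    then have "(\<lambda>n. ?h T + (\<Sum>j. ?h (R (j + n)))) \<longlonglongrightarrow> ?h T + 0"
      by (intro tendsto_add tendsto_const)
    then show ?thesis
      using bound by (intro LIMSEQ_le_const) auto
  qed
  then have "?h (T \<inter> F) + ?h (T - F) = ?h T" for T
    using hausdorff_outer_subadditive[of k "T \<inter> F" "T - F"]
    by (metis Int_Diff_Un antisym)
  then show ?thesis
    by (simp add: algebra.lambda_system_eq[OF algebra_Pow] del: Pow_UNIV)
qed

lemma emeasure_hausdorff_measure:
  fixes A :: "'a::metric_space set"
  assumes "A \<in> sets borel"
  shows "emeasure (hausdorff_measure k) A = hausdorff_outer k A"
proof -
  let ?L = "lambda_system UNIV (Pow UNIV) (hausdorff_outer k :: 'a set \<Rightarrow> ennreal)"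
  have L: "measure_space UNIV ?L (hausdorff_outer k)"
    by (rule sigma_algebra.caratheodory_lemma[OF sigma_algebra_Pow outer_measure_space_hausdorff_outer])
  then have "sigma_algebra UNIV ?L" by (simp add: measure_space_def)
  moreover have "Collect closed \<subseteq> ?L" using closed_in_lambda_system_hausdorff_outer by blast
  ultimately have "sigma_sets UNIV (Collect closed) \<subseteq> ?L" by (rule sigma_algebra.sigma_sets_subset)
  then have sub: "sets borel \<subseteq> ?L" by (simp add: borel_eq_closed)
  show ?thesis
    unfolding hausdorff_measure_def
  proof (rule emeasure_measure_of_sigma)
    show "sigma_algebra UNIV (sets borel :: 'a set set)"
      using sets.sigma_algebra_axioms[of "borel :: 'a measure"] by simp
    show "positive (sets borel) (hausdorff_outer k :: 'a set \<Rightarrow> ennreal)"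
      by (simp add: positive_def)
    show "countably_additive (sets borel) (hausdorff_outer k :: 'a set \<Rightarrow> ennreal)"
      using L sub unfolding measure_space_def countably_additive_def by blast
  qed fact
qed

lemma space_hausdorff_measure [simp]: "space (hausdorff_measure k) = UNIV"
  by (simp add: hausdorff_measure_def)

lemma sets_hausdorff_measure [simp, measurable_cong]: "sets (hausdorff_measure k) = sets borel"
  unfolding hausdorff_measure_def by (simp add: sets.sigma_sets_eq[of borel, simplified])

section \<open>Elliptic operators and their fundamental solutions\<close>

definition directional_deriv :: "'a::euclidean_space \<Rightarrow> ('a \<Rightarrow> real) \<Rightarrow> 'a \<Rightarrow> real" where
  "directional_deriv v f x = deriv (\<lambda>t. f (x + t *\<^sub>R v)) 0"

definition laplacian :: "('a::euclidean_space \<Rightarrow> real) \<Rightarrow> 'a \<Rightarrow> real" where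
  "laplacian f x = (\<Sum>b\<in>Basis. directional_deriv b (directional_deriv b f) x)"

text \<open>
  A multi-index \<open>(i\<^sub>1, \<dots>, i\<^sub>k)\<close> is rendered as the list of basis vectors
  \<open>[e\<^bsub>i\<^sub>1\<^esub>, \<dots>, e\<^bsub>i\<^sub>k\<^esub>]\<close>.
\<close>

definition multi_indices :: "nat \<Rightarrow> 'a::euclidean_space list set" where
  "multi_indices k = {is. length is = k \<and> set is \<subseteq> Basis}"

text \<open>
  \<open>elliptic_operator m Q L\<close> says that \<open>L = (-1)\<^sup>m Q(\<partial>)\<close> is an elliptic operator of order \<open>2m\<close>
  with constant coefficients and only highest order terms. The operator is meaningful on
  sufficiently smooth functions, on which its value does not depend on the choice of the
  coefficients \<open>A\<close> representing \<open>Q\<close>.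
\<close>

definition elliptic_operator ::
    "nat \<Rightarrow> ('a::euclidean_space \<Rightarrow> real) \<Rightarrow> (('a \<Rightarrow> real) \<Rightarrow> 'a \<Rightarrow> real) \<Rightarrow> bool" where
  "elliptic_operator m Q L \<longleftrightarrow>
     (\<exists>A :: 'a list \<Rightarrow> real.
        Q = (\<lambda>\<xi>. \<Sum>is\<in>multi_indices (2 * m). A is * (\<Prod>b\<leftarrow>is. \<xi> \<bullet> b)) \<and>
        L = (\<lambda>\<phi> x. (-1) ^ m * (\<Sum>is\<in>multi_indices (2 * m). A is * foldr directional_deriv is \<phi> x))) \<and>
     (\<exists>c>0. \<forall>\<xi>. Q \<xi> \<ge> c * norm \<xi> ^ (2 * m))"

text \<open>
  John's fundamental solution with pole 0 of \<open>L = (-1)\<^sup>m Q(\<partial>)\<close>, for \<open>DIM('a) > 2 * m\<close> and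
  \<open>x \<noteq> 0\<close>. For fixed \<open>y \<noteq> 0\<close> the convention \<open>ln 0 = 0\<close> only concerns a null set of \<open>\<xi>\<close>.
\<close>

definition john_fundamental_solution :: "nat \<Rightarrow> ('a::euclidean_space \<Rightarrow> real) \<Rightarrow> 'a \<Rightarrow> real" where
  "john_fundamental_solution m Q x =
     (let d = DIM('a); neg_laplacian = (\<lambda>f y. - laplacian f y) in
      if odd d then
        - 1 / (4 * (2 * pi) ^ (d - 1)) *
          (neg_laplacian ^^ ((d + 1 - 2 * m) div 2))
            (\<lambda>y. LINT \<xi>:sphere 0 1|hausdorff_measure (d - 1). \<bar>y \<bullet> \<xi>\<bar> / Q \<xi>) x
      else
        - 1 / (2 * pi) ^ d *
          (neg_laplacian ^^ ((d - 2 * m) div 2))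
            (\<lambda>y. LINT \<xi>:sphere 0 1|hausdorff_measure (d - 1). ln \<bar>y \<bullet> \<xi>\<bar> / Q \<xi>) x)"

end

theory Submission
  imports Defs "HOL-Probability.Sinc_Integral"
begin

text \<open>
  Take \<open>Q(\<xi>', \<xi>\<^sub>n) = Q'(\<xi>') + \<xi>\<^sub>n\<^bsup>2m\<^esup>\<close> and use the descent \<open>K\<^bsub>n-1\<^esub>(x') = c \<integral> K\<^sub>n(x', t) dt\<close>:
  if \<open>K\<^sub>n(x', t)\<close> were nonnegative for all \<open>t\<close>, so would be \<open>K\<^bsub>n-1\<^esub>(x')\<close>.

  To make sense of this for John's formula, whose shape depends on the parity of the dimension \<open>d\<close>, it
  is brought into one form. The Hausdorff measure on the sphere is a positive multiple of the
  cone measure, so by homogeneity the spherical integral of \<open>\<psi>(y \<bullet> \<xi>) / Q(\<xi>)\<close>, where \<open>\<psi>\<close> is the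
  absolute value or its logarithm, equals up to a positive factor and an additive constant the integral
  of \<open>\<psi>(y \<bullet> x) |x|\<^bsup>2(a-k)\<^esup> exp (- |x|\<^bsup>2a\<^esup> Q(x))\<close> over the whole space, for any \<open>a \<ge> k\<close> with \<open>k\<close> the number
  of Laplacians. Writing \<open>|s|\<close> and \<open>ln |s|\<close> as superpositions of \<open>1 - cos (r s)\<close> over \<open>r > 0\<close> and
  differentiating under the integrals, one obtains for a constant \<open>A > 0\<close> in both parities
  \<open>K\<^sub>d(y) = A \<integral> r\<^bsup>d-1-2m\<^esup> F(r y) dr\<close>, where \<open>F\<close> is the Fourier transform of
  \<open>|x|\<^bsup>2a\<^esup> exp (- |x|\<^bsup>2a\<^esup> Q(x))\<close>. With the same \<open>a\<close> in both dimensions, the function for \<open>Q\<close>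
  restricts to the one for \<open>Q'\<close> on the hyperplane \<open>x\<^sub>n = 0\<close>.
\<close>

section \<open>Cosine transforms of polynomials times exponentials\<close>

text \<open>The degree of the exponent is forced: if the weight |x|^q satisfies d + q = 2(m+a), the
  radial integral of r^(d-1+q) exp (- r^(2(m+a)) Q(\<xi>)) is 1 / (2(m+a) Q(\<xi>)), so 1/Q appears
  to the first power. Each negative Laplacian multiplies the integrand by r^2 |x|^2; k of them
  complete |x|^(2(a-k)) to |x|^(2a), in which k, and with it the parity, is gone. Even powers of the
  norm are polynomials, so F decays faster than any power along rays and the integrals converge for
  large r. Near r = 0 the densities 1/r^2 and 1/r of the superpositions are singular; there the
  value at y is compared with the value at a fixed reference point y1, and the first Laplacian
  removes both the reference point and the singularity. The integral over t is damped by exp (-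
  \<delta> t), so that the integrals can be exchanged under product majorants. Since the conclusion
  concerns a sign, constants are tracked only as positive factors; for this the unit sphere must
  have positive Hausdorff measure. In dimension n a projection shows it, in dimension n-1 it is read
  off from the hypothesis K(x') < 0 itself.\<close>

lemma has_real_derivative_integral:
  fixes f :: "real \<Rightarrow> 'a \<Rightarrow> real"
  assumes e: "0 < e"
    and int: "\<And>t. \<bar>t - t0\<bar> < e \<Longrightarrow> integrable M (f t)"
    and meas: "f' t0 \<in> borel_measurable M"
    and der: "\<And>t x. x \<in> space M \<Longrightarrow> \<bar>t - t0\<bar> < e \<Longrightarrow>
      ((\<lambda>s. f s x) has_real_derivative f' t x) (at t)"
    and bd: "\<And>t x. x \<in> space M \<Longrightarrow> \<bar>t - t0\<bar> < e \<Longrightarrow> \<bar>f' t x\<bar> \<le> g x"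
    and g: "integrable M g"
  shows "((\<lambda>t. \<integral>x. f t x \<partial>M) has_real_derivative (\<integral>x. f' t0 x \<partial>M)) (at t0)"
proof -
  have "((\<lambda>h. ((\<integral>x. f (t0 + h) x \<partial>M) - (\<integral>x. f t0 x \<partial>M)) / h) \<longlongrightarrow> (\<integral>x. f' t0 x \<partial>M)) (at 0)"
    unfolding tendsto_at_iff_sequentially
  proof (intro allI impI)
    fix X :: "nat \<Rightarrow> real" assume X: "\<forall>i. X i \<in> UNIV - {0}" "X \<longlonglongrightarrow> 0"
    from X(2) e obtain N where N: "\<And>n. n \<ge> N \<Longrightarrow> \<bar>X n\<bar> < e"
      by (metis LIMSEQ_D diff_zero real_norm_def)
    define Y where "Y i = X (i + N)" for i
    have Y: "Y i \<noteq> 0" "\<bar>Y i\<bar> < e" for i using X N by (auto simp: Y_def)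
    have Y0: "Y \<longlonglongrightarrow> 0" unfolding Y_def using X(2) by (rule LIMSEQ_ignore_initial_segment)
    have "(\<lambda>i. \<integral>x. (f (t0 + Y i) x - f t0 x) / Y i \<partial>M) \<longlonglongrightarrow> (\<integral>x. f' t0 x \<partial>M)"
    proof (rule integral_dominated_convergence[where w = g])
      show "(\<lambda>x. (f (t0 + Y i) x - f t0 x) / Y i) \<in> borel_measurable M" for i
        using int[of "t0 + Y i"] int[of t0] e Y by (intro borel_measurable_divide borel_measurable_diff) auto
      show "AE x in M. (\<lambda>i. (f (t0 + Y i) x - f t0 x) / Y i) \<longlonglongrightarrow> f' t0 x"
      proof (rule AE_I2)
        fix x assume "x \<in> space M"
        then have "((\<lambda>h. (f (t0 + h) x - f t0 x) / h) \<longlongrightarrow> f' t0 x) (at 0)"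
          using der[of x t0] e by (simp add: DERIV_def)
        with Y Y0 show "(\<lambda>i. (f (t0 + Y i) x - f t0 x) / Y i) \<longlonglongrightarrow> f' t0 x"
          unfolding tendsto_at_iff_sequentially by (auto simp: o_def)
      qed
      show "AE x in M. norm ((f (t0 + Y i) x - f t0 x) / Y i) \<le> g x" for i
      proof (rule AE_I2)
        fix x assume x: "x \<in> space M"
        \<comment> \<open>The mean value inequality on the ball of radius \<open>e\<close> turns the
          bound on \<open>f'\<close> into a bound on the difference quotients, the majorant for
          dominated convergence.\<close>
        have "norm (f (t0 + Y i) x - f t0 x) \<le> g x * norm ((t0 + Y i) - t0)"
          by (rule field_differentiable_bound[of "ball t0 e" "\<lambda>s. f s x" "\<lambda>t. f' t x"])
            (use e Y x in \<open>auto simp: dist_real_def abs_minus_commute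
                intro!: has_field_derivative_at_within[OF der] bd\<close>)
        with Y(1)[of i] show "norm ((f (t0 + Y i) x - f t0 x) / Y i) \<le> g x"
          by (simp add: divide_le_eq)
      qed
    qed (use meas g in auto)
    also have "(\<lambda>i. \<integral>x. (f (t0 + Y i) x - f t0 x) / Y i \<partial>M) =
        (\<lambda>i. ((\<integral>x. f (t0 + Y i) x \<partial>M) - (\<integral>x. f t0 x \<partial>M)) / Y i)"
      using int[of "t0 + Y _"] int[of t0] e Y by (subst Bochner_Integration.integral_diff[symmetric]) auto
    finally have "(\<lambda>i. ((\<lambda>h. ((\<integral>x. f (t0 + h) x \<partial>M) - (\<integral>x. f t0 x \<partial>M)) / h) \<circ> X) (i + N))
        \<longlonglongrightarrow> (\<integral>x. f' t0 x \<partial>M)"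
      by (simp add: Y_def o_def)
    then show "((\<lambda>h. ((\<integral>x. f (t0 + h) x \<partial>M) - (\<integral>x. f t0 x \<partial>M)) / h) \<circ> X) \<longlonglongrightarrow> (\<integral>x. f' t0 x \<partial>M)"
      by (rule LIMSEQ_offset)
  qed
  then show ?thesis by (simp add: DERIV_def)
qed

section \<open>Exponentially decaying integrands and integration by parts\<close>

lemma integral_lborel_shift:
  fixes f :: "'a::euclidean_space \<Rightarrow> real"
  assumes [measurable]: "f \<in> borel_measurable borel"
  shows "(\<integral>x. f (x + c) \<partial>lborel) = (\<integral>x. f x \<partial>lborel)"
proof -
  have "(\<integral>x. f x \<partial>lborel) = (\<integral>x. f x \<partial>distr lborel borel ((+) c))"
    by (simp add: lborel_distr_plus)
  also have "\<dots> = (\<integral>x. f (x + c) \<partial>lborel)"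
    by (subst integral_distr) (auto simp: add.commute)
  finally show ?thesis by simp
qed

lemma power_le_exp:
  assumes "\<kappa> > 0"
  obtains C :: real where "C > 0" "\<And>x::real. x \<ge> 0 \<Longrightarrow> x ^ k \<le> C * exp (\<kappa> * x)"
proof
  \<comment> \<open>With y = \<kappa> x / (k+1), the constant is chosen so that C y^k = x^k; then y
    \<le> exp y is raised to the k-th power. Using k+1 instead of k keeps the denominator nonzero
    for k = 0.\<close>
  let ?C = "((real k + 1) / \<kappa>) ^ k"
  show "?C > 0" using assms by simp
  fix x :: real assume x: "x \<ge> 0"
  let ?y = "\<kappa> * x / (real k + 1)"
  have "?y ^ k \<le> exp ?y ^ k"
    using x assms exp_ge_add_one_self[of ?y] by (intro power_mono) (auto simp del: exp_ge_add_one_self intro: order.trans[of _ "1 + ?y"])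
  also have "\<dots> = exp (real k * ?y)" by (rule exp_of_nat_mult[symmetric])
  also have "\<dots> \<le> exp (\<kappa> * x)"
    using x assms by (simp add: field_simps)
  finally have "?C * ?y ^ k \<le> ?C * exp (\<kappa> * x)"
    using assms by (intro mult_left_mono) auto
  moreover have "?C * ?y ^ k = x ^ k"
    using assms by (simp add: power_mult_distrib[symmetric])
  ultimately show "x ^ k \<le> ?C * exp (\<kappa> * x)" by simp
qed

text \<open>Where n \<le> |x| < n+1 the integrand is at most exp (- \<kappa> n), and such x lie in a
  ball of volume proportional to (n+1)^d. Half of the exponential decay absorbs this power, the
  other half leaves a geometric series.\<close>

lemma integrable_exp_norm:
  assumes k: "\<kappa> > 0"
  shows "integrable lborel (\<lambda>x::'a::euclidean_space. exp (- \<kappa> * norm x))"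
proof (rule integrableI_nonneg)
  let ?d = "DIM('a)"
  let ?w = "unit_ball_vol (real ?d)"
  let ?a = "\<lambda>n::nat. exp (- \<kappa> * real n) * (?w * (real n + 1) ^ ?d)"
  have w: "?w \<ge> 0" by simp
  obtain C where C: "C > 0" "\<And>x::real. x \<ge> 0 \<Longrightarrow> x ^ ?d \<le> C * exp (\<kappa> / 2 * x)"
    using power_le_exp[of "\<kappa> / 2" ?d] k by auto
  have sum: "summable ?a"
  proof (rule summable_comparison_test)
    show "\<exists>N. \<forall>n\<ge>N. norm (?a n) \<le> ?w * C * exp (\<kappa> / 2) * exp (- \<kappa> / 2) ^ n"
    proof (intro exI allI impI)
      fix n :: nat
      have "norm (?a n) = exp (- \<kappa> * real n) * (?w * (real n + 1) ^ ?d)" by simp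
      also have "\<dots> \<le> exp (- \<kappa> * real n) * (?w * (C * exp (\<kappa> / 2 * (real n + 1))))"
        using w by (intro mult_left_mono C) auto
      also have "\<dots> = ?w * C * (exp (- \<kappa> * real n) * exp (\<kappa> / 2 * (real n + 1)))"
        by simp
      also have "exp (- \<kappa> * real n) * exp (\<kappa> / 2 * (real n + 1)) = exp (\<kappa> / 2) * exp (- \<kappa> / 2) ^ n"
        by (simp add: exp_of_nat_mult[symmetric] exp_add[symmetric] field_simps)
      finally show "norm (?a n) \<le> ?w * C * exp (\<kappa> / 2) * exp (- \<kappa> / 2) ^ n" by (simp add: mult.assoc)
    qed
    show "summable (\<lambda>n. ?w * C * exp (\<kappa> / 2) * exp (- \<kappa> / 2) ^ n)"
      using k by (intro summable_mult summable_geometric) auto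
  qed
  have "(\<integral>\<^sup>+x. ennreal (exp (- \<kappa> * norm x)) \<partial>(lborel::'a measure)) \<le>
      (\<integral>\<^sup>+x. (\<Sum>n. ennreal (exp (- \<kappa> * real n)) * indicator (ball 0 (real n + 1)) x) \<partial>(lborel::'a measure))"
  proof (rule nn_integral_mono)
    fix x :: 'a
    define n where "n = nat \<lfloor>norm x\<rfloor>"
    have n: "real n \<le> norm x" "norm x < real n + 1"
      unfolding n_def by (simp_all add: of_nat_nat)
    have "ennreal (exp (- \<kappa> * norm x)) \<le> ennreal (exp (- \<kappa> * real n)) * indicator (ball 0 (real n + 1)) x"
      using n k by (auto simp: indicator_def intro!: ennreal_leI)
    also have "\<dots> \<le> (\<Sum>n. ennreal (exp (- \<kappa> * real n)) * indicator (ball 0 (real n + 1)) x)"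
      using sum_le_suminf[of "\<lambda>n. ennreal (exp (- \<kappa> * real n)) * indicator (ball 0 (real n + 1)) x" "{n}"]
      by (simp only: sum.insert sum.empty finite.emptyI empty_iff not_False_eq_True add_0_right) simp
    finally show "ennreal (exp (- \<kappa> * norm x)) \<le> \<dots>" .
  qed
  also have "\<dots> = (\<Sum>n. \<integral>\<^sup>+x. ennreal (exp (- \<kappa> * real n)) * indicator (ball 0 (real n + 1)) x \<partial>(lborel::'a measure))"
    by (intro nn_integral_suminf borel_measurable_times_ennreal borel_measurable_const borel_measurable_indicator)
      (simp add: borel_open)
  also have "\<dots> = (\<Sum>n. ennreal (?a n))"
    by (intro suminf_cong) (simp add: nn_integral_cmult_indicator emeasure_ball ennreal_mult')
  also have "\<dots> = ennreal (\<Sum>n. ?a n)"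
    using sum by (intro suminf_ennreal2) auto
  finally show "(\<integral>\<^sup>+x. ennreal (exp (- \<kappa> * norm x)) \<partial>(lborel::'a measure)) < \<infinity>"
    by (simp add: top.not_eq_extremum le_less_trans)
qed auto

lemma integrable_exp_norm_bound:
  fixes f :: "'a::euclidean_space \<Rightarrow> real"
  assumes "f \<in> borel_measurable borel" "\<And>x. \<bar>f x\<bar> \<le> C * exp (- \<kappa> * norm x)" "\<kappa> > 0"
  shows "integrable lborel f"
  by (rule Bochner_Integration.integrable_bound[OF integrable_mult_right[OF integrable_exp_norm[OF assms(3)], of C]])
    (use assms(1) in \<open>auto intro!: order.trans[OF assms(2)]\<close>)

text \<open>By the triangle inequality the weight is comparable with its translates by bounded
  vectors. This provides majorants that are uniform in the translation parameter.\<close>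

lemma exp_norm_shift_le:
  fixes v :: "'a::euclidean_space"
  assumes "\<kappa> > 0" "\<bar>t\<bar> \<le> 1"
  shows "exp (- \<kappa> * norm (x + t *\<^sub>R v)) \<le> exp (\<kappa> * norm v) * exp (- \<kappa> * norm x)"
proof -
  have "norm x \<le> norm (x + t *\<^sub>R v) + norm (t *\<^sub>R v)" by (metis add_diff_cancel norm_triangle_ineq4)
  also have "norm (t *\<^sub>R v) \<le> norm v" using assms mult_right_mono[of "\<bar>t\<bar>" 1 "norm v"] by simp
  finally have "\<kappa> * norm x \<le> \<kappa> * (norm (x + t *\<^sub>R v) + norm v)"
    using assms by (simp add: mult_left_mono)
  then show ?thesis by (simp add: exp_add[symmetric] algebra_simps)
qed

text \<open>Translation invariance makes the integral of u(x + t v) constant in t; differentiating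
  under the integral at t = 0 gives the claim. This replaces the boundary terms of an integration by
  parts.\<close>

lemma integral_directional_derivative_zero:
  fixes u u' :: "'a::euclidean_space \<Rightarrow> real"
  assumes [measurable]: "u \<in> borel_measurable borel" "u' \<in> borel_measurable borel"
    and k: "\<kappa> > 0"
    and bd: "\<And>x. \<bar>u x\<bar> \<le> C * exp (- \<kappa> * norm x)" "\<And>x. \<bar>u' x\<bar> \<le> C * exp (- \<kappa> * norm x)"
    and der: "\<And>x t. ((\<lambda>s. u (x + s *\<^sub>R v)) has_real_derivative u' (x + t *\<^sub>R v)) (at t)"
  shows "(\<integral>x. u' x \<partial>lborel) = 0"
proof -
  have C: "C \<ge> 0" using bd(1)[of 0] by simp
  have "((\<lambda>t. \<integral>x. u (x + t *\<^sub>R v) \<partial>lborel) has_real_derivative (\<integral>x. u' (x + 0 *\<^sub>R v) \<partial>lborel)) (at 0)"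
  proof (rule has_real_derivative_integral[where e = 1 and g = "\<lambda>x. C * (exp (\<kappa> * norm v) * exp (- \<kappa> * norm x))"])
    fix t x assume "\<bar>t - 0::real\<bar> < 1"
    then have t: "\<bar>t\<bar> \<le> 1" by simp
    show b: "\<bar>u' (x + t *\<^sub>R v)\<bar> \<le> C * (exp (\<kappa> * norm v) * exp (- \<kappa> * norm x))" for x
      by (rule order.trans[OF bd(2) mult_left_mono[OF exp_norm_shift_le[OF k t] C]])
    have b: "\<bar>u (x + t *\<^sub>R v)\<bar> \<le> (C * exp (\<kappa> * norm v)) * exp (- \<kappa> * norm x)" for x
      using order.trans[OF bd(1) mult_left_mono[OF exp_norm_shift_le[OF k t] C]] by (simp add: mult.assoc)
    show "integrable lborel (\<lambda>x. u (x + t *\<^sub>R v))"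
      by (rule integrable_exp_norm_bound[OF _ b k]) measurable
  qed (use der integrable_exp_norm[OF k] in \<open>auto intro!: integrable_mult_right\<close>)
  moreover have "(\<integral>x. u (x + t *\<^sub>R v) \<partial>lborel) = (\<integral>x. u x \<partial>lborel)" for t
    by (rule integral_lborel_shift) simp
  ultimately have "((\<lambda>t. \<integral>x. u x \<partial>lborel) has_real_derivative (\<integral>x. u' x \<partial>lborel)) (at (0::real))"
    by simp
  then show ?thesis using DERIV_const DERIV_unique by blast
qed

text \<open>With the phase \<open>\<theta>\<close>, derivatives of a cosine transform are again cosine transforms, with phase
  \<open>\<theta> + pi / 2\<close>.\<close>

definition ft :: "real \<Rightarrow> ('a::euclidean_space \<Rightarrow> real) \<Rightarrow> 'a \<Rightarrow> real" where
  "ft \<theta> f y = (\<integral>x. cos (y \<bullet> x + \<theta>) * f x \<partial>lborel)"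

text \<open>The derivative of sin (y \<bullet> x + \<theta>) f(x) in direction \<open>v\<close>
  integrates to 0. Since cos (s + pi/2) = - sin s, the phase shift also absorbs the sign.\<close>

lemma ft_parts:
  fixes f f' :: "'a::euclidean_space \<Rightarrow> real"
  assumes [measurable]: "f \<in> borel_measurable borel" "f' \<in> borel_measurable borel"
    and k: "\<kappa> > 0"
    and bd: "\<And>x. \<bar>f x\<bar> \<le> C * exp (- \<kappa> * norm x)" "\<And>x. \<bar>f' x\<bar> \<le> C' * exp (- \<kappa> * norm x)"
    and der: "\<And>x t. ((\<lambda>s. f (x + s *\<^sub>R v)) has_real_derivative f' (x + t *\<^sub>R v)) (at t)"
  shows "(y \<bullet> v) * ft \<theta> f y = ft (\<theta> + pi / 2) f' y"
proof -
  let ?u = "\<lambda>x. sin (y \<bullet> x + \<theta>) * f x"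
  let ?u' = "\<lambda>x. (y \<bullet> v) * (cos (y \<bullet> x + \<theta>) * f x) - cos (y \<bullet> x + (\<theta> + pi / 2)) * f' x"
  let ?K = "\<bar>C\<bar> + \<bar>y \<bullet> v\<bar> * \<bar>C\<bar> + \<bar>C'\<bar>"
  have c: "\<bar>s * z\<bar> \<le> \<bar>A\<bar> * E" if "\<bar>s\<bar> \<le> 1" "\<bar>z\<bar> \<le> A * E" "E \<ge> 0" for s z A E :: real
  proof -
    have "\<bar>s * z\<bar> \<le> 1 * (A * E)" unfolding abs_mult using that by (intro mult_mono) auto
    also have "\<dots> \<le> \<bar>A\<bar> * E" using that by (simp add: mult_right_mono)
    finally show ?thesis .
  qed
  have i1: "integrable lborel (\<lambda>x. cos (y \<bullet> x + \<theta>) * f x)"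
    by (rule integrable_exp_norm_bound[of _ "\<bar>C\<bar>", OF _ _ k]) (measurable, intro c bd, auto)
  have i2: "integrable lborel (\<lambda>x. cos (y \<bullet> x + (\<theta> + pi / 2)) * f' x)"
    by (rule integrable_exp_norm_bound[of _ "\<bar>C'\<bar>", OF _ _ k]) (measurable, intro c bd, auto)
  have "(\<integral>x. ?u' x \<partial>lborel) = 0"
  proof (rule integral_directional_derivative_zero[of ?u ?u' \<kappa> ?K v])
    fix x :: 'a
    have 1: "\<bar>?u x\<bar> \<le> \<bar>C\<bar> * exp (- \<kappa> * norm x)" by (intro c bd) auto
    also have "\<dots> \<le> ?K * exp (- \<kappa> * norm x)" by (intro mult_right_mono) auto
    finally show "\<bar>?u x\<bar> \<le> ?K * exp (- \<kappa> * norm x)" .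
    have "\<bar>?u' x\<bar> \<le> \<bar>y \<bullet> v\<bar> * \<bar>cos (y \<bullet> x + \<theta>) * f x\<bar> + \<bar>cos (y \<bullet> x + (\<theta> + pi / 2)) * f' x\<bar>"
      by (metis abs_mult abs_triangle_ineq4)
    also have "\<dots> \<le> \<bar>y \<bullet> v\<bar> * (\<bar>C\<bar> * exp (- \<kappa> * norm x)) + \<bar>C'\<bar> * exp (- \<kappa> * norm x)"
      by (intro add_mono mult_left_mono c bd) auto
    also have "\<dots> \<le> ?K * exp (- \<kappa> * norm x)" by (simp add: algebra_simps)
    finally show "\<bar>?u' x\<bar> \<le> ?K * exp (- \<kappa> * norm x)" .
  next
    fix x t
    show "((\<lambda>s. ?u (x + s *\<^sub>R v)) has_real_derivative ?u' (x + t *\<^sub>R v)) (at t)"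
      by (rule derivative_eq_intros der refl | simp add: inner_add_right cos_add)+
        (simp add: algebra_simps sin_add cos_add)
  qed (use k in auto)
  then show ?thesis
    unfolding ft_def using i1 i2 by (simp add: integrable_mult_right)
qed

lemma ft_bound:
  fixes f :: "'a::euclidean_space \<Rightarrow> real"
  assumes [measurable]: "f \<in> borel_measurable borel"
    and k: "\<kappa> > 0" and bd: "\<And>x. \<bar>f x\<bar> \<le> C * exp (- \<kappa> * norm x)"
  shows "\<bar>ft \<theta> f y\<bar> \<le> C * (\<integral>x. exp (- \<kappa> * norm x) \<partial>(lborel::'a measure))"
proof -
  have "\<bar>ft \<theta> f y\<bar> \<le> (\<integral>x. \<bar>cos (y \<bullet> x + \<theta>) * f x\<bar> \<partial>lborel)"
    unfolding ft_def by (rule integral_abs_bound)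
  also have "\<dots> \<le> (\<integral>x. C * exp (- \<kappa> * norm x) \<partial>(lborel::'a measure))"
  proof (rule Bochner_Integration.integral_mono')
    fix x :: 'a
    have "\<bar>cos (y \<bullet> x + \<theta>)\<bar> * \<bar>f x\<bar> \<le> 1 * (C * exp (- \<kappa> * norm x))"
      by (intro mult_mono bd) auto
    then show "\<bar>cos (y \<bullet> x + \<theta>) * f x\<bar> \<le> C * exp (- \<kappa> * norm x)" by (simp add: abs_mult)
  next
    have "C \<ge> 0" using bd[of 0] by simp
    then show "0 \<le> C * exp (- \<kappa> * norm x)" for x :: 'a by simp
  qed (rule integrable_mult_right[OF integrable_exp_norm[OF k]])
  finally show ?thesis by simp
qed

text \<open>Each factor y \<bullet> v is traded for one derivative by \<open>ft_parts\<close>; the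
  sequence \<open>F\<close> consists of the successive derivatives in direction
  \<open>v\<close>.\<close>

lemma ft_decay:
  fixes F :: "nat \<Rightarrow> 'a::euclidean_space \<Rightarrow> real"
  assumes [measurable]: "\<And>i. F i \<in> borel_measurable borel"
    and k: "\<kappa> > 0"
    and bd: "\<And>i x. \<bar>F i x\<bar> \<le> B i * exp (- \<kappa> * norm x)"
    and der: "\<And>i x t. ((\<lambda>s. F i (x + s *\<^sub>R v)) has_real_derivative F (Suc i) (x + t *\<^sub>R v)) (at t)"
  shows "\<bar>y \<bullet> v\<bar> ^ N * \<bar>ft \<theta> (F i) y\<bar> \<le> B (i + N) * (\<integral>x. exp (- \<kappa> * norm x) \<partial>(lborel::'a measure))"
proof (induction N arbitrary: i \<theta>)
  case 0
  then show ?case using ft_bound[OF _ k bd] by simp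
next
  case (Suc N)
  have "\<bar>y \<bullet> v\<bar> ^ Suc N * \<bar>ft \<theta> (F i) y\<bar> = \<bar>y \<bullet> v\<bar> ^ N * \<bar>(y \<bullet> v) * ft \<theta> (F i) y\<bar>"
    by (simp add: abs_mult)
  also have "(y \<bullet> v) * ft \<theta> (F i) y = ft (\<theta> + pi / 2) (F (Suc i)) y"
    by (rule ft_parts[OF _ _ k bd bd der]) auto
  also have "\<bar>y \<bullet> v\<bar> ^ N * \<bar>\<dots>\<bar> \<le> B (Suc i + N) * (\<integral>x. exp (- \<kappa> * norm x) \<partial>(lborel::'a measure))"
    by (rule Suc.IH)
  finally show ?case by simp
qed

section \<open>A class of functions closed under polynomial multiplication and directional
  derivatives\<close>

definition poly_exp :: "('a::euclidean_space \<Rightarrow> real) \<Rightarrow> ('a \<Rightarrow> real) \<Rightarrow> bool" where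
  "poly_exp R f \<longleftrightarrow> (\<exists>p. real_polynomial_function p \<and> f = (\<lambda>x. p x * exp (- R x)))"

lemma poly_exp_mult:
  assumes "poly_exp R f" "real_polynomial_function q"
  shows "poly_exp R (\<lambda>x. q x * f x)"
proof -
  obtain p where "real_polynomial_function p" "f = (\<lambda>x. p x * exp (- R x))"
    using assms(1) by (auto simp: poly_exp_def)
  then show ?thesis
    unfolding poly_exp_def
    by (intro exI[of _ "\<lambda>x. q x * p x"]) (auto intro: real_polynomial_function.intros(4) assms(2))
qed

lemma real_polynomial_function_inner: "real_polynomial_function (\<lambda>x. x \<bullet> b)"
  by (intro real_polynomial_function.intros(1) bounded_linear_inner_left)

lemma real_polynomial_function_norm_power:
  "real_polynomial_function (\<lambda>x::'a::euclidean_space. norm x ^ (2 * k))"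
proof -
  have "real_polynomial_function (\<lambda>x::'a. (\<Sum>b\<in>Basis. (x \<bullet> b) ^ 2) ^ k)"
    by (intro real_polynomial_function_power real_polynomial_function_sum real_polynomial_function_inner) auto
  also have "(\<lambda>x::'a. (\<Sum>b\<in>Basis. (x \<bullet> b) ^ 2) ^ k) = (\<lambda>x. norm x ^ (2 * k))"
  proof
    fix x :: 'a
    have "(\<Sum>b\<in>Basis. (x \<bullet> b) ^ 2) = norm x ^ 2"
      unfolding power2_norm_eq_inner by (subst euclidean_inner) (simp add: power2_eq_square)
    then show "(\<Sum>b\<in>Basis. (x \<bullet> b) ^ 2) ^ k = norm x ^ (2 * k)" by (simp add: power_mult)
  qed
  finally show ?thesis .
qed

lemma real_polynomial_function_directional_derivative:
  assumes "real_polynomial_function p"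
  shows "\<exists>p'. real_polynomial_function p' \<and>
    (\<forall>x t. ((\<lambda>s. p (x + s *\<^sub>R v)) has_real_derivative p' (x + t *\<^sub>R v)) (at t))"
  using assms
proof (induction rule: real_polynomial_function.induct)
  case (linear f)
  interpret bounded_linear f by fact
  have "((\<lambda>s. f (x + s *\<^sub>R v)) has_real_derivative f v) (at t)" for x t
    unfolding add scale by (auto intro!: derivative_eq_intros)
  then show ?case by (intro exI[of _ "\<lambda>_. f v"]) auto
next
  case (const c)
  then show ?case by (intro exI[of _ "\<lambda>_. 0"]) auto
next
  case (add f g)
  then obtain f' g' where *: "real_polynomial_function f'" "real_polynomial_function g'"
    "\<And>x t. ((\<lambda>s. f (x + s *\<^sub>R v)) has_real_derivative f' (x + t *\<^sub>R v)) (at t)"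
    "\<And>x t. ((\<lambda>s. g (x + s *\<^sub>R v)) has_real_derivative g' (x + t *\<^sub>R v)) (at t)" by blast
  then show ?case
    by (intro exI[of _ "\<lambda>x. f' x + g' x"]) (auto intro!: derivative_eq_intros real_polynomial_function.intros(3))
next
  case (mult f g)
  then obtain f' g' where *: "real_polynomial_function f'" "real_polynomial_function g'"
    "\<And>x t. ((\<lambda>s. f (x + s *\<^sub>R v)) has_real_derivative f' (x + t *\<^sub>R v)) (at t)"
    "\<And>x t. ((\<lambda>s. g (x + s *\<^sub>R v)) has_real_derivative g' (x + t *\<^sub>R v)) (at t)" by blast
  then show ?case using mult.hyps
    by (intro exI[of _ "\<lambda>x. f' x * g x + f x * g' x"])
      (auto intro!: DERIV_cong[OF DERIV_mult'] real_polynomial_function.intros(3) real_polynomial_function.intros(4) simp: algebra_simps)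
qed

text \<open>An exponential bound passes to sums and products by adding exponents, so no degrees have
  to be tracked; a quadratically growing exponent still beats it.\<close>

lemma real_polynomial_function_growth:
  assumes "real_polynomial_function p"
  shows "\<exists>C k. \<forall>x. \<bar>p x\<bar> \<le> C * exp (real k * norm x)"
  using assms
proof (induction rule: real_polynomial_function.induct)
  case (linear f)
  then obtain K where K: "\<And>x. norm (f x) \<le> norm x * K" "K \<ge> 0"
    using bounded_linear.nonneg_bounded by blast
  have "\<bar>f x\<bar> \<le> K * exp (real 1 * norm x)" for x
  proof -
    have "norm x \<le> exp (norm x)" using exp_ge_add_one_self[of "norm x"] by linarith
    then have "norm x * K \<le> exp (norm x) * K" using K by (intro mult_right_mono)
    with K(1)[of x] show ?thesis by (simp add: mult.commute)
  qed
  then show ?case by blast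
next
  case (const c)
  have "\<bar>c\<bar> \<le> \<bar>c\<bar> * exp (real 0 * norm x)" for x :: 'a by simp
  then show ?case by blast
next
  case (add f g)
  then obtain C k C' k' where *: "\<And>x. \<bar>f x\<bar> \<le> C * exp (real k * norm x)" "\<And>x. \<bar>g x\<bar> \<le> C' * exp (real k' * norm x)"
    by blast
  have C: "C \<ge> 0" "C' \<ge> 0" using *(1)[of 0] *(2)[of 0] by auto
  have "\<bar>f x + g x\<bar> \<le> (C + C') * exp (real (k + k') * norm x)" for x
  proof -
    have "\<bar>f x + g x\<bar> \<le> C * exp (real k * norm x) + C' * exp (real k' * norm x)"
      using *[of x] by linarith
    also have "\<dots> \<le> C * exp (real (k + k') * norm x) + C' * exp (real (k + k') * norm x)"
      using C by (intro add_mono mult_left_mono) (auto simp: mult_right_mono)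
    finally show ?thesis by (simp add: algebra_simps)
  qed
  then show ?case by blast
next
  case (mult f g)
  then obtain C k C' k' where *: "\<And>x. \<bar>f x\<bar> \<le> C * exp (real k * norm x)" "\<And>x. \<bar>g x\<bar> \<le> C' * exp (real k' * norm x)"
    by blast
  have C: "C \<ge> 0" "C' \<ge> 0" using *(1)[of 0] *(2)[of 0] by auto
  have "\<bar>f x * g x\<bar> \<le> (C * C') * exp (real (k + k') * norm x)" for x
  proof -
    have "\<bar>f x * g x\<bar> \<le> (C * exp (real k * norm x)) * (C' * exp (real k' * norm x))"
      unfolding abs_mult using * C by (intro mult_mono) auto
    then show ?thesis by (simp add: algebra_simps exp_add)
  qed
  then show ?case by blast
qed

text \<open>The summand \<open>- c\<close> makes the bound hold inside the unit ball as well, where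
  its right-hand side is nonpositive. Hence forms R with R(x) \<ge> c |x|^(2j), j \<ge> 1, qualify.
  Under this bound the functions in \<open>poly_exp R\<close> play the part of Schwartz
  functions.\<close>

locale exp_weight =
  fixes R :: "'a::euclidean_space \<Rightarrow> real" and c :: real
  assumes R_poly: "real_polynomial_function R" and c_pos: "c > 0"
    and R_ge: "\<And>x. R x \<ge> c * norm x ^ 2 - c"
begin

lemma poly_exp_measurable: "poly_exp R f \<Longrightarrow> f \<in> borel_measurable borel"
proof -
  assume "poly_exp R f"
  then obtain p where p: "real_polynomial_function p" "f = (\<lambda>x. p x * exp (- R x))"
    by (auto simp: poly_exp_def)
  show ?thesis unfolding p(2)
    by (intro borel_measurable_continuous_onI continuous_intros continuous_on_polymonial_function)
      (use p R_poly in \<open>auto simp: real_polynomial_function_eq\<close>)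
qed

lemma poly_exp_bound:
  assumes "poly_exp R f"
  obtains C where "\<And>x. \<bar>f x\<bar> \<le> C * exp (- norm x)"
proof -
  obtain p where p: "real_polynomial_function p" "f = (\<lambda>x. p x * exp (- R x))"
    using assms by (auto simp: poly_exp_def)
  obtain C k where C: "\<And>x. \<bar>p x\<bar> \<le> C * exp (real k * norm x)"
    using real_polynomial_function_growth[OF p(1)] by blast
  have C0: "C \<ge> 0" using C[of 0] by auto
  let ?b = "real k + 1"
  have "\<bar>f x\<bar> \<le> (C * exp (c + ?b\<^sup>2 / (4 * c))) * exp (- norm x)" for x
  proof -
    \<comment> \<open>Completing the square in |x|. With k+1 in place of k, one factor exp (- |x|)
      is left over.\<close>
    have "0 \<le> (2 * c * norm x - ?b)\<^sup>2 / (4 * c)" using c_pos by simp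
    also have "\<dots> = c * norm x ^ 2 - ?b * norm x + ?b\<^sup>2 / (4 * c)"
      using c_pos by (simp add: power2_eq_square field_simps)
    finally have q: "real k * norm x - R x \<le> c + ?b\<^sup>2 / (4 * c) + (- norm x)"
      using R_ge[of x] by (simp add: algebra_simps)
    have "\<bar>f x\<bar> \<le> (C * exp (real k * norm x)) * exp (- R x)"
      unfolding p(2) abs_mult using C[of x] by (intro mult_mono) auto
    also have "\<dots> = C * exp (real k * norm x - R x)" by (simp add: exp_add[symmetric])
    also have "\<dots> \<le> C * exp (c + ?b\<^sup>2 / (4 * c) + (- norm x))" using C0 q by (intro mult_left_mono) auto
    finally show ?thesis by (simp only: exp_add mult.assoc)
  qed
  then show ?thesis by (rule that)
qed

lemma poly_exp_integrable: "poly_exp R f \<Longrightarrow> integrable lborel f"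
  by (metis integrable_exp_norm_bound[of f _ 1] poly_exp_bound poly_exp_measurable mult_minus1 zero_less_one)

lemma poly_exp_derivative:
  assumes "poly_exp R f"
  shows "\<exists>f'. poly_exp R f' \<and>
    (\<forall>x t. ((\<lambda>s. f (x + s *\<^sub>R v)) has_real_derivative f' (x + t *\<^sub>R v)) (at t))"
proof -
  obtain p where p: "real_polynomial_function p" "f = (\<lambda>x. p x * exp (- R x))"
    using assms by (auto simp: poly_exp_def)
  obtain p' where p': "real_polynomial_function p'"
    "\<And>x t. ((\<lambda>s. p (x + s *\<^sub>R v)) has_real_derivative p' (x + t *\<^sub>R v)) (at t)"
    using real_polynomial_function_directional_derivative[OF p(1)] by blast
  obtain R' where R': "real_polynomial_function R'"
    "\<And>x t. ((\<lambda>s. R (x + s *\<^sub>R v)) has_real_derivative R' (x + t *\<^sub>R v)) (at t)"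
    using real_polynomial_function_directional_derivative[OF R_poly] by blast
  let ?q = "\<lambda>x. p' x - p x * R' x"
  have "poly_exp R (\<lambda>x. ?q x * exp (- R x))"
    unfolding poly_exp_def using p p' R'
    by (intro exI[of _ ?q] conjI refl real_polynomial_function_diff real_polynomial_function.intros(4)) 
  moreover have "((\<lambda>s. f (x + s *\<^sub>R v)) has_real_derivative ?q (x + t *\<^sub>R v) * exp (- R (x + t *\<^sub>R v))) (at t)" for x t
    unfolding p(2) by (rule derivative_eq_intros p' R' refl | simp add: algebra_simps)+
  ultimately show ?thesis by blast
qed

lemma poly_exp_tower:
  assumes "poly_exp R f"
  obtains F where "F 0 = f" "\<And>i. poly_exp R (F i)"
    "\<And>i x t. ((\<lambda>s. F i (x + s *\<^sub>R v)) has_real_derivative F (Suc i) (x + t *\<^sub>R v)) (at t)"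
proof -
  have "\<exists>F. \<forall>i::nat. (poly_exp R (F i) \<and> (i = 0 \<longrightarrow> F i = f)) \<and>
    (\<forall>x t. ((\<lambda>s. F i (x + s *\<^sub>R v)) has_real_derivative F (Suc i) (x + t *\<^sub>R v)) (at t))"
    by (rule dependent_nat_choice) (use assms poly_exp_derivative in blast)+
  then show ?thesis using that by blast
qed

lemma poly_exp_ft_bound:
  assumes "poly_exp R f"
  obtains C where "\<And>\<theta> y. \<bar>ft \<theta> f y\<bar> \<le> C"
proof -
  obtain C where "\<And>x. \<bar>f x\<bar> \<le> C * exp (- norm x)" using poly_exp_bound[OF assms] by blast
  then have "\<bar>ft \<theta> f y\<bar> \<le> C * (\<integral>x. exp (- 1 * norm x) \<partial>(lborel::'a measure))" for \<theta> y
    by (intro ft_bound poly_exp_measurable[OF assms]) auto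
  then show ?thesis using that by blast
qed

lemma poly_exp_ft_decay:
  assumes "poly_exp R f"
  obtains C where "\<And>\<theta> y. \<bar>y \<bullet> v\<bar> ^ N * \<bar>ft \<theta> f y\<bar> \<le> C"
proof -
  obtain F where F: "F 0 = f" "\<And>i. poly_exp R (F i)"
    "\<And>i x t. ((\<lambda>s. F i (x + s *\<^sub>R v)) has_real_derivative F (Suc i) (x + t *\<^sub>R v)) (at t)"
    using poly_exp_tower[OF assms] by blast
  have "\<exists>B. \<forall>x. \<bar>F i x\<bar> \<le> B * exp (- 1 * norm x)" for i
    using poly_exp_bound[OF F(2)] by (metis mult_minus1)
  then obtain B where B: "\<And>i x. \<bar>F i x\<bar> \<le> B i * exp (- 1 * norm x)" by metis
  have "\<bar>y \<bullet> v\<bar> ^ N * \<bar>ft \<theta> (F 0) y\<bar> \<le> B (0 + N) * (\<integral>x. exp (- 1 * norm x) \<partial>(lborel::'a measure))" for \<theta> y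
    by (rule ft_decay[where \<kappa> = 1 and F = F and B = B and v = v]) (use F B poly_exp_measurable in auto)
  then show ?thesis using that F(1) by blast
qed

lemma ft_has_derivative:
  assumes f: "poly_exp R f"
  shows "((\<lambda>t. ft \<theta> f (y + t *\<^sub>R b)) has_real_derivative ft (\<theta> + pi / 2) (\<lambda>x. (x \<bullet> b) * f x) (y + t *\<^sub>R b)) (at t)"
  unfolding ft_def
proof (rule has_real_derivative_integral[where e = 1 and g = "\<lambda>x. \<bar>(x \<bullet> b) * f x\<bar>"])
  note [measurable] = poly_exp_measurable[OF f]
  have fb: "poly_exp R (\<lambda>x. (x \<bullet> b) * f x)" by (intro poly_exp_mult f real_polynomial_function_inner)
  then show "integrable lborel (\<lambda>x. \<bar>(x \<bullet> b) * f x\<bar>)"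
    using poly_exp_integrable by auto
  fix s x
  show "\<bar>cos ((y + s *\<^sub>R b) \<bullet> x + (\<theta> + pi / 2)) * ((x \<bullet> b) * f x)\<bar> \<le> \<bar>(x \<bullet> b) * f x\<bar>" for x
    by (simp add: abs_mult mult_left_le_one_le)
  show "integrable lborel (\<lambda>x. cos ((y + s *\<^sub>R b) \<bullet> x + \<theta>) * f x)"
    by (rule Bochner_Integration.integrable_bound[OF poly_exp_integrable[OF f]])
      (auto simp: abs_mult mult_left_le_one_le)
  show "((\<lambda>s. cos ((y + s *\<^sub>R b) \<bullet> x + \<theta>) * f x) has_real_derivative
      cos ((y + s *\<^sub>R b) \<bullet> x + (\<theta> + pi / 2)) * ((x \<bullet> b) * f x)) (at s)"
  proof -
    have "((\<lambda>s. cos (y \<bullet> x + \<theta> + s * (x \<bullet> b)) * f x) has_real_derivative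
        - sin (y \<bullet> x + \<theta> + s * (x \<bullet> b)) * (x \<bullet> b) * f x) (at s)"
      by (auto intro!: derivative_eq_intros)
    then show ?thesis
      by (simp add: cos_add sin_add inner_add_left inner_commute[of b] algebra_simps)
  qed
qed (use poly_exp_measurable[OF f] in auto)

lemma ft_measurable:
  assumes f: "poly_exp R f"
  shows "ft \<theta> f \<in> borel_measurable borel"
proof -
  note [measurable] = poly_exp_measurable[OF f]
  show ?thesis unfolding ft_def[abs_def] by measurable
qed

end

section \<open>Radial integrals of cosine transforms and their Laplacians\<close>

lemma one_minus_cos_le: "1 - cos s \<le> s\<^sup>2" for s :: real
proof -
  have "1 - cos s = 2 * (sin (s / 2))\<^sup>2" using cos_double_sin[of "s / 2"] by simp
  also have "(sin (s / 2))\<^sup>2 \<le> (s / 2)\<^sup>2" unfolding abs_le_square_iff[symmetric] by (rule abs_sin_x_le_abs_x)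
  also have "2 * (s / 2)\<^sup>2 \<le> s\<^sup>2" by (simp add: power_divide)
  finally show ?thesis by simp
qed

section \<open>Integration over the positive half-line\<close>

definition lpos :: "real measure" where
  "lpos = restrict_space lborel {0<..}"

lemma space_lpos [simp]: "space lpos = {0<..}"
  by (simp add: lpos_def space_restrict_space)

lemma lpos_measurable: "f \<in> borel_measurable borel \<Longrightarrow> f \<in> borel_measurable lpos"
  unfolding lpos_def by (rule measurable_restrict_space1) simp

lemma sigma_finite_lpos: "sigma_finite_measure lpos"
  unfolding lpos_def by (rule sigma_finite_measure_restrict_space) (auto intro: sigma_finite_lborel)

lemma integrable_inverse_square: "integrable lborel (\<lambda>x::real. 1 / (1 + x\<^sup>2))"
  using integrable_inverse_1_plus_square
  by (simp add: set_integrable_def einterval_iff[abs_def] inverse_eq_divide einterval_eq_UNIV)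

lemma integrable_lpos_inverse_square: "integrable lpos (\<lambda>x::real. C / (1 + x\<^sup>2))"
proof -
  have "integrable lpos (\<lambda>x::real. 1 / (1 + x\<^sup>2))"
    unfolding lpos_def using integrable_real_mult_indicator[OF _ integrable_inverse_square, of "{0<..}"]
    by (subst integrable_restrict_space) (auto simp: mult.commute)
  then have "integrable lpos (\<lambda>x::real. C * (1 / (1 + x\<^sup>2)))" by (rule integrable_mult_right)
  then show ?thesis by simp
qed

text \<open>One integrable majorant for functions that are bounded near 0 and decay quadratically at
  infinity. The factor 2 comes from 1 + r^2 \<le> 2 for r \<le> 1 and 1 + r^2 \<le> 2 r^2 for r
  \<ge> 1.\<close>

lemma lpos_bound:
  fixes a r C C' :: real
  assumes "0 < r" "r \<le> 1 \<Longrightarrow> \<bar>a\<bar> \<le> C" "1 \<le> r \<Longrightarrow> r\<^sup>2 * \<bar>a\<bar> \<le> C'"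
  shows "\<bar>a\<bar> \<le> 2 * max \<bar>C\<bar> \<bar>C'\<bar> / (1 + r\<^sup>2)"
proof (cases "r \<le> 1")
  case True
  then have "r\<^sup>2 \<le> 1" using assms by (simp add: power_le_one)
  then have "\<bar>a\<bar> * (1 + r\<^sup>2) \<le> \<bar>C\<bar> * 2"
    using assms(2)[OF True] by (intro mult_mono) auto
  then show ?thesis by (simp add: pos_le_divide_eq add_pos_nonneg)
next
  case False
  then have "1 \<le> r\<^sup>2" by (simp add: one_le_power)
  then have "\<bar>a\<bar> * (1 + r\<^sup>2) \<le> 2 * (r\<^sup>2 * \<bar>a\<bar>)"
    using mult_right_mono[of 1 "r\<^sup>2" "\<bar>a\<bar>"] by (simp add: algebra_simps)
  also have "\<dots> \<le> 2 * max \<bar>C\<bar> \<bar>C'\<bar>" using assms(3) False by auto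
  finally show ?thesis by (simp add: pos_le_divide_eq add_pos_nonneg)
qed

lemma integrable_lposI:
  assumes "g \<in> borel_measurable borel"
    and "\<And>r. 0 < r \<Longrightarrow> r \<le> 1 \<Longrightarrow> \<bar>g r\<bar> \<le> C" "\<And>r. 1 \<le> r \<Longrightarrow> r\<^sup>2 * \<bar>g r\<bar> \<le> C'"
  shows "integrable lpos g"
proof (rule Bochner_Integration.integrable_bound[OF integrable_lpos_inverse_square])
  show "AE r in lpos. norm (g r) \<le> norm (2 * max \<bar>C\<bar> \<bar>C'\<bar> / (1 + r\<^sup>2))"
  proof (rule AE_I2)
    fix r assume "r \<in> space lpos"
    then have "\<bar>g r\<bar> \<le> 2 * max \<bar>C\<bar> \<bar>C'\<bar> / (1 + r\<^sup>2)"
      by (intro lpos_bound assms(2,3)) auto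
    then show "norm (g r) \<le> norm (2 * max \<bar>C\<bar> \<bar>C'\<bar> / (1 + r\<^sup>2))" by simp
  qed
qed (rule lpos_measurable[OF assms(1)])

section \<open>Locality of derivatives and the radial integrals\<close>

lemma directional_deriv_cong:
  assumes "open S" "x \<in> S" "\<And>z. z \<in> S \<Longrightarrow> f z = g z"
  shows "directional_deriv v f x = directional_deriv v g x"
  unfolding directional_deriv_def
proof (rule deriv_cong_ev)
  have "((\<lambda>t. x + t *\<^sub>R v) \<longlongrightarrow> x + 0 *\<^sub>R v) (nhds 0)"
    by (intro tendsto_intros filterlim_ident)
  then have "eventually (\<lambda>t. x + t *\<^sub>R v \<in> S) (nhds 0)"
    using assms(1,2) by (intro topological_tendstoD) auto
  then show "eventually (\<lambda>t. f (x + t *\<^sub>R v) = g (x + t *\<^sub>R v)) (nhds 0)"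
    by eventually_elim (rule assms(3))
qed simp

text \<open>The formulas for iterated Laplacians are available only away from the origin.
  Derivatives depend on germs, so equality on an open set is enough to iterate them.\<close>

lemma laplacian_cong:
  assumes "open S" "x \<in> S" "\<And>z. z \<in> S \<Longrightarrow> f z = g z"
  shows "laplacian f x = laplacian g x"
  unfolding laplacian_def
proof (rule sum.cong[OF refl])
  fix b :: 'a
  have "directional_deriv b f z = directional_deriv b g z" if "z \<in> S" for z
    by (rule directional_deriv_cong[OF assms(1) that assms(3)])
  then show "directional_deriv b (directional_deriv b f) x = directional_deriv b (directional_deriv b g) x"
    by (rule directional_deriv_cong[OF assms(1,2)])
qed

lemma directional_derivI:
  "((\<lambda>t. f (x + t *\<^sub>R v)) has_real_derivative D) (at 0) \<Longrightarrow> directional_deriv v f x = D"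
  unfolding directional_deriv_def by (rule DERIV_imp_deriv)

lemma directional_deriv_directional_deriv:
  assumes "\<And>z. z \<noteq> 0 \<Longrightarrow> ((\<lambda>t. f (z + t *\<^sub>R v)) has_real_derivative g z) (at 0)"
    and "((\<lambda>t. g (y + t *\<^sub>R v)) has_real_derivative D) (at 0)" "y \<noteq> 0"
  shows "directional_deriv v (directional_deriv v f) y = D"
proof -
  have "directional_deriv v (directional_deriv v f) y = directional_deriv v g y"
    by (rule directional_deriv_cong[of "- {0}"]) (use assms in \<open>auto intro: directional_derivI\<close>)
  with directional_derivI[OF assms(2)] show ?thesis by simp
qed

text \<open>With \<theta> = 0 and p = d-1-2m this is, up to a positive factor, John's solution. The
  general p and \<theta> make the family closed under differentiation: each derivative raises
  \<open>p\<close> by one and advances \<theta> by pi/2.\<close>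

definition radial :: "nat \<Rightarrow> real \<Rightarrow> ('a::euclidean_space \<Rightarrow> real) \<Rightarrow> 'a \<Rightarrow> real" where
  "radial p \<theta> f y = (\<integral>r. r ^ p * ft \<theta> f (r *\<^sub>R y) \<partial>lpos)"

lemma ft_plus_pi: "ft (\<theta> + pi) f y = - ft \<theta> f y"
proof -
  have "cos (y \<bullet> x + (\<theta> + pi)) = - cos (y \<bullet> x + \<theta>)" for x
    using cos_periodic_pi[of "y \<bullet> x + \<theta>"] by (simp add: add.assoc)
  then show ?thesis unfolding ft_def by simp
qed

context exp_weight
begin

text \<open>The decay estimate is used in the direction \<open>y\<close> itself. The condition on
  \<open>t\<close> keeps (y + t b) \<bullet> y \<ge> |y|^2 / 2, so one constant serves all nearby
  rays, as differentiation under the radial integral requires.\<close>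

lemma ray_decay:
  assumes f: "poly_exp R f" and y: "y \<noteq> 0"
  obtains C where "\<And>\<theta> r t. 1 \<le> r \<Longrightarrow> \<bar>t\<bar> * \<bar>b \<bullet> y\<bar> \<le> norm y ^ 2 / 2 \<Longrightarrow>
      r ^ N * \<bar>ft \<theta> f (r *\<^sub>R (y + t *\<^sub>R b))\<bar> \<le> C"
proof -
  obtain C where C: "\<And>\<theta> z. \<bar>z \<bullet> y\<bar> ^ N * \<bar>ft \<theta> f z\<bar> \<le> C"
    using poly_exp_ft_decay[OF f] by blast
  let ?k = "norm y ^ 2 / 2"
  have k: "?k > 0" using y by simp
  have "r ^ N * \<bar>ft \<theta> f (r *\<^sub>R (y + t *\<^sub>R b))\<bar> \<le> C / ?k ^ N"
    if r: "1 \<le> r" and t: "\<bar>t\<bar> * \<bar>b \<bullet> y\<bar> \<le> ?k" for \<theta> r t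
  proof -
    have "?k \<le> (y + t *\<^sub>R b) \<bullet> y"
      using t abs_mult[of t "b \<bullet> y"] by (simp add: inner_add_left power2_norm_eq_inner)
    then have "r * ?k \<le> r * ((y + t *\<^sub>R b) \<bullet> y)" using r by (intro mult_left_mono) auto
    also have "\<dots> \<le> \<bar>(r *\<^sub>R (y + t *\<^sub>R b)) \<bullet> y\<bar>" by simp
    finally have "(r * ?k) ^ N * \<bar>ft \<theta> f (r *\<^sub>R (y + t *\<^sub>R b))\<bar> \<le>
        \<bar>(r *\<^sub>R (y + t *\<^sub>R b)) \<bullet> y\<bar> ^ N * \<bar>ft \<theta> f (r *\<^sub>R (y + t *\<^sub>R b))\<bar>"
      using r k by (intro mult_right_mono power_mono) auto
    also have "\<dots> \<le> C" by (rule C)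
    finally have "?k ^ N * (r ^ N * \<bar>ft \<theta> f (r *\<^sub>R (y + t *\<^sub>R b))\<bar>) \<le> C"
      by (simp only: power_mult_distrib mult_ac)
    then show ?thesis using k by (simp only: pos_le_divide_eq zero_less_power mult.commute)
  qed
  then show ?thesis by (rule that)
qed

lemma ft_ray_measurable:
  assumes "poly_exp R f"
  shows "(\<lambda>r. ft \<theta> f (r *\<^sub>R y)) \<in> borel_measurable borel"
  by (rule measurable_compose[OF _ ft_measurable[OF assms]]) measurable

lemma radial_integrable:
  assumes f: "poly_exp R f" and y: "y \<noteq> 0" and [measurable]: "\<rho> \<in> borel_measurable borel"
    and big: "\<And>r. 1 \<le> r \<Longrightarrow> \<bar>\<rho> r\<bar> \<le> r ^ N"
    and small: "\<And>r. 0 < r \<Longrightarrow> r \<le> 1 \<Longrightarrow> \<bar>\<rho> r * ft \<theta> f (r *\<^sub>R y)\<bar> \<le> C"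
  shows "integrable lpos (\<lambda>r. \<rho> r * ft \<theta> f (r *\<^sub>R y))"
proof -
  obtain C' where C': "\<And>\<theta> r t. 1 \<le> r \<Longrightarrow> \<bar>t\<bar> * \<bar>0 \<bullet> y\<bar> \<le> norm y ^ 2 / 2 \<Longrightarrow>
      r ^ (N + 2) * \<bar>ft \<theta> f (r *\<^sub>R (y + t *\<^sub>R 0))\<bar> \<le> C'"
    using ray_decay[OF f y] by blast
  note [measurable] = ft_ray_measurable[OF f]
  show ?thesis
  proof (rule integrable_lposI[OF _ small])
    fix r :: real assume r: "1 \<le> r"
    have "r\<^sup>2 * \<bar>\<rho> r * ft \<theta> f (r *\<^sub>R y)\<bar> \<le> r\<^sup>2 * (r ^ N * \<bar>ft \<theta> f (r *\<^sub>R y)\<bar>)"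
      unfolding abs_mult using big[OF r] by (intro mult_left_mono mult_right_mono) auto
    also have "\<dots> = r ^ (N + 2) * \<bar>ft \<theta> f (r *\<^sub>R y)\<bar>" by (simp add: power_add power2_eq_square)
    also have "\<dots> \<le> C'" using C'[OF r, of 0 \<theta>] by simp
    finally show "r\<^sup>2 * \<bar>\<rho> r * ft \<theta> f (r *\<^sub>R y)\<bar> \<le> C'" .
  qed measurable
qed

text \<open>The summand \<open>k\<close> does not depend on the point and disappears in the
  derivative. It is the contribution of the reference point, which makes the integral converge at 0
  when the density \<rho> is singular there. Small r is controlled by \<open>small\<close>, large r
  by \<open>ray_decay\<close>.\<close>

lemma radial_has_derivative:
  assumes f: "poly_exp R f" and y: "y \<noteq> 0"
    and meas [measurable]: "\<rho> \<in> borel_measurable borel"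
    and big: "\<And>r. 1 \<le> r \<Longrightarrow> \<bar>\<rho> r\<bar> \<le> r ^ N"
    and small: "\<And>r z. 0 < r \<Longrightarrow> r \<le> 1 \<Longrightarrow> norm z \<le> norm y + norm b \<Longrightarrow>
      \<bar>\<rho> r * (r * ft (\<theta> + pi / 2) (\<lambda>x. (x \<bullet> b) * f x) (r *\<^sub>R z))\<bar> \<le> C"
    and int: "\<And>z. z \<noteq> 0 \<Longrightarrow> integrable lpos (\<lambda>r. k r + \<rho> r * ft \<theta> f (r *\<^sub>R z))"
  shows "((\<lambda>t. \<integral>r. k r + \<rho> r * ft \<theta> f (r *\<^sub>R (y + t *\<^sub>R b)) \<partial>lpos) has_real_derivative
      (\<integral>r. \<rho> r * (r * ft (\<theta> + pi / 2) (\<lambda>x. (x \<bullet> b) * f x) (r *\<^sub>R y)) \<partial>lpos)) (at 0)"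
proof -
  let ?g = "\<lambda>x. (x \<bullet> b) * f x"
  have g: "poly_exp R ?g" by (intro poly_exp_mult f real_polynomial_function_inner)
  obtain C' where C': "\<And>\<theta> r t. 1 \<le> r \<Longrightarrow> \<bar>t\<bar> * \<bar>b \<bullet> y\<bar> \<le> norm y ^ 2 / 2 \<Longrightarrow>
      r ^ (N + 3) * \<bar>ft \<theta> ?g (r *\<^sub>R (y + t *\<^sub>R b))\<bar> \<le> C'"
    using ray_decay[OF g y] by blast
  \<comment> \<open>The largest step that meets the condition of \<open>ray_decay\<close>; it also
    keeps y + t b away from the origin. The added 1 covers b \<bullet> y = 0.\<close>
  define e where "e = min 1 (norm y ^ 2 / (2 * (\<bar>b \<bullet> y\<bar> + 1)))"
  have e: "e > 0" "e \<le> 1" using y by (auto simp: e_def)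
  have et: "\<bar>t\<bar> * \<bar>b \<bullet> y\<bar> \<le> norm y ^ 2 / 2" if "\<bar>t\<bar> < e" for t
  proof -
    have "\<bar>t\<bar> * \<bar>b \<bullet> y\<bar> \<le> (norm y ^ 2 / (2 * (\<bar>b \<bullet> y\<bar> + 1))) * (\<bar>b \<bullet> y\<bar> + 1)"
      using that by (intro mult_mono) (auto simp: e_def)
    also have "\<dots> = norm y ^ 2 / 2" by (simp add: field_simps)
    finally show ?thesis .
  qed
  have nz: "y + t *\<^sub>R b \<noteq> 0" if "\<bar>t\<bar> < e" for t
  proof
    assume "y + t *\<^sub>R b = 0"
    then have "(y + t *\<^sub>R b) \<bullet> y = 0" by simp
    then have "norm y ^ 2 = - t * (b \<bullet> y)"
      by (simp add: inner_add_left power2_norm_eq_inner add_eq_0_iff2)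
    also have "\<dots> \<le> \<bar>t\<bar> * \<bar>b \<bullet> y\<bar>" by (metis abs_ge_self abs_minus_cancel abs_mult)
    finally have "norm y ^ 2 \<le> norm y ^ 2 / 2" using et[OF that] by linarith
    moreover have "norm y ^ 2 > 0" using y by simp
    ultimately show False by linarith
  qed
  have "((\<lambda>t. \<integral>r. k r + \<rho> r * ft \<theta> f (r *\<^sub>R (y + t *\<^sub>R b)) \<partial>lpos) has_real_derivative
      (\<integral>r. \<rho> r * (r * ft (\<theta> + pi / 2) ?g (r *\<^sub>R (y + 0 *\<^sub>R b))) \<partial>lpos)) (at 0)"
  proof (rule has_real_derivative_integral[OF e(1), where g = "\<lambda>r. 2 * max \<bar>C\<bar> \<bar>C'\<bar> / (1 + r\<^sup>2)"])
    show "(\<lambda>r. \<rho> r * (r * ft (\<theta> + pi / 2) ?g (r *\<^sub>R (y + 0 *\<^sub>R b)))) \<in> borel_measurable lpos"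
      using ft_ray_measurable[OF g] by (intro lpos_measurable) measurable
    show "integrable lpos (\<lambda>r. 2 * max \<bar>C\<bar> \<bar>C'\<bar> / (1 + r\<^sup>2))"
      by (rule integrable_lpos_inverse_square)
    fix t :: real assume "\<bar>t - 0\<bar> < e"
    then have t: "\<bar>t\<bar> < e" by simp
    show "integrable lpos (\<lambda>r. k r + \<rho> r * ft \<theta> f (r *\<^sub>R (y + t *\<^sub>R b)))"
      by (rule int[OF nz[OF t]])
    fix r :: real assume "r \<in> space lpos"
    then have r: "0 < r" by simp
    have "((\<lambda>s. ft \<theta> f (r *\<^sub>R y + s *\<^sub>R (r *\<^sub>R b))) has_real_derivative
        ft (\<theta> + pi / 2) (\<lambda>x. (x \<bullet> (r *\<^sub>R b)) * f x) (r *\<^sub>R y + t *\<^sub>R (r *\<^sub>R b))) (at t)"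
      by (rule ft_has_derivative[OF f])
    moreover have "ft (\<theta> + pi / 2) (\<lambda>x. (x \<bullet> (r *\<^sub>R b)) * f x) z = r * ft (\<theta> + pi / 2) ?g z" for z
      unfolding ft_def by (simp add: mult.assoc mult.left_commute[of _ r] flip: Bochner_Integration.integral_mult_right_zero)
    ultimately have d: "((\<lambda>s. ft \<theta> f (r *\<^sub>R (y + s *\<^sub>R b))) has_real_derivative
        r * ft (\<theta> + pi / 2) ?g (r *\<^sub>R (y + t *\<^sub>R b))) (at t)"
      by (simp add: scaleR_add_right mult.commute)
    show "((\<lambda>s. k r + \<rho> r * ft \<theta> f (r *\<^sub>R (y + s *\<^sub>R b))) has_real_derivative
        \<rho> r * (r * ft (\<theta> + pi / 2) ?g (r *\<^sub>R (y + t *\<^sub>R b)))) (at t)"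
      by (rule derivative_eq_intros d refl | simp)+
    show "\<bar>\<rho> r * (r * ft (\<theta> + pi / 2) ?g (r *\<^sub>R (y + t *\<^sub>R b)))\<bar> \<le> 2 * max \<bar>C\<bar> \<bar>C'\<bar> / (1 + r\<^sup>2)"
    proof (rule lpos_bound[OF r])
      have "norm (y + t *\<^sub>R b) \<le> norm y + \<bar>t\<bar> * norm b" by (metis norm_scaleR norm_triangle_ineq)
      also have "\<dots> \<le> norm y + norm b" using t e mult_right_mono[of "\<bar>t\<bar>" 1 "norm b"] by auto
      finally show "r \<le> 1 \<Longrightarrow> \<bar>\<rho> r * (r * ft (\<theta> + pi / 2) ?g (r *\<^sub>R (y + t *\<^sub>R b)))\<bar> \<le> C"
        using small[OF r] by blast
    next
      assume r1: "1 \<le> r"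
      let ?F = "\<bar>ft (\<theta> + pi / 2) ?g (r *\<^sub>R (y + t *\<^sub>R b))\<bar>"
      have "r\<^sup>2 * \<bar>\<rho> r * (r * ft (\<theta> + pi / 2) ?g (r *\<^sub>R (y + t *\<^sub>R b)))\<bar> = \<bar>\<rho> r\<bar> * (r ^ 3 * ?F)"
        using r by (simp add: abs_mult power3_eq_cube power2_eq_square)
      also have "\<dots> \<le> r ^ N * (r ^ 3 * ?F)" using big[OF r1] r by (intro mult_right_mono) auto
      also have "\<dots> = r ^ (N + 3) * ?F" by (simp add: power_add)
      also have "\<dots> \<le> C'" by (rule C'[OF r1 et[OF t]])
      finally show "r\<^sup>2 * \<bar>\<rho> r * (r * ft (\<theta> + pi / 2) ?g (r *\<^sub>R (y + t *\<^sub>R b)))\<bar> \<le> C'" .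
    qed
  qed
  then show ?thesis by simp
qed

lemma ft_sum_square:
  assumes f: "poly_exp R f"
  shows "(\<Sum>b\<in>Basis. ft \<theta> (\<lambda>x. (x \<bullet> b) * ((x \<bullet> b) * f x)) y) = ft \<theta> (\<lambda>x. norm x ^ 2 * f x) y"
proof -
  have i: "integrable lborel (\<lambda>x. cos (y \<bullet> x + \<theta>) * ((x \<bullet> b) * ((x \<bullet> b) * f x)))" for b
  proof -
    have "poly_exp R (\<lambda>x. (x \<bullet> b) * ((x \<bullet> b) * f x))"
      by (intro poly_exp_mult f real_polynomial_function_inner)
    then show ?thesis
      by (intro Bochner_Integration.integrable_bound[OF poly_exp_integrable] borel_measurable_times AE_I2)
        (use poly_exp_measurable[OF f] in \<open>auto intro!: mult_left_le_one_le simp: abs_mult\<close>)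
  qed
  have "norm x ^ 2 * f x = (\<Sum>b\<in>Basis. (x \<bullet> b) * ((x \<bullet> b) * f x))" for x
    unfolding power2_norm_eq_inner by (subst euclidean_inner) (simp add: sum_distrib_right mult.assoc)
  then show ?thesis
    unfolding ft_def using i by (simp add: sum_distrib_left Bochner_Integration.integral_sum)
qed

lemma radial_integrable_power:
  assumes f: "poly_exp R f" and y: "y \<noteq> 0"
  shows "integrable lpos (\<lambda>r. r ^ p * ft \<theta> f (r *\<^sub>R y))"
proof -
  obtain C where C: "\<And>\<theta> y. \<bar>ft \<theta> f y\<bar> \<le> C" using poly_exp_ft_bound[OF f] by blast
  show ?thesis
  proof (rule radial_integrable[OF f y, of _ p])
    fix r :: real assume "0 < r" "r \<le> 1"
    then have "\<bar>r ^ p\<bar> * \<bar>ft \<theta> f (r *\<^sub>R y)\<bar> \<le> 1 * C"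
      by (intro mult_mono C) (auto simp: power_le_one)
    then show "\<bar>r ^ p * ft \<theta> f (r *\<^sub>R y)\<bar> \<le> C" by (simp add: abs_mult)
  qed auto
qed

lemma sum_radial:
  assumes f: "poly_exp R f" and y: "y \<noteq> 0"
  shows "(\<Sum>b\<in>Basis. radial p \<theta> (\<lambda>x. (x \<bullet> b) * ((x \<bullet> b) * f x)) y) = radial p \<theta> (\<lambda>x. norm x ^ 2 * f x) y"
proof -
  have "integrable lpos (\<lambda>r. r ^ p * ft \<theta> (\<lambda>x. (x \<bullet> b) * ((x \<bullet> b) * f x)) (r *\<^sub>R y))" for b
    by (intro radial_integrable_power y poly_exp_mult f real_polynomial_function_inner)
  then show ?thesis
    unfolding radial_def
    by (simp add: Bochner_Integration.integral_sum[symmetric] sum_distrib_left[symmetric] ft_sum_square[OF f])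
qed

lemma radial_derivative:
  assumes f: "poly_exp R f" and y: "y \<noteq> 0"
  shows "((\<lambda>t. A * radial p \<theta> f (y + t *\<^sub>R b)) has_real_derivative
      A * radial (Suc p) (\<theta> + pi / 2) (\<lambda>x. (x \<bullet> b) * f x) y) (at 0)"
proof -
  have g: "poly_exp R (\<lambda>x. (x \<bullet> b) * f x)" by (intro poly_exp_mult f real_polynomial_function_inner)
  obtain C where C: "\<And>\<theta> y. \<bar>ft \<theta> (\<lambda>x. (x \<bullet> b) * f x) y\<bar> \<le> C" using poly_exp_ft_bound[OF g] by blast
  have "((\<lambda>t. \<integral>r. 0 + r ^ p * ft \<theta> f (r *\<^sub>R (y + t *\<^sub>R b)) \<partial>lpos) has_real_derivative
      (\<integral>r. r ^ p * (r * ft (\<theta> + pi / 2) (\<lambda>x. (x \<bullet> b) * f x) (r *\<^sub>R y)) \<partial>lpos)) (at 0)"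
  proof (rule radial_has_derivative[OF f y, where N = p])
    fix r :: real and z assume "0 < r" "r \<le> 1"
    then have "\<bar>r ^ Suc p\<bar> * \<bar>ft (\<theta> + pi / 2) (\<lambda>x. (x \<bullet> b) * f x) (r *\<^sub>R z)\<bar> \<le> 1 * C"
      by (intro mult_mono C) (auto simp: power_le_one simp del: power_Suc)
    then show "\<bar>r ^ p * (r * ft (\<theta> + pi / 2) (\<lambda>x. (x \<bullet> b) * f x) (r *\<^sub>R z))\<bar> \<le> C"
      by (simp add: abs_mult mult_ac)
  qed (use radial_integrable_power[OF f] in auto)
  then show ?thesis
    unfolding radial_def by (intro DERIV_cmult) (simp add: mult_ac)
qed

text \<open>Two derivatives advance the phase by pi, that is, they change the sign, and contribute
  r^2 (x \<bullet> b)^2. Summation over the basis gives r^2 |x|^2.\<close>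

lemma neg_laplacian_radial:
  assumes f: "poly_exp R f" and y: "y \<noteq> 0"
  shows "- laplacian (\<lambda>y. A * radial p \<theta> f y) y = A * radial (p + 2) \<theta> (\<lambda>x. norm x ^ 2 * f x) y"
proof -
  have "directional_deriv b (directional_deriv b (\<lambda>y. A * radial p \<theta> f y)) y =
      A * radial (Suc (Suc p)) (\<theta> + pi / 2 + pi / 2) (\<lambda>x. (x \<bullet> b) * ((x \<bullet> b) * f x)) y" for b
    by (rule directional_deriv_directional_deriv[OF radial_derivative radial_derivative])
      (use f y in \<open>auto intro!: poly_exp_mult real_polynomial_function_inner\<close>)
  moreover have "\<theta> + pi / 2 + pi / 2 = \<theta> + pi" by simp
  moreover have "radial q (\<theta> + pi) h z = - radial q \<theta> h z" for q h and z :: 'a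
    unfolding radial_def by (simp add: ft_plus_pi)
  ultimately show ?thesis
    unfolding laplacian_def using sum_radial[OF f y]
    by (simp add: sum_negf sum_distrib_left[symmetric])
qed

text \<open>The kernel is a sine and vanishes to first order at z = 0. Together with the factor r of
  the derivative this compensates a density as singular as 1/r^2.\<close>

lemma ft_half_pi_bound:
  assumes f: "poly_exp R f"
  obtains C where "C \<ge> 0" "\<And>z. \<bar>ft (pi / 2) f z\<bar> \<le> norm z * C"
proof
  let ?C = "\<integral>x. \<bar>norm x ^ 2 * f x\<bar> + \<bar>f x\<bar> \<partial>lborel"
  have i: "integrable lborel (\<lambda>x. \<bar>norm x ^ 2 * f x\<bar> + \<bar>f x\<bar>)"
    using poly_exp_integrable[OF f] poly_exp_integrable[OF poly_exp_mult[OF f real_polynomial_function_norm_power[of 1]]]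
    by auto
  show "?C \<ge> 0" by (intro integral_nonneg_AE) auto
  fix z :: 'a
  have "\<bar>ft (pi / 2) f z\<bar> \<le> (\<integral>x. \<bar>cos (z \<bullet> x + pi / 2) * f x\<bar> \<partial>lborel)"
    unfolding ft_def by (rule integral_abs_bound)
  also have "\<dots> \<le> (\<integral>x. norm z * (\<bar>norm x ^ 2 * f x\<bar> + \<bar>f x\<bar>) \<partial>lborel)"
  proof (rule Bochner_Integration.integral_mono')
    show "integrable lborel (\<lambda>x. norm z * (\<bar>norm x ^ 2 * f x\<bar> + \<bar>f x\<bar>))"
      using i by (rule integrable_mult_right)
    fix x :: 'a
    have "\<bar>cos (z \<bullet> x + pi / 2)\<bar> \<le> \<bar>z \<bullet> x\<bar>" by (simp add: cos_add abs_sin_x_le_abs_x)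
    also have "\<dots> \<le> norm z * norm x" by (rule Cauchy_Schwarz_ineq2)
    \<comment> \<open>The odd power of the norm is not a polynomial; it is replaced by even ones so
      that the majorant stays in the class \<open>poly_exp R\<close>.\<close>
    also have "norm x \<le> norm x ^ 2 + 1"
      by (smt (verit) power2_eq_square mult_le_cancel_left1 norm_ge_zero zero_le_power2 self_le_power pos2)
    finally have "\<bar>cos (z \<bullet> x + pi / 2)\<bar> * \<bar>f x\<bar> \<le> norm z * (norm x ^ 2 + 1) * \<bar>f x\<bar>"
      by (simp add: mult_left_mono mult_right_mono)
    then show "\<bar>cos (z \<bullet> x + pi / 2) * f x\<bar> \<le> norm z * (\<bar>norm x ^ 2 * f x\<bar> + \<bar>f x\<bar>)"
      by (simp add: abs_mult algebra_simps)
  qed auto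
  finally show "\<bar>ft (pi / 2) f z\<bar> \<le> norm z * ?C" by simp
qed

text \<open>1 - cos s vanishes to second order, so the difference of two values of the cosine
  transform along rays is of order r^2 near r = 0.\<close>

lemma ft_0_diff_bound:
  assumes f: "poly_exp R f"
  obtains C where "C \<ge> 0" "\<And>z z'. \<bar>ft 0 f z - ft 0 f z'\<bar> \<le> (norm z ^ 2 + norm z' ^ 2) * C"
proof
  let ?C = "\<integral>x. \<bar>norm x ^ 2 * f x\<bar> \<partial>lborel"
  have i: "integrable lborel (\<lambda>x. \<bar>norm x ^ 2 * f x\<bar>)"
    using poly_exp_integrable[OF poly_exp_mult[OF f real_polynomial_function_norm_power[of 1]]]
    by auto
  show "?C \<ge> 0" by (intro integral_nonneg_AE) auto
  fix z z' :: 'a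
  have j: "integrable lborel (\<lambda>x. cos (z \<bullet> x) * f x)" for z
    by (rule Bochner_Integration.integrable_bound[OF poly_exp_integrable[OF f]])
      (use poly_exp_measurable[OF f] in \<open>auto simp: abs_mult mult_left_le_one_le\<close>)
  have "\<bar>ft 0 f z - ft 0 f z'\<bar> = \<bar>\<integral>x. cos (z \<bullet> x) * f x - cos (z' \<bullet> x) * f x \<partial>lborel\<bar>"
    unfolding ft_def using j by simp
  also have "\<dots> \<le> (\<integral>x. \<bar>cos (z \<bullet> x) * f x - cos (z' \<bullet> x) * f x\<bar> \<partial>lborel)"
    by (rule integral_abs_bound)
  also have "\<dots> \<le> (\<integral>x. (norm z ^ 2 + norm z' ^ 2) * \<bar>norm x ^ 2 * f x\<bar> \<partial>lborel)"
  proof (rule Bochner_Integration.integral_mono')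
    show "integrable lborel (\<lambda>x. (norm z ^ 2 + norm z' ^ 2) * \<bar>norm x ^ 2 * f x\<bar>)"
      using i by (rule integrable_mult_right)
    fix x :: 'a
    have q: "(z \<bullet> x)\<^sup>2 \<le> norm z ^ 2 * norm x ^ 2" for z :: 'a
      by (metis Cauchy_Schwarz_ineq power2_norm_eq_inner)
    have "\<bar>cos (z \<bullet> x) - cos (z' \<bullet> x)\<bar> \<le> (norm z ^ 2 + norm z' ^ 2) * norm x ^ 2"
    proof -
      have "cos u - cos w \<le> w\<^sup>2" for u w :: real
        using diff_right_mono[OF cos_le_one] one_minus_cos_le by (rule order.trans)
      from this[of "z \<bullet> x" "z' \<bullet> x"] this[of "z' \<bullet> x" "z \<bullet> x"]
      have "\<bar>cos (z \<bullet> x) - cos (z' \<bullet> x)\<bar> \<le> (z \<bullet> x)\<^sup>2 + (z' \<bullet> x)\<^sup>2"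
        by (smt (verit) zero_le_power2)
      with q[of z] q[of z'] show ?thesis by (simp add: distrib_right)
    qed
    then have "\<bar>cos (z \<bullet> x) - cos (z' \<bullet> x)\<bar> * \<bar>f x\<bar> \<le> (norm z ^ 2 + norm z' ^ 2) * norm x ^ 2 * \<bar>f x\<bar>"
      by (rule mult_right_mono) simp
    then show "\<bar>cos (z \<bullet> x) * f x - cos (z' \<bullet> x) * f x\<bar> \<le> (norm z ^ 2 + norm z' ^ 2) * \<bar>norm x ^ 2 * f x\<bar>"
      by (simp add: abs_mult mult.assoc flip: left_diff_distrib)
  qed auto
  finally show "\<bar>ft 0 f z - ft 0 f z'\<bar> \<le> (norm z ^ 2 + norm z' ^ 2) * ?C" by simp
qed

text \<open>The exponent e = 2 belongs to the absolute value (odd dimension), e = 1 to the logarithm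
  (even dimension). Near 0 the difference of order r^2 cancels the singularity; for large r both
  transforms decay separately.\<close>

lemma integrable_ft_diff:
  assumes f: "poly_exp R f" and y: "y \<noteq> 0" "y1 \<noteq> 0" and e: "e = 1 \<or> e = 2"
  shows "integrable lpos (\<lambda>r. (ft 0 f (r *\<^sub>R y1) - ft 0 f (r *\<^sub>R y)) / r ^ e)"
proof -
  obtain C where C: "C \<ge> 0" "\<And>z z'. \<bar>ft 0 f z - ft 0 f z'\<bar> \<le> (norm z ^ 2 + norm z' ^ 2) * C"
    using ft_0_diff_bound[OF f] by blast
  obtain C1 where C1: "\<And>\<theta> r t. 1 \<le> r \<Longrightarrow> \<bar>t\<bar> * \<bar>0 \<bullet> y\<bar> \<le> norm y ^ 2 / 2 \<Longrightarrow>
      r ^ 2 * \<bar>ft \<theta> f (r *\<^sub>R (y + t *\<^sub>R 0))\<bar> \<le> C1"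
    using ray_decay[OF f y(1)] by blast
  obtain C2 where C2: "\<And>\<theta> r t. 1 \<le> r \<Longrightarrow> \<bar>t\<bar> * \<bar>0 \<bullet> y1\<bar> \<le> norm y1 ^ 2 / 2 \<Longrightarrow>
      r ^ 2 * \<bar>ft \<theta> f (r *\<^sub>R (y1 + t *\<^sub>R 0))\<bar> \<le> C2"
    using ray_decay[OF f y(2)] by blast
  note [measurable] = ft_ray_measurable[OF f]
  show ?thesis
  proof (rule integrable_lposI)
    fix r :: real assume r: "0 < r" "r \<le> 1"
    let ?D = "\<bar>ft 0 f (r *\<^sub>R y1) - ft 0 f (r *\<^sub>R y)\<bar>"
    have "r ^ 2 \<le> r ^ e" using e r by (auto intro!: power_decreasing)
    have "?D \<le> (norm y1 ^ 2 + norm y ^ 2) * C * r ^ 2"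
      using C(2)[of "r *\<^sub>R y1" "r *\<^sub>R y"] by (simp add: power_mult_distrib algebra_simps)
    also have "\<dots> \<le> (norm y1 ^ 2 + norm y ^ 2) * C * r ^ e"
      using C(1) \<open>r ^ 2 \<le> r ^ e\<close> by (intro mult_left_mono) auto
    finally show "\<bar>(ft 0 f (r *\<^sub>R y1) - ft 0 f (r *\<^sub>R y)) / r ^ e\<bar> \<le> (norm y1 ^ 2 + norm y ^ 2) * C"
      using r by (simp add: pos_divide_le_eq)
  next
    fix r :: real assume r: "1 \<le> r"
    have "1 \<le> r ^ e" using r by (rule one_le_power)
    have "r\<^sup>2 * \<bar>(ft 0 f (r *\<^sub>R y1) - ft 0 f (r *\<^sub>R y)) / r ^ e\<bar> \<le> r\<^sup>2 * (\<bar>ft 0 f (r *\<^sub>R y1) - ft 0 f (r *\<^sub>R y)\<bar> / 1)"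
      unfolding abs_divide using r \<open>1 \<le> r ^ e\<close> by (intro mult_left_mono divide_left_mono) auto
    also have "\<dots> \<le> r\<^sup>2 * (\<bar>ft 0 f (r *\<^sub>R y1)\<bar> + \<bar>ft 0 f (r *\<^sub>R y)\<bar>)" by (intro mult_left_mono) auto
    also have "\<dots> \<le> C2 + C1"
      using C1[OF r, of 0 0] C2[OF r, of 0 0] by (simp add: distrib_left)
    finally show "r\<^sup>2 * \<bar>(ft 0 f (r *\<^sub>R y1) - ft 0 f (r *\<^sub>R y)) / r ^ e\<bar> \<le> C2 + C1" .
  qed measurable
qed

text \<open>The first derivative \<open>H\<close> drops the reference term and has a sine kernel,
  whose first-order zero keeps the density harmless. The second derivative brings another factor r,
  and r^2 / r^e is a genuine power, so the result is an ordinary radial integral.\<close>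

lemma neg_laplacian_ft_diff:
  assumes f: "poly_exp R f" and y: "y \<noteq> 0" "y1 \<noteq> 0" and e: "e = 1 \<or> e = (2::nat)"
  shows "- laplacian (\<lambda>y. K + A * (\<integral>r. (ft 0 f (r *\<^sub>R y1) - ft 0 f (r *\<^sub>R y)) / r ^ e \<partial>lpos)) y =
    - A * radial (2 - e) 0 (\<lambda>x. norm x ^ 2 * f x) y"
proof -
  let ?xf = "\<lambda>b x. (x \<bullet> b) * f x" and ?xxf = "\<lambda>b x. (x \<bullet> b) * ((x \<bullet> b) * f x)"
  have xf: "poly_exp R (?xf b)" for b by (intro poly_exp_mult f real_polynomial_function_inner)
  have xxf: "poly_exp R (?xxf b)" for b by (intro poly_exp_mult f real_polynomial_function_inner)
  define H where "H b z = (\<integral>r. - (1 / r ^ e) * (r * ft (0 + pi / 2) (?xf b) (r *\<^sub>R z)) \<partial>lpos)" for b z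
  have small: "\<exists>C. \<forall>r z. 0 < r \<longrightarrow> r \<le> 1 \<longrightarrow> norm z \<le> B \<longrightarrow>
      \<bar>- (1 / r ^ e) * (r * ft (0 + pi / 2) (?xf b) (r *\<^sub>R z))\<bar> \<le> C" for b B
  proof -
    obtain C where C: "C \<ge> 0" "\<And>z. \<bar>ft (pi / 2) (?xf b) z\<bar> \<le> norm z * C"
      using ft_half_pi_bound[OF xf] by blast
    have "\<bar>- (1 / r ^ e) * (r * ft (0 + pi / 2) (?xf b) (r *\<^sub>R z))\<bar> \<le> B * C"
      if r: "0 < r" "r \<le> 1" and z: "norm z \<le> B" for r z
    proof -
      have "r * r \<le> r ^ e" using e r by (auto simp: power2_eq_square mult_left_le)
      have "\<bar>r * ft (pi / 2) (?xf b) (r *\<^sub>R z)\<bar> = r * \<bar>ft (pi / 2) (?xf b) (r *\<^sub>R z)\<bar>"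
        using r by (simp add: abs_mult)
      also have "\<dots> \<le> r * (norm (r *\<^sub>R z) * C)" using r by (intro mult_left_mono C) auto
      also have "\<dots> = (norm z * C) * (r * r)" using r by simp
      also have "\<dots> \<le> (B * C) * r ^ e"
        using z C(1) r order.trans[OF norm_ge_zero z] \<open>r * r \<le> r ^ e\<close> by (intro mult_mono) auto
      finally show ?thesis using r by (simp add: abs_mult pos_divide_le_eq)
    qed
    then show ?thesis by blast
  qed
  have le1: "\<bar>- (1 / r ^ e)\<bar> \<le> r ^ 0" if "1 \<le> r" for r :: real
    using that by (simp add: one_le_power)
  have d1: "((\<lambda>t. K + A * (\<integral>r. (ft 0 f (r *\<^sub>R y1) - ft 0 f (r *\<^sub>R (z + t *\<^sub>R b))) / r ^ e \<partial>lpos))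
      has_real_derivative A * H b z) (at 0)" if z: "z \<noteq> 0" for b z
  proof -
    obtain C where C: "\<forall>r u. 0 < r \<longrightarrow> r \<le> 1 \<longrightarrow> norm u \<le> norm z + norm b \<longrightarrow>
      \<bar>- (1 / r ^ e) * (r * ft (0 + pi / 2) (?xf b) (r *\<^sub>R u))\<bar> \<le> C" using small by blast
    have "((\<lambda>t. \<integral>r. ft 0 f (r *\<^sub>R y1) / r ^ e + - (1 / r ^ e) * ft 0 f (r *\<^sub>R (z + t *\<^sub>R b)) \<partial>lpos)
        has_real_derivative H b z) (at 0)"
      unfolding H_def
    proof (rule radial_has_derivative[OF f z _ le1])
      fix w :: 'a assume "w \<noteq> 0"
      then show "integrable lpos (\<lambda>r. ft 0 f (r *\<^sub>R y1) / r ^ e + - (1 / r ^ e) * ft 0 f (r *\<^sub>R w))"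
        using integrable_ft_diff[OF f _ y(2) e] by (simp add: diff_divide_distrib)
    qed (use C in auto)
    then have "((\<lambda>t. \<integral>r. (ft 0 f (r *\<^sub>R y1) - ft 0 f (r *\<^sub>R (z + t *\<^sub>R b))) / r ^ e \<partial>lpos)
        has_real_derivative H b z) (at 0)"
      by (simp add: diff_divide_distrib)
    then show ?thesis by (auto intro!: derivative_eq_intros)
  qed
  have powr: "(1 / r ^ e) * r * r = r ^ (2 - e)" if "0 < r" for r :: real
    using e that by (auto simp: power2_eq_square)
  have d2: "((\<lambda>t. A * H b (y + t *\<^sub>R b)) has_real_derivative A * radial (2 - e) 0 (?xxf b) y) (at 0)" for b
  proof -
    obtain C where C: "\<And>\<theta> z. \<bar>ft \<theta> (?xxf b) z\<bar> \<le> C" using poly_exp_ft_bound[OF xxf] by blast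
    have "((\<lambda>t. \<integral>r. 0 + (- (1 / r ^ e) * r) * ft (0 + pi / 2) (?xf b) (r *\<^sub>R (y + t *\<^sub>R b)) \<partial>lpos)
      has_real_derivative (\<integral>r. (- (1 / r ^ e) * r) * (r * ft (0 + pi / 2 + pi / 2) (?xxf b) (r *\<^sub>R y)) \<partial>lpos)) (at 0)"
    proof (rule radial_has_derivative[OF xf y(1), where N = 1])
      fix r :: real assume r: "1 \<le> r"
      have "\<bar>- (1 / r ^ e)\<bar> * r \<le> r ^ 0 * r" using le1[OF r] r by (intro mult_right_mono) auto
      then show "\<bar>- (1 / r ^ e) * r\<bar> \<le> r ^ 1" using r by (simp add: abs_mult)
    next
      fix r :: real and z assume r: "0 < r" "r \<le> 1"
      have "\<bar>- (1 / r ^ e) * r * (r * ft (0 + pi / 2 + pi / 2) (?xxf b) (r *\<^sub>R z))\<bar> =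
          \<bar>((1 / r ^ e) * r * r) * ft (0 + pi / 2 + pi / 2) (?xxf b) (r *\<^sub>R z)\<bar>"
        by (simp add: abs_mult)
      also have "\<dots> = r ^ (2 - e) * \<bar>ft (0 + pi / 2 + pi / 2) (?xxf b) (r *\<^sub>R z)\<bar>"
        using r by (simp only: powr abs_mult) simp
      also have "\<dots> \<le> 1 * C" using r by (intro mult_mono C) (auto simp: power_le_one)
      finally show "\<bar>- (1 / r ^ e) * r * (r * ft (0 + pi / 2 + pi / 2) (?xxf b) (r *\<^sub>R z))\<bar> \<le> C" by simp
    next
      fix z :: 'a assume z: "z \<noteq> 0"
      obtain C where C: "\<forall>r u. 0 < r \<longrightarrow> r \<le> 1 \<longrightarrow> norm u \<le> norm z \<longrightarrow>
        \<bar>- (1 / r ^ e) * (r * ft (0 + pi / 2) (?xf b) (r *\<^sub>R u))\<bar> \<le> C" using small by blast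
      show "integrable lpos (\<lambda>r. 0 + (- (1 / r ^ e) * r) * ft (0 + pi / 2) (?xf b) (r *\<^sub>R z))"
        unfolding add_0_left
      proof (rule radial_integrable[OF xf z, where N = 1])
        fix r :: real assume r: "1 \<le> r"
        have "\<bar>- (1 / r ^ e)\<bar> * r \<le> r ^ 0 * r" using le1[OF r] r by (intro mult_right_mono) auto
        then show "\<bar>- (1 / r ^ e) * r\<bar> \<le> r ^ 1" using r by (simp add: abs_mult)
      qed (use C in \<open>auto simp: mult.assoc\<close>)
    qed measurable
    moreover have "(\<integral>r. (- (1 / r ^ e) * r) * (r * ft (0 + pi / 2 + pi / 2) (?xxf b) (r *\<^sub>R y)) \<partial>lpos) =
        radial (2 - e) 0 (?xxf b) y"
      unfolding radial_def
    proof (rule Bochner_Integration.integral_cong[OF refl])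
      fix r assume "r \<in> space lpos"
      then have r: "0 < r" by simp
      have "ft (0 + pi / 2 + pi / 2) (?xxf b) (r *\<^sub>R y) = - ft 0 (?xxf b) (r *\<^sub>R y)"
        using ft_plus_pi[of 0] by simp
      then show "(- (1 / r ^ e) * r) * (r * ft (0 + pi / 2 + pi / 2) (?xxf b) (r *\<^sub>R y)) =
          r ^ (2 - e) * ft 0 (?xxf b) (r *\<^sub>R y)"
        using powr[OF r, symmetric] by simp
    qed
    ultimately show ?thesis
      unfolding H_def by (intro DERIV_cmult) (simp add: mult.assoc)
  qed
  have "directional_deriv b (directional_deriv b
      (\<lambda>y. K + A * (\<integral>r. (ft 0 f (r *\<^sub>R y1) - ft 0 f (r *\<^sub>R y)) / r ^ e \<partial>lpos))) y =
      A * radial (2 - e) 0 (?xxf b) y" for b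
    by (rule directional_deriv_directional_deriv[OF d1 d2 y(1)])
  then show ?thesis
    unfolding laplacian_def using sum_radial[OF f y(1)]
    by (simp add: sum_distrib_left[symmetric])
qed

text \<open>The first Laplacian removes \<open>K\<close>, the reference point and the singular
  density; the remaining ones act by \<open>neg_laplacian_radial\<close>. This is why the count is a
  successor; the natural subtraction is exact since e \<le> 2.\<close>

lemma neg_laplacian_iterate:
  assumes f: "poly_exp R f" and e: "e = 1 \<or> e = (2::nat)" and y1: "y1 \<noteq> 0"
    and F: "\<And>y. y \<noteq> 0 \<Longrightarrow> F y = K + A * (\<integral>r. (ft 0 f (r *\<^sub>R y1) - ft 0 f (r *\<^sub>R y)) / r ^ e \<partial>lpos)"
    and y: "y \<noteq> 0"
  shows "((\<lambda>f y. - laplacian f y) ^^ Suc j) F y =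
    - A * radial (2 * Suc j - e) 0 (\<lambda>x. norm x ^ (2 * Suc j) * f x) y"
  using y
proof (induction j arbitrary: y)
  case 0
  have "laplacian F y = laplacian (\<lambda>y. K + A * (\<integral>r. (ft 0 f (r *\<^sub>R y1) - ft 0 f (r *\<^sub>R y)) / r ^ e \<partial>lpos)) y"
    by (rule laplacian_cong[of "- {0}"]) (use 0 F in auto)
  then show ?case using neg_laplacian_ft_diff[OF f 0 y1 e, of K A] by simp
next
  case (Suc j)
  let ?G = "\<lambda>y. - A * radial (2 * Suc j - e) 0 (\<lambda>x. norm x ^ (2 * Suc j) * f x) y"
  have g: "poly_exp R (\<lambda>x. norm x ^ (2 * Suc j) * f x)"
    by (rule poly_exp_mult[OF f real_polynomial_function_norm_power])
  have "((\<lambda>f y. - laplacian f y) ^^ Suc (Suc j)) F y = - laplacian (((\<lambda>f y. - laplacian f y) ^^ Suc j) F) y"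
    by simp
  also have "\<dots> = - laplacian ?G y"
    by (subst laplacian_cong[of "- {0}" _ _ ?G]) (use Suc in auto)
  also have "\<dots> = - A * radial (2 * Suc j - e + 2) 0 (\<lambda>x. norm x ^ 2 * (norm x ^ (2 * Suc j) * f x)) y"
    by (rule neg_laplacian_radial[OF g Suc.prems])
  also have "2 * Suc j - e + 2 = 2 * Suc (Suc j) - e" using e by auto
  also have "(\<lambda>x. norm x ^ 2 * (norm x ^ (2 * Suc j) * f x)) = (\<lambda>x. norm x ^ (2 * Suc (Suc j)) * f x)"
    by (simp add: power_add[symmetric] power2_eq_square mult.assoc)
  finally show ?case .
qed

end

section \<open>Plane waves\<close>

lemma measurable_lborel_lpos:
  assumes "f \<in> borel_measurable (borel \<Otimes>\<^sub>M borel)"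
  shows "f \<in> borel_measurable (lborel \<Otimes>\<^sub>M lpos)"
proof -
  have "(\<lambda>p. (fst p, snd p)) \<in> lborel \<Otimes>\<^sub>M lpos \<rightarrow>\<^sub>M borel \<Otimes>\<^sub>M borel"
  proof (rule measurable_Pair)
    show "snd \<in> lborel \<Otimes>\<^sub>M lpos \<rightarrow>\<^sub>M borel"
      by (rule measurable_compose[OF measurable_snd lpos_measurable]) simp
    show "fst \<in> lborel \<Otimes>\<^sub>M lpos \<rightarrow>\<^sub>M borel"
      by (rule measurable_compose[OF measurable_fst]) simp
  qed
  from measurable_compose[OF this assms] show ?thesis by simp
qed

lemma Fubini_product_bound:
  fixes f :: "'a \<Rightarrow> 'b \<Rightarrow> real"
  assumes "sigma_finite_measure M" "sigma_finite_measure N"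
    and meas: "case_prod f \<in> borel_measurable (M \<Otimes>\<^sub>M N)"
    and bd: "\<And>x y. x \<in> space M \<Longrightarrow> y \<in> space N \<Longrightarrow> \<bar>f x y\<bar> \<le> g x * h y"
    and g: "integrable M g" and h: "integrable N h"
  shows "integrable (M \<Otimes>\<^sub>M N) (case_prod f)"
    and "(\<integral>y. (\<integral>x. f x y \<partial>M) \<partial>N) = (\<integral>x. (\<integral>y. f x y \<partial>N) \<partial>M)"
    and "integrable N (\<lambda>y. \<integral>x. f x y \<partial>M)" and "integrable M (\<lambda>x. \<integral>y. f x y \<partial>N)"
proof -
  interpret pair_sigma_finite M N using assms(1,2) by (simp add: pair_sigma_finite_def)
  note [measurable] = borel_measurable_integrable[OF g] borel_measurable_integrable[OF h]
  have "integrable (M \<Otimes>\<^sub>M N) (\<lambda>p. g (fst p) * h (snd p))"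
  proof (rule Fubini_integrable)
    show "integrable M (\<lambda>x. \<integral>y. norm (g (fst (x, y)) * h (snd (x, y))) \<partial>N)"
      using g by (simp add: abs_mult)
    show "AE x in M. integrable N (\<lambda>y. g (fst (x, y)) * h (snd (x, y)))"
      using h by simp
  qed measurable
  then show i: "integrable (M \<Otimes>\<^sub>M N) (case_prod f)"
  proof (rule Bochner_Integration.integrable_bound[OF _ meas], intro AE_I2)
    fix p assume "p \<in> space (M \<Otimes>\<^sub>M N)"
    then have "\<bar>f (fst p) (snd p)\<bar> \<le> g (fst p) * h (snd p)" 
      by (intro bd) (auto simp: space_pair_measure)
    then show "norm (case_prod f p) \<le> norm (g (fst p) * h (snd p))"
      by (simp add: case_prod_beta)
  qed
  show "(\<integral>y. (\<integral>x. f x y \<partial>M) \<partial>N) = (\<integral>x. (\<integral>y. f x y \<partial>N) \<partial>M)"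
    by (rule Fubini_integral[OF i])
  show "integrable N (\<lambda>y. \<integral>x. f x y \<partial>M)" by (rule integrable_snd[OF i])
  show "integrable M (\<lambda>x. \<integral>y. f x y \<partial>N)" by (rule integrable_fst[OF i])
qed

lemma integral_lpos: "integral\<^sup>L lpos f = (\<integral>r. indicator {0<..} r * f r \<partial>lborel)" for f :: "real \<Rightarrow> real"
  unfolding lpos_def by (subst integral_restrict_space) auto

lemma integrable_lpos_iff: "integrable lpos f \<longleftrightarrow> integrable lborel (\<lambda>r. indicator {0<..} r * f r)" for f :: "real \<Rightarrow> real"
  unfolding lpos_def by (subst integrable_restrict_space) auto

lemma integral_lpos_scale:
  fixes f :: "real \<Rightarrow> real"
  assumes "s > 0"
  shows "(\<integral>r. f (s * r) \<partial>lpos) = (\<integral>r. f r \<partial>lpos) / s"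
proof -
  have "(\<integral>r. f r \<partial>lpos) = \<bar>s\<bar> *\<^sub>R (\<integral>r. indicator {0<..} (0 + s * r) * f (0 + s * r) \<partial>lborel)"
    unfolding integral_lpos by (rule lborel_integral_real_affine) (use assms in auto)
  also have "(\<lambda>r. indicator {0<..} (0 + s * r) * f (0 + s * r)) = (\<lambda>r. indicator {0<..} r * f (s * r))"
    using assms by (auto simp: indicator_def zero_less_mult_iff)
  finally show ?thesis using assms unfolding integral_lpos by simp
qed

lemma integrable_lpos_exp: "\<epsilon> > 0 \<Longrightarrow> integrable lpos (\<lambda>r. exp (- \<epsilon> * r))"
  using integrable_I0i_exp_mscale[of \<epsilon>]
  by (simp add: integrable_lpos_iff set_integrable_def mult.commute)

text \<open>The phase lets one computation serve twice: \<theta> = 0 gives the Poisson kernel of the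
  descent, \<theta> = - pi/2 the Laplace transform of the sine for the logarithm.\<close>

lemma integral_lpos_exp_cos:
  assumes e: "\<epsilon> > 0"
  shows "(\<integral>r. exp (- \<epsilon> * r) * cos (r * s + \<theta>) \<partial>lpos) = (\<epsilon> * cos \<theta> - s * sin \<theta>) / (\<epsilon>\<^sup>2 + s\<^sup>2)"
proof -
  let ?D = "\<epsilon>\<^sup>2 + s\<^sup>2"
  let ?F = "\<lambda>r. exp (- \<epsilon> * r) * (s * sin (r * s + \<theta>) - \<epsilon> * cos (r * s + \<theta>)) / ?D"
  let ?f = "\<lambda>r. exp (- \<epsilon> * r) * cos (r * s + \<theta>)"
  have D: "?D > 0" using e by (simp add: add_pos_nonneg)
  have int: "integrable lpos ?f"
    by (rule Bochner_Integration.integrable_bound[OF integrable_lpos_exp[OF e]])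
      (auto intro!: lpos_measurable simp: abs_mult)
  have "(\<integral>r. ?f r \<partial>lpos) = (LBINT r=0..\<infinity>. ?f r)"
    unfolding integral_lpos interval_lebesgue_integral_0_infty set_lebesgue_integral_def by simp
  also have "\<dots> = 0 - ?F 0"
  proof (rule interval_integral_FTC_integrable)
    show "set_integrable lborel (einterval 0 \<infinity>) ?f"
      using int by (simp add: integrable_lpos_iff set_integrable_def einterval_def zero_ereal_def greaterThan_def)
    fix r :: real
    have "(?F has_real_derivative ((- \<epsilon> * exp (- \<epsilon> * r)) * (s * sin (r * s + \<theta>) - \<epsilon> * cos (r * s + \<theta>)) +
        exp (- \<epsilon> * r) * (s * (cos (r * s + \<theta>) * s) + \<epsilon> * (sin (r * s + \<theta>) * s))) / ?D) (at r)"
      by (rule DERIV_cdivide) (auto intro!: derivative_eq_intros simp: algebra_simps)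
    moreover have "(- \<epsilon> * exp (- \<epsilon> * r)) * (s * sin (r * s + \<theta>) - \<epsilon> * cos (r * s + \<theta>)) +
        exp (- \<epsilon> * r) * (s * (cos (r * s + \<theta>) * s) + \<epsilon> * (sin (r * s + \<theta>) * s)) = ?D * ?f r"
      by (simp add: algebra_simps power2_eq_square)
    moreover have "?D * ?f r / ?D = ?f r"
      by (rule nonzero_mult_div_cancel_left[OF less_imp_neq[OF D, THEN not_sym]])
    ultimately show "(?F has_vector_derivative ?f r) (at r)"
      by (simp only: has_real_derivative_iff_has_vector_derivative)
    show "isCont ?f r" by (intro continuous_intros)
  next
    have "(?F \<longlongrightarrow> ?F 0) (at 0)" by (intro isContD continuous_intros) (use D in auto)
    then have "(?F \<longlongrightarrow> ?F 0) (at_right 0)" by (rule filterlim_mono[OF _ order_refl at_le]) auto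
    then show "((?F \<circ> real_of_ereal) \<longlongrightarrow> ?F 0) (at_right 0)"
      by (simp add: zero_ereal_def ereal_tendsto_simps)
    have "(?F \<longlongrightarrow> 0) at_top"
    proof (rule Lim_null_comparison)
      show "\<forall>\<^sub>F r in at_top. norm (?F r) \<le> exp (- \<epsilon> * r) * ((\<bar>s\<bar> + \<epsilon>) / ?D)"
      proof (rule always_eventually, rule allI)
        fix r
        have "\<bar>s * sin (r * s + \<theta>) - \<epsilon> * cos (r * s + \<theta>)\<bar> \<le> \<bar>s * sin (r * s + \<theta>)\<bar> + \<bar>\<epsilon> * cos (r * s + \<theta>)\<bar>"
          by (rule abs_triangle_ineq4)
        also have "\<dots> \<le> \<bar>s\<bar> * 1 + \<epsilon> * 1"
          unfolding abs_mult using e by (intro add_mono mult_mono) auto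
        finally show "norm (?F r) \<le> exp (- \<epsilon> * r) * ((\<bar>s\<bar> + \<epsilon>) / ?D)"
          using D by (simp add: abs_mult divide_right_mono mult_left_mono)
      qed
      have "((\<lambda>r. exp (- \<epsilon> * r)) \<longlongrightarrow> 0) at_top"
        using e by (auto intro!: exp_at_bot[THEN filterlim_compose] filterlim_tendsto_pos_mult_at_top filterlim_ident
             simp: filterlim_uminus_at_bot mult.commute[of _ \<epsilon>])
      then show "((\<lambda>r. exp (- \<epsilon> * r) * ((\<bar>s\<bar> + \<epsilon>) / ?D)) \<longlongrightarrow> 0) at_top"
        by (rule tendsto_mult_left_zero)
    qed
    then show "((?F \<circ> real_of_ereal) \<longlongrightarrow> 0) (at_left \<infinity>)"
      by (simp add: ereal_tendsto_simps)
  qed simp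
  finally show ?thesis by (simp add: diff_divide_distrib)
qed

section \<open>Absolute value and logarithm as superpositions of cosines\<close>

lemma one_minus_cos_le_2: "1 - cos s \<le> (2::real)"
  using cos_ge_minus_one[of s] by simp

lemma one_minus_cos_div_le:
  fixes r s :: real
  assumes r: "r > 0"
  shows "(1 - cos (r * s)) / r \<le> s\<^sup>2 + 2"
proof (cases "r \<le> 1")
  case True
  have "1 - cos (r * s) \<le> (r * r) * s\<^sup>2"
    using one_minus_cos_le[of "r * s"] by (simp only: power_mult_distrib power2_eq_square mult_ac)
  also have "\<dots> \<le> r * s\<^sup>2" using True r by (intro mult_right_mono) (auto simp: mult_left_le)
  also have "\<dots> \<le> r * (s\<^sup>2 + 2)" using r by simp
  finally show ?thesis using r by (simp add: pos_divide_le_eq mult.commute)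
next
  case False
  then have "1 - cos (r * s) \<le> 2 * r" using one_minus_cos_le_2[of "r * s"] by linarith
  also have "\<dots> \<le> (s\<^sup>2 + 2) * r" using r by (intro mult_right_mono) auto
  finally show ?thesis using r by (simp add: pos_divide_le_eq)
qed

text \<open>Differentiation in s cancels the factor 1/r and leaves the Laplace transform of the
  sine, s / (\<epsilon>^2 + s^2). This is also the derivative of the right-hand side, and both sides
  vanish at s = 0.\<close>

lemma integral_exp_one_minus_cos:
  assumes e: "\<epsilon> > 0"
  shows "(\<integral>r. exp (- \<epsilon> * r) * ((1 - cos (r * s)) / r) \<partial>lpos) = (ln (\<epsilon>\<^sup>2 + s\<^sup>2) - ln (\<epsilon>\<^sup>2)) / 2"
proof -
  define L where "L s = (\<integral>r. exp (- \<epsilon> * r) * ((1 - cos (r * s)) / r) \<partial>lpos)" for s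
  have dL: "(L has_real_derivative s / (\<epsilon>\<^sup>2 + s\<^sup>2)) (at s)" for s
  proof -
    have "((\<lambda>t. \<integral>r. exp (- \<epsilon> * r) * ((1 - cos (r * t)) / r) \<partial>lpos) has_real_derivative
        (\<integral>r. exp (- \<epsilon> * r) * sin (r * s) \<partial>lpos)) (at s)"
    proof (rule has_real_derivative_integral[where e = 1 and g = "\<lambda>r. exp (- \<epsilon> * r)"])
      fix t r assume r: "r \<in> space lpos"
      then show "((\<lambda>t. exp (- \<epsilon> * r) * ((1 - cos (r * t)) / r)) has_real_derivative exp (- \<epsilon> * r) * sin (r * t)) (at t)"
        by (auto intro!: derivative_eq_intros)
      show "\<bar>exp (- \<epsilon> * r) * sin (r * t)\<bar> \<le> exp (- \<epsilon> * r)" by (simp add: abs_mult)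
    next
      fix t :: real
      show "integrable lpos (\<lambda>r. exp (- \<epsilon> * r) * ((1 - cos (r * t)) / r))"
      proof (rule Bochner_Integration.integrable_bound[OF integrable_mult_right[OF integrable_lpos_exp[OF e], of "t\<^sup>2 + 2"]])
        show "AE r in lpos. norm (exp (- \<epsilon> * r) * ((1 - cos (r * t)) / r)) \<le> norm ((t\<^sup>2 + 2) * exp (- \<epsilon> * r))"
        proof (rule AE_I2)
          fix r assume "r \<in> space lpos"
          then have r: "r > 0" by simp
          have "(1 - cos (r * t)) / r \<le> t\<^sup>2 + 2" by (rule one_minus_cos_div_le[OF r])
          then have "exp (- \<epsilon> * r) * ((1 - cos (r * t)) / r) \<le> exp (- \<epsilon> * r) * (t\<^sup>2 + 2)"
            by (rule mult_left_mono) simp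
          then show "norm (exp (- \<epsilon> * r) * ((1 - cos (r * t)) / r)) \<le> norm ((t\<^sup>2 + 2) * exp (- \<epsilon> * r))"
            using r by (simp add: mult.commute)
        qed
      qed (intro lpos_measurable, measurable)
    qed (use integrable_lpos_exp[OF e] in \<open>auto intro!: lpos_measurable\<close>)
    also have "(\<integral>r. exp (- \<epsilon> * r) * sin (r * s) \<partial>lpos) = s / (\<epsilon>\<^sup>2 + s\<^sup>2)"
      using integral_lpos_exp_cos[OF e, of s "- (pi / 2)"] by (simp add: cos_diff)
    finally show ?thesis unfolding L_def .
  qed
  have pos: "\<epsilon>\<^sup>2 + s\<^sup>2 > 0" for s using e by (simp add: add_pos_nonneg)
  have "((\<lambda>s. L s - ln (\<epsilon>\<^sup>2 + s\<^sup>2) / 2) has_real_derivative 0) (at s)" for s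
    using pos[of s] by (auto intro!: derivative_eq_intros dL simp: field_simps)
  then have "L s - ln (\<epsilon>\<^sup>2 + s\<^sup>2) / 2 = L 0 - ln (\<epsilon>\<^sup>2 + 0\<^sup>2) / 2"
    using DERIV_isconst_all by blast
  then show ?thesis by (simp add: L_def diff_divide_distrib)
qed

lemma integrable_one_minus_cos: "integrable lpos (\<lambda>r. (1 - cos (r * s)) / r\<^sup>2)"
proof (rule integrable_lposI[where C = "s\<^sup>2" and C' = 2])
  fix r :: real assume "0 < r" "r \<le> 1"
  then show "\<bar>(1 - cos (r * s)) / r\<^sup>2\<bar> \<le> s\<^sup>2"
    using one_minus_cos_le[of "r * s"] by (simp add: pos_divide_le_eq power_mult_distrib mult.commute)
next
  fix r :: real assume "1 \<le> r"
  then show "r\<^sup>2 * \<bar>(1 - cos (r * s)) / r\<^sup>2\<bar> \<le> 2"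
    using one_minus_cos_le_2[of "r * s"] by simp
qed measurable

text \<open>The substitution r to r / |s| shows that the integral is homogeneous of degree 1 in |s|;
  the factor is its value at s = 1.\<close>

lemma integral_one_minus_cos:
  obtains c where "c > 0" "\<And>s. (\<integral>r. (1 - cos (r * s)) / r\<^sup>2 \<partial>lpos) = c * \<bar>s\<bar>"
proof
  let ?c = "\<integral>r. (1 - cos r) / r\<^sup>2 \<partial>lpos"
  \<comment> \<open>On [pi/2, pi] the numerator 1 - cos r is at least 1 and the denominator at most
    pi^2, which bounds the integral from below.\<close>
  have "0 < 1 / pi\<^sup>2 * (pi / 2)" by simp
  also have "\<dots> = (\<integral>r. 1 / pi\<^sup>2 * indicator {pi / 2..pi} r \<partial>lborel)"
    by simp
  also have "\<dots> \<le> (\<integral>r. indicator {0<..} r * ((1 - cos r) / r\<^sup>2) \<partial>lborel)"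
  proof (rule integral_mono)
    show "integrable lborel (\<lambda>r::real. indicator {0<..} r * ((1 - cos r) / r\<^sup>2))"
      using integrable_one_minus_cos[of 1] by (simp add: integrable_lpos_iff)
    fix r :: real
    show "1 / pi\<^sup>2 * indicator {pi / 2..pi} r \<le> indicator {0<..} r * ((1 - cos r) / r\<^sup>2)"
    proof (cases "r \<in> {pi / 2..pi}")
      case True
      then have r: "0 < r" "pi / 2 \<le> r" "r \<le> pi" using less_le_trans[OF pi_half_gt_zero] by auto
      have "cos r \<le> cos (pi / 2)" using r by (intro cos_monotone_0_pi_le) auto
      then have "1 \<le> 1 - cos r" by simp
      moreover have "r\<^sup>2 \<le> pi\<^sup>2" using r by (intro power_mono) auto
      ultimately have "1 / pi\<^sup>2 \<le> (1 - cos r) / r\<^sup>2" using r by (intro frac_le) auto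
      then show ?thesis using r by (simp add: indicator_def)
    qed (auto simp: indicator_def)
  qed simp
  finally show "?c > 0" by (simp add: integral_lpos)
  fix s :: real
  show "(\<integral>r. (1 - cos (r * s)) / r\<^sup>2 \<partial>lpos) = ?c * \<bar>s\<bar>"
  proof (cases "s = 0")
    case False
    have "cos (r * s) = cos (\<bar>s\<bar> * r)" for r by (cases "s \<ge> 0") (auto simp: mult.commute)
    then have "(\<integral>r. (1 - cos (r * s)) / r\<^sup>2 \<partial>lpos) = (\<integral>r. s\<^sup>2 * ((1 - cos (\<bar>s\<bar> * r)) / (\<bar>s\<bar> * r)\<^sup>2) \<partial>lpos)"
      using False by (intro Bochner_Integration.integral_cong) (auto simp: power_mult_distrib)
    also have "\<dots> = s\<^sup>2 * (\<integral>r. (1 - cos (\<bar>s\<bar> * r)) / (\<bar>s\<bar> * r)\<^sup>2 \<partial>lpos)"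
      by (rule integral_mult_right_zero)
    also have "\<dots> = s\<^sup>2 * (?c / \<bar>s\<bar>)"
      using False by (subst integral_lpos_scale) auto
    also have "\<dots> = ?c * \<bar>s\<bar>" using False by (simp add: field_simps power2_eq_square abs_mult_self_eq)
    finally show ?thesis .
  qed simp
qed

section \<open>Integrability of the logarithmic singularity on a hyperplane\<close>

lemma abs_ln_le: "\<bar>ln s\<bar> \<le> 2 * s powr (- (1 / 2)) + s" if "s \<ge> 0" for s :: real
proof (cases "s = 0")
  case False
  with that have s: "s > 0" by simp
  have a: "ln s \<le> s" using ln_le_minus_one[OF s] by simp
  \<comment> \<open>The logarithm of s^(-1/2) is estimated by its argument: the exponent -1/2 is
    integrable at 0 in one variable, and the price is the factor 2.\<close>
  have "- ln s = 2 * ln (s powr (- (1 / 2)))" using s by (simp add: ln_powr)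
  also have "\<dots> \<le> 2 * s powr (- (1 / 2))"
    using ln_le_minus_one[of "s powr (- (1 / 2))"] s by simp
  finally show ?thesis using a s powr_ge_zero[of s "- (1 / 2)"] by (smt (verit))
qed simp

lemma nn_integral_powr_half: "(\<integral>\<^sup>+t. ennreal (indicator {-1..1} t * \<bar>t\<bar> powr (- (1 / 2))) \<partial>lborel) < \<infinity>"
proof -
  let ?w = "\<lambda>t::real. \<bar>t\<bar> powr (- (1 / 2))"
  have "set_integrable lborel (einterval 0 1) (\<lambda>t::real. t powr (- (1 / 2)))"
  proof (rule interval_integral_FTC_nonneg[where F = "\<lambda>t. 2 * t powr (1 / 2)"])
    fix t :: real assume "0 < ereal t"
    then show "((\<lambda>t. 2 * t powr (1 / 2)) has_real_derivative t powr (- (1 / 2))) (at t)"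
      by (auto intro!: derivative_eq_intros)
    show "isCont (\<lambda>t. t powr (- (1 / 2))) t"
      using \<open>0 < ereal t\<close> by (intro continuous_intros) auto
  next
    have c: "((\<lambda>t::real. 2 * t powr (1 / 2)) \<longlongrightarrow> 2 * a powr (1 / 2)) (at a within {0..})" if "a \<ge> 0" for a
      using that by (intro tendsto_intros) (auto simp: eventually_at_topological)
    have "((\<lambda>t::real. 2 * t powr (1 / 2)) \<longlongrightarrow> 2 * 0 powr (1 / 2)) (at_right 0)"
      using c[of 0] by (rule filterlim_mono[OF _ order_refl at_le]) auto
    then show "(((\<lambda>t::real. 2 * t powr (1 / 2)) \<circ> real_of_ereal) \<longlongrightarrow> 0) (at_right 0)"
      by (simp add: zero_ereal_def ereal_tendsto_simps)
    have "((\<lambda>t::real. 2 * t powr (1 / 2)) \<longlongrightarrow> 2 * 1 powr (1 / 2)) (at_left 1)"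
      by (intro tendsto_intros) auto
    then show "(((\<lambda>t::real. 2 * t powr (1 / 2)) \<circ> real_of_ereal) \<longlongrightarrow> 2) (at_left 1)"
      by (simp add: one_ereal_def ereal_tendsto_simps)
  qed auto
  then have i: "integrable lborel (\<lambda>t. indicator {0<..<1} t * ?w t)"
    unfolding set_integrable_def
    by (rule Bochner_Integration.integrable_cong[THEN iffD1, rotated 2])
      (auto simp: einterval_def zero_ereal_def one_ereal_def indicator_def)
  have j: "integrable lborel (\<lambda>t. indicator {0<..<1} (0 + (-1) * t) * ?w (0 + (-1) * t))"
    by (rule lborel_integrable_real_affine[OF i]) simp
  have "integrable lborel (\<lambda>t. indicator {0<..<1} t * ?w t + indicator {0<..<1} (0 + (-1) * t) * ?w (0 + (-1) * t) + indicator {-1..1} t)"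
    using i j by (intro Bochner_Integration.integrable_add) auto
  then have "integrable lborel (\<lambda>t. indicator {-1..1} t * ?w t)"
    by (rule Bochner_Integration.integrable_bound) (auto simp: indicator_def)
  then show ?thesis by (auto simp: integrable_iff_bounded abs_mult)
qed

text \<open>The weight changes only by a constant factor under the translations \<open>x \<mapsto> x + t *\<^sub>R v\<close> with
  \<open>0 \<le> t \<le> 1\<close>, so the singularity on the hyperplane may be averaged over \<open>t\<close>.\<close>

lemma integrable_inner_powr_exp:
  fixes y :: "'a::euclidean_space"
  assumes y: "y \<noteq> 0" and k: "\<kappa> > 0"
  shows "integrable lborel (\<lambda>x. \<bar>y \<bullet> x\<bar> powr (- (1 / 2)) * exp (- \<kappa> * norm x))"
proof (rule integrableI_nonneg)
  let ?w = "\<lambda>t::real. ennreal (\<bar>t\<bar> powr (- (1 / 2)))"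
  let ?E = "\<lambda>x::'a. ennreal (exp (- \<kappa> * norm x))"
  \<comment> \<open>Normalised so that translation by t v raises y \<bullet> x by exactly t.\<close>
  define v where "v = y /\<^sub>R (norm y)\<^sup>2"
  have yv: "y \<bullet> v = 1" using y by (simp add: v_def power2_norm_eq_inner)
  define K where "K = ennreal (exp (\<kappa> * norm v))"
  let ?I = "\<integral>\<^sup>+x. ?w (y \<bullet> x) * ?E x \<partial>lborel"
  \<comment> \<open>A bound, uniform in s, for the integral of |s + t|^(-1/2) over t in [0,1]: the
    integrand is at most 1 where |s + t| > 1, and the rest is part of the integral over
    [-1,1].\<close>
  define W where "W = 1 + (\<integral>\<^sup>+t. ennreal (indicator {-1..1} t * \<bar>t\<bar> powr (- (1 / 2))) \<partial>lborel)"
  have W: "W < \<infinity>" unfolding W_def using nn_integral_powr_half by (simp add: top.not_eq_extremum)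
  have inner: "(\<integral>\<^sup>+t. indicator {0..1} t * ?w (s + t) \<partial>lborel) \<le> W" for s :: real
  proof -
    have "(\<integral>\<^sup>+t. indicator {0..1} t * ?w (s + t) \<partial>lborel) \<le>
        (\<integral>\<^sup>+t. indicator {0..1} t + ennreal (indicator {-1..1} (s + t) * \<bar>s + t\<bar> powr (- (1 / 2))) \<partial>lborel)"
    proof (rule nn_integral_mono)
      fix t :: real
      have "\<bar>s + t\<bar> powr (- (1 / 2)) \<le> 1" if "\<not> (- 1 \<le> s + t \<and> s + t \<le> 1)"
        using powr_mono[of "- (1 / 2)" 0 "\<bar>s + t\<bar>"] that by (auto simp: abs_if split: if_splits)
      then show "indicator {0..1} t * ?w (s + t) \<le>
          indicator {0..1} t + ennreal (indicator {-1..1} (s + t) * \<bar>s + t\<bar> powr (- (1 / 2)))"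
        by (auto simp: indicator_def)
    qed
    also have "\<dots> = 1 + (\<integral>\<^sup>+t. ennreal (indicator {-1..1} (s + 1 * t) * \<bar>s + 1 * t\<bar> powr (- (1 / 2))) \<partial>lborel)"
      by (subst nn_integral_add) auto
    also have "\<dots> = W"
      unfolding W_def by (subst nn_integral_real_affine[of _ 1 s]) auto
    finally show ?thesis .
  qed
  have shift: "?I \<le> K * (\<integral>\<^sup>+x. ?w (y \<bullet> x + t) * ?E x \<partial>lborel)" if t: "t \<in> {0..1}" for t
  proof -
    have "?I = (\<integral>\<^sup>+x. ?w (y \<bullet> x) * ?E x \<partial>distr lborel borel ((+) (t *\<^sub>R v)))"
      by (simp add: lborel_distr_plus)
    also have "\<dots> = (\<integral>\<^sup>+x. ?w (y \<bullet> (t *\<^sub>R v + x)) * ?E (t *\<^sub>R v + x) \<partial>lborel)"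
      by (subst nn_integral_distr) auto
    also have "\<dots> \<le> (\<integral>\<^sup>+x. K * (?w (y \<bullet> x + t) * ?E x) \<partial>lborel)"
    proof (rule nn_integral_mono)
      fix x :: 'a
      have "?E (t *\<^sub>R v + x) \<le> K * ?E x"
        using exp_norm_shift_le[OF k, of t x v] t
        by (auto simp: K_def add.commute ennreal_mult[symmetric] intro!: ennreal_leI)
      then have "?w (y \<bullet> x + t) * ?E (t *\<^sub>R v + x) \<le> ?w (y \<bullet> x + t) * (K * ?E x)"
        by (rule mult_left_mono) simp
      then show "?w (y \<bullet> (t *\<^sub>R v + x)) * ?E (t *\<^sub>R v + x) \<le> K * (?w (y \<bullet> x + t) * ?E x)"
        by (simp add: inner_add_right yv add.commute mult.left_commute)
    qed
    also have "\<dots> = K * (\<integral>\<^sup>+x. ?w (y \<bullet> x + t) * ?E x \<partial>lborel)"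
      by (rule nn_integral_cmult) measurable
    finally show ?thesis .
  qed
  have "?I = (\<integral>\<^sup>+t. ?I * indicator {0..1::real} t \<partial>lborel)"
    by (subst nn_integral_cmult_indicator) auto
  also have "\<dots> \<le> (\<integral>\<^sup>+t. K * (\<integral>\<^sup>+x. ?w (y \<bullet> x + t) * ?E x \<partial>lborel) * indicator {0..1::real} t \<partial>lborel)"
    using shift by (intro nn_integral_mono) (auto simp: indicator_def)
  also have "\<dots> = (\<integral>\<^sup>+t. (\<integral>\<^sup>+x. K * ?E x * (indicator {0..1::real} t * ?w (y \<bullet> x + t)) \<partial>lborel) \<partial>lborel)"
  proof (rule nn_integral_cong)
    fix t :: real
    have "(\<integral>\<^sup>+x. K * ?E x * (indicator {0..1::real} t * ?w (y \<bullet> x + t)) \<partial>lborel) =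
        (\<integral>\<^sup>+x. (K * indicator {0..1::real} t) * (?w (y \<bullet> x + t) * ?E x) \<partial>lborel)"
      by (simp add: mult_ac)
    also have "\<dots> = (K * indicator {0..1::real} t) * (\<integral>\<^sup>+x. ?w (y \<bullet> x + t) * ?E x \<partial>lborel)"
      by (rule nn_integral_cmult) measurable
    finally show "K * (\<integral>\<^sup>+x. ?w (y \<bullet> x + t) * ?E x \<partial>lborel) * indicator {0..1::real} t =
        (\<integral>\<^sup>+x. K * ?E x * (indicator {0..1::real} t * ?w (y \<bullet> x + t)) \<partial>lborel)"
      by (simp add: mult_ac)
  qed
  also have "\<dots> = (\<integral>\<^sup>+x. (\<integral>\<^sup>+t. K * ?E x * (indicator {0..1::real} t * ?w (y \<bullet> x + t)) \<partial>lborel) \<partial>lborel)"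
    by (rule lborel_pair.Fubini') measurable
  also have "\<dots> = (\<integral>\<^sup>+x. K * ?E x * (\<integral>\<^sup>+t. indicator {0..1::real} t * ?w (y \<bullet> x + t) \<partial>lborel) \<partial>lborel)"
    by (intro nn_integral_cong nn_integral_cmult) measurable
  also have "\<dots> \<le> (\<integral>\<^sup>+x. K * W * ?E x \<partial>lborel)"
  proof (rule nn_integral_mono)
    fix x :: 'a
    show "K * ?E x * (\<integral>\<^sup>+t. indicator {0..1::real} t * ?w (y \<bullet> x + t) \<partial>lborel) \<le> K * W * ?E x"
      using mult_left_mono[OF inner[of "y \<bullet> x"], of "K * ?E x"] by (simp only: mult_ac zero_le)
  qed
  also have "\<dots> = K * W * (\<integral>\<^sup>+x. ?E x \<partial>lborel)"
    by (rule nn_integral_cmult) measurable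
  also have "\<dots> < \<infinity>"
    using W integrable_exp_norm[OF k, where 'a = 'a]
    by (auto simp: K_def integrable_iff_bounded ennreal_mult_less_top)
  finally show "(\<integral>\<^sup>+x. ennreal (\<bar>y \<bullet> x\<bar> powr (- (1 / 2)) * exp (- \<kappa> * norm x)) \<partial>lborel) < \<infinity>"
    by (simp add: ennreal_mult')
qed auto

lemma (in exp_weight) integrable_ln_inner:
  assumes f: "poly_exp R f" and y: "y \<noteq> 0"
  shows "integrable lborel (\<lambda>x. ln \<bar>y \<bullet> x\<bar> * f x)"
proof -
  note [measurable] = poly_exp_measurable[OF f]
  obtain C where C: "\<And>x. \<bar>f x\<bar> \<le> C * exp (- norm x)" using poly_exp_bound[OF f] by blast
  have i: "integrable lborel (\<lambda>x. \<bar>(y \<bullet> x) * f x\<bar>)"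
    using poly_exp_integrable[OF poly_exp_mult[OF f, of "\<lambda>x. y \<bullet> x"]]
      real_polynomial_function_inner[of y] by (simp add: inner_commute)
  show ?thesis
  proof (rule Bochner_Integration.integrable_bound)
    show "integrable lborel (\<lambda>x. 2 * C * (\<bar>y \<bullet> x\<bar> powr (- (1 / 2)) * exp (- 1 * norm x)) + \<bar>(y \<bullet> x) * f x\<bar>)"
      by (intro Bochner_Integration.integrable_add i integrable_mult_right integrable_inner_powr_exp y) simp
    show "AE x in lborel. norm (ln \<bar>y \<bullet> x\<bar> * f x) \<le>
        norm (2 * C * (\<bar>y \<bullet> x\<bar> powr (- (1 / 2)) * exp (- 1 * norm x)) + \<bar>(y \<bullet> x) * f x\<bar>)"
    proof (rule AE_I2)
      fix x
      let ?p = "\<bar>y \<bullet> x\<bar> powr (- (1 / 2))"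
      have "\<bar>ln \<bar>y \<bullet> x\<bar>\<bar> * \<bar>f x\<bar> \<le> (2 * ?p + \<bar>y \<bullet> x\<bar>) * \<bar>f x\<bar>"
        by (intro mult_right_mono abs_ln_le) auto
      also have "\<dots> = 2 * ?p * \<bar>f x\<bar> + \<bar>(y \<bullet> x) * f x\<bar>" by (simp add: algebra_simps abs_mult)
      also have "\<dots> \<le> 2 * ?p * (C * exp (- norm x)) + \<bar>(y \<bullet> x) * f x\<bar>"
        by (intro add_right_mono mult_left_mono C) auto
      finally show "norm (ln \<bar>y \<bullet> x\<bar> * f x) \<le>
          norm (2 * C * (?p * exp (- 1 * norm x)) + \<bar>(y \<bullet> x) * f x\<bar>)"
        unfolding real_norm_def abs_mult[of "ln \<bar>y \<bullet> x\<bar>"] by (intro order.trans[OF _ abs_ge_self]) (simp add: mult_ac)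
    qed
  qed measurable
qed

text \<open>By Cauchy-Schwarz the ratio is at most |y|, so only its negative power matters. That
  power produces an extra |x|^(1/2), paid for with half of the exponential decay.\<close>

lemma (in exp_weight) integrable_ln_inner_norm:
  assumes f: "poly_exp R f" and y: "y \<noteq> 0"
  shows "integrable lborel (\<lambda>x. ln (\<bar>y \<bullet> x\<bar> / norm x) * f x)"
proof -
  note [measurable] = poly_exp_measurable[OF f]
  obtain C where C: "\<And>x. \<bar>f x\<bar> \<le> C * exp (- norm x)" using poly_exp_bound[OF f] by blast
  have C0: "C \<ge> 0" using C[of 0] by simp
  have i: "integrable lborel (\<lambda>x. \<bar>f x\<bar>)" using poly_exp_integrable[OF f] by simp
  show ?thesis
  proof (rule Bochner_Integration.integrable_bound)
    show "integrable lborel (\<lambda>x. 4 * C * (\<bar>y \<bullet> x\<bar> powr (- (1 / 2)) * exp (- (1 / 2) * norm x)) + norm y * \<bar>f x\<bar>)"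
      by (intro Bochner_Integration.integrable_add i integrable_mult_right integrable_inner_powr_exp y) simp
    show "AE x in lborel. norm (ln (\<bar>y \<bullet> x\<bar> / norm x) * f x) \<le>
        norm (4 * C * (\<bar>y \<bullet> x\<bar> powr (- (1 / 2)) * exp (- (1 / 2) * norm x)) + norm y * \<bar>f x\<bar>)"
    proof (rule AE_I2)
      fix x
      let ?p = "\<bar>y \<bullet> x\<bar> powr (- (1 / 2))" and ?s = "\<bar>y \<bullet> x\<bar> / norm x"
      have s: "?s \<le> norm y"
        using Cauchy_Schwarz_ineq2[of y x] by (cases "x = 0") (auto simp: divide_le_eq)
      have p: "?s powr (- (1 / 2)) = ?p * norm x powr (1 / 2)"
        by (simp add: powr_divide powr_minus_divide)
      have "norm x powr (1 / 2) \<le> (1 + norm x) powr (1 / 2)" by (intro powr_mono2) auto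
      also have "\<dots> \<le> (1 + norm x) powr 1" by (intro powr_mono) auto
      also have "\<dots> \<le> 2 * (1 + norm x / 2)" by simp
      also have "\<dots> \<le> 2 * exp (norm x / 2)" using exp_ge_add_one_self[of "norm x / 2"] by (intro mult_left_mono) auto
      finally have nx: "norm x powr (1 / 2) * exp (- norm x) \<le> 2 * exp (norm x / 2) * exp (- norm x)"
        by (rule mult_right_mono) simp
      also have "\<dots> = 2 * exp (- (1 / 2) * norm x)" by (simp add: exp_add[symmetric])
      finally have nx: "norm x powr (1 / 2) * exp (- norm x) \<le> 2 * exp (- (1 / 2) * norm x)" .
      have "\<bar>ln ?s\<bar> * \<bar>f x\<bar> \<le> (2 * ?s powr (- (1 / 2)) + ?s) * \<bar>f x\<bar>"
        by (intro mult_right_mono abs_ln_le) auto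
      also have "\<dots> \<le> (2 * ?s powr (- (1 / 2)) + norm y) * \<bar>f x\<bar>"
        using s by (intro mult_right_mono add_left_mono) auto
      also have "\<dots> = 2 * ?p * norm x powr (1 / 2) * \<bar>f x\<bar> + norm y * \<bar>f x\<bar>"
        by (simp only: p distrib_right mult.assoc)
      also have "\<dots> \<le> 2 * ?p * norm x powr (1 / 2) * (C * exp (- norm x)) + norm y * \<bar>f x\<bar>"
        by (intro add_right_mono mult_left_mono C) auto
      also have "\<dots> = 2 * ?p * C * (norm x powr (1 / 2) * exp (- norm x)) + norm y * \<bar>f x\<bar>"
        by (simp only: mult_ac)
      also have "\<dots> \<le> 2 * ?p * C * (2 * exp (- (1 / 2) * norm x)) + norm y * \<bar>f x\<bar>"
        using C0 nx by (intro add_right_mono mult_left_mono) auto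
      also have "\<dots> = 4 * C * (?p * exp (- (1 / 2) * norm x)) + norm y * \<bar>f x\<bar>" by simp
      finally show "norm (ln ?s * f x) \<le> norm (4 * C * (?p * exp (- (1 / 2) * norm x)) + norm y * \<bar>f x\<bar>)"
        unfolding real_norm_def abs_mult[of "ln ?s"] by (rule order.trans[OF _ abs_ge_self]) 
    qed
  qed measurable
qed

text \<open>\<omega> is the density of the superposition of the waves 1 - cos (r s). The majorant
  grows at most quadratically in s and therefore remains integrable against \<open>f\<close>, which
  permits Fubini; \<open>ft 0 f 0\<close> is the integral of \<open>f\<close>.\<close>

lemma (in exp_weight) integral_cosine_superposition:
  assumes f: "poly_exp R f" and [measurable]: "\<omega> \<in> borel_measurable borel"
    and h: "integrable lpos h" and bd: "\<And>r s. 0 < r \<Longrightarrow> \<bar>(1 - cos (r * s)) * \<omega> r\<bar> \<le> (s\<^sup>2 + 2) * h r"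
  defines "g \<equiv> \<lambda>s. \<integral>r. (1 - cos (r * s)) * \<omega> r \<partial>lpos"
  shows "integrable lpos (\<lambda>r. \<omega> r * (ft 0 f 0 - ft 0 f (r *\<^sub>R y)))" (is ?I1)
    and "integrable lborel (\<lambda>x. g (y \<bullet> x) * f x)" (is ?I2)
    and "(\<integral>x. g (y \<bullet> x) * f x \<partial>lborel) = (\<integral>r. \<omega> r * (ft 0 f 0 - ft 0 f (r *\<^sub>R y)) \<partial>lpos)" (is ?E)
proof -
  note [measurable] = poly_exp_measurable[OF f]
  have ic: "integrable lborel (\<lambda>x. cos (z \<bullet> x) * f x)" for z
    by (rule Bochner_Integration.integrable_bound[OF poly_exp_integrable[OF f]])
      (auto simp: abs_mult mult_left_le_one_le)
  let ?h = "\<lambda>x r. (1 - cos (r * (y \<bullet> x))) * \<omega> r * f x"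
  let ?g = "\<lambda>x. norm y ^ 2 * \<bar>norm x ^ 2 * f x\<bar> + 2 * \<bar>f x\<bar>"
  have "case_prod ?h \<in> borel_measurable (lborel \<Otimes>\<^sub>M lpos)"
    by (intro measurable_lborel_lpos) (simp add: case_prod_beta)
  moreover have "\<bar>?h x r\<bar> \<le> ?g x * h r" if "r \<in> space lpos" for x r
  proof -
    have r: "r > 0" using that by simp
    have h0: "h r \<ge> 0" using bd[OF r, of 0] by simp
    have s: "(y \<bullet> x)\<^sup>2 \<le> norm y ^ 2 * norm x ^ 2"
      by (metis Cauchy_Schwarz_ineq power2_norm_eq_inner)
    have "\<bar>(1 - cos (r * (y \<bullet> x))) * \<omega> r\<bar> \<le> ((y \<bullet> x)\<^sup>2 + 2) * h r" by (rule bd[OF r])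
    also have "\<dots> \<le> (norm y ^ 2 * norm x ^ 2 + 2) * h r" using s h0 by (intro mult_right_mono) auto
    finally have "\<bar>(1 - cos (r * (y \<bullet> x))) * \<omega> r\<bar> * \<bar>f x\<bar> \<le> (norm y ^ 2 * norm x ^ 2 + 2) * h r * \<bar>f x\<bar>"
      by (rule mult_right_mono) simp
    also have "\<dots> = ?g x * h r" by (simp add: abs_mult algebra_simps)
    finally show ?thesis by (simp only: abs_mult)
  qed
  moreover have "integrable lborel ?g"
    using poly_exp_integrable[OF f] poly_exp_integrable[OF poly_exp_mult[OF f real_polynomial_function_norm_power[of 1]]]
    by (intro integrable_mult_right Bochner_Integration.integrable_add) auto
  ultimately have F: "(\<integral>r. (\<integral>x. ?h x r \<partial>lborel) \<partial>lpos) = (\<integral>x. (\<integral>r. ?h x r \<partial>lpos) \<partial>lborel)"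
    and I: "integrable lpos (\<lambda>r. \<integral>x. ?h x r \<partial>lborel)" "integrable lborel (\<lambda>x. \<integral>r. ?h x r \<partial>lpos)"
    using Fubini_product_bound[of lborel lpos ?h ?g h] sigma_finite_lpos h by (auto intro: sigma_finite_lborel)
  have L: "(\<integral>x. ?h x r \<partial>lborel) = \<omega> r * (ft 0 f 0 - ft 0 f (r *\<^sub>R y))" for r
  proof -
    have "(\<integral>x. ?h x r \<partial>lborel) = (\<integral>x. \<omega> r * (cos (0 \<bullet> x) * f x - cos ((r *\<^sub>R y) \<bullet> x) * f x) \<partial>lborel)"
      by (simp add: algebra_simps)
    also have "\<dots> = \<omega> r * (ft 0 f 0 - ft 0 f (r *\<^sub>R y))"
      unfolding ft_def integral_mult_right_zero
      using Bochner_Integration.integral_diff[OF ic[of 0] ic[of "r *\<^sub>R y"]] by simp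
    finally show ?thesis .
  qed
  have Q: "(\<integral>r. ?h x r \<partial>lpos) = g (y \<bullet> x) * f x" for x
    unfolding g_def by (rule integral_mult_left_zero)
  show ?I1 using I(1) unfolding L .
  show ?I2 using I(2) unfolding Q .
  show ?E using F unfolding L Q by (rule sym)
qed

text \<open>The superposition with density 1/r^2 converges for each point, but the result is put in
  the form of a difference of two points, which is also the form available for the logarithm. The
  constant is independent of \<open>f\<close>.\<close>

lemma (in exp_weight) abs_plane_wave:
  obtains A where "A > 0" "\<And>f y y1. poly_exp R f \<Longrightarrow> y \<noteq> 0 \<Longrightarrow> y1 \<noteq> 0 \<Longrightarrow>
    (\<integral>x. \<bar>y \<bullet> x\<bar> * f x \<partial>lborel) - (\<integral>x. \<bar>y1 \<bullet> x\<bar> * f x \<partial>lborel) =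
    A * (\<integral>r. (ft 0 f (r *\<^sub>R y1) - ft 0 f (r *\<^sub>R y)) / r\<^sup>2 \<partial>lpos)"
proof -
  obtain c where c: "c > 0" "\<And>s. (\<integral>r. (1 - cos (r * s)) / r\<^sup>2 \<partial>lpos) = c * \<bar>s\<bar>"
    using integral_one_minus_cos by blast
  have bd: "\<bar>(1 - cos (r * s)) * (1 / r\<^sup>2)\<bar> \<le> (s\<^sup>2 + 2) * (2 / (1 + r\<^sup>2))" if r: "0 < r" for r s :: real
  proof -
    have "\<bar>(1 - cos (r * s)) / r\<^sup>2\<bar> \<le> 2 * max \<bar>s\<^sup>2\<bar> \<bar>2\<bar> / (1 + r\<^sup>2)"
      using one_minus_cos_le[of "r * s"] one_minus_cos_le_2[of "r * s"] r
      by (intro lpos_bound) (simp_all add: pos_divide_le_eq power_mult_distrib mult.commute)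
    also have "\<dots> \<le> 2 * (s\<^sup>2 + 2) / (1 + r\<^sup>2)"
      by (intro divide_right_mono mult_left_mono) (auto simp: add_nonneg_nonneg)
    also have "\<dots> = (s\<^sup>2 + 2) * (2 / (1 + r\<^sup>2))" by (simp only: times_divide_eq_right mult.commute)
    finally show ?thesis by (simp only: times_divide_eq_right mult_1_right)
  qed
  note sup = integral_cosine_superposition[where \<omega> = "\<lambda>r. 1 / r\<^sup>2", OF _ _ integrable_lpos_inverse_square bd, simplified]
  show ?thesis
  proof (rule that[of "1 / c"])
    fix f y y1 assume f: "poly_exp R f"
    have main: "c * (\<integral>x. \<bar>y \<bullet> x\<bar> * f x \<partial>lborel) = (\<integral>r. (ft 0 f 0 - ft 0 f (r *\<^sub>R y)) / r\<^sup>2 \<partial>lpos)" for y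
      using sup(3)[OF f, of y] unfolding c(2) by (simp add: mult.assoc)
    have "(\<integral>r. (ft 0 f (r *\<^sub>R y1) - ft 0 f (r *\<^sub>R y)) / r\<^sup>2 \<partial>lpos) =
        (\<integral>r. (ft 0 f 0 - ft 0 f (r *\<^sub>R y)) / r\<^sup>2 - (ft 0 f 0 - ft 0 f (r *\<^sub>R y1)) / r\<^sup>2 \<partial>lpos)"
      by (simp add: diff_divide_distrib)
    also have "\<dots> = c * (\<integral>x. \<bar>y \<bullet> x\<bar> * f x \<partial>lborel) - c * (\<integral>x. \<bar>y1 \<bullet> x\<bar> * f x \<partial>lborel)"
      unfolding main by (rule Bochner_Integration.integral_diff[OF sup(1)[OF f] sup(1)[OF f]])
    finally show "(\<integral>x. \<bar>y \<bullet> x\<bar> * f x \<partial>lborel) - (\<integral>x. \<bar>y1 \<bullet> x\<bar> * f x \<partial>lborel) =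
        1 / c * (\<integral>r. (ft 0 f (r *\<^sub>R y1) - ft 0 f (r *\<^sub>R y)) / r\<^sup>2 \<partial>lpos)"
      using c(1) by (simp add: right_diff_distrib[symmetric])
  qed (use c in simp)
qed

lemma AE_inner_nonzero:
  fixes y :: "'a::euclidean_space"
  assumes "y \<noteq> 0"
  shows "AE x in lborel. y \<bullet> x \<noteq> 0"
proof -
  have "negligible {x. y \<bullet> x = 0}" using assms by (intro negligible_hyperplane) simp
  moreover have "{x. y \<bullet> x = 0} \<in> sets borel" by (intro borel_closed closed_hyperplane)
  ultimately have "{x. y \<bullet> x = 0} \<in> null_sets lborel"
    by (simp add: negligible_iff_null_sets null_sets_completion_iff)
  then show ?thesis by (rule AE_I') auto
qed

text \<open>The representation \<open>ln (1 + (s / \<epsilon>)\<^sup>2) / 2 = \<integral> exp (- \<epsilon> r) (1 - cos (r s)) / r dr\<close> converges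
  absolutely; \<open>\<epsilon>\<close> tends to 0 in the difference of its values at \<open>y \<bullet> x\<close> and \<open>y1 \<bullet> x\<close>.\<close>

lemma (in exp_weight) ln_plane_wave:
  assumes f: "poly_exp R f" and y: "y \<noteq> 0" "y1 \<noteq> 0"
  shows "(\<integral>x. ln \<bar>y \<bullet> x\<bar> * f x \<partial>lborel) - (\<integral>x. ln \<bar>y1 \<bullet> x\<bar> * f x \<partial>lborel) =
    (\<integral>r. (ft 0 f (r *\<^sub>R y1) - ft 0 f (r *\<^sub>R y)) / r \<partial>lpos)"
proof -
  note [measurable] = poly_exp_measurable[OF f] ft_ray_measurable[OF f]
  have ic: "integrable lborel (\<lambda>x. cos (z \<bullet> x) * f x)" for z
    by (rule Bochner_Integration.integrable_bound[OF poly_exp_integrable[OF f]])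
      (auto simp: abs_mult mult_left_le_one_le)
  have i2: "integrable lborel (\<lambda>x. \<bar>norm x ^ 2 * f x\<bar>)"
    using poly_exp_integrable[OF poly_exp_mult[OF f real_polynomial_function_norm_power[of 1]]] by auto
  define \<epsilon> where "\<epsilon> n = 1 / real (Suc n)" for n
  have e: "\<epsilon> n > 0" "\<epsilon> n \<le> 1" for n by (auto simp: \<epsilon>_def)
  have e0: "\<epsilon> \<longlonglongrightarrow> 0" unfolding \<epsilon>_def[abs_def] by (rule LIMSEQ_Suc[OF lim_1_over_n, unfolded inverse_eq_divide])
  define l where "l n s = ln ((\<epsilon> n)\<^sup>2 + s\<^sup>2) / 2" for n s
  have bd: "\<bar>(1 - cos (r * s)) * (exp (- \<epsilon> n * r) / r)\<bar> \<le> (s\<^sup>2 + 2) * exp (- \<epsilon> n * r)" if "0 < r" for n r s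
    using mult_right_mono[OF one_minus_cos_div_le[OF that, of s], of "exp (- \<epsilon> n * r)"] that by (simp add: abs_mult)
  note sup = integral_cosine_superposition[where \<omega> = "\<lambda>r. exp (- \<epsilon> n * r) / r" for n, OF f _ integrable_lpos_exp[OF e(1)] bd]
  have Q: "(\<integral>r. (1 - cos (r * s)) * (exp (- \<epsilon> n * r) / r) \<partial>lpos) = l n s - ln (\<epsilon> n ^ 2) / 2" for n s
  proof -
    have "(\<lambda>r. (1 - cos (r * s)) * (exp (- \<epsilon> n * r) / r)) = (\<lambda>r. exp (- \<epsilon> n * r) * ((1 - cos (r * s)) / r))"
      by (rule ext) simp
    then show ?thesis
      using integral_exp_one_minus_cos[OF e(1), of n s] by (simp only: l_def diff_divide_distrib[symmetric])
  qed
  have main: "(\<integral>x. (l n (y \<bullet> x) - ln (\<epsilon> n ^ 2) / 2) * f x \<partial>lborel) =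
      (\<integral>r. exp (- \<epsilon> n * r) * ((ft 0 f 0 - ft 0 f (r *\<^sub>R y)) / r) \<partial>lpos)"
    and int1: "integrable lborel (\<lambda>x. (l n (y \<bullet> x) - ln (\<epsilon> n ^ 2) / 2) * f x)"
    and int2: "integrable lpos (\<lambda>r. exp (- \<epsilon> n * r) * ((ft 0 f 0 - ft 0 f (r *\<^sub>R y)) / r))" for n y
    using sup(3,2,1)[of n y] unfolding Q by simp_all
  \<comment> \<open>The constant ln (\<epsilon>^2) / 2 diverges as \<epsilon> tends to 0; it cancels
    in the difference of the two points.\<close>
  have eq: "(\<integral>x. (l n (y \<bullet> x) - l n (y1 \<bullet> x)) * f x \<partial>lborel) =
      (\<integral>r. exp (- \<epsilon> n * r) * ((ft 0 f (r *\<^sub>R y1) - ft 0 f (r *\<^sub>R y)) / r) \<partial>lpos)" for n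
  proof -
    have "(\<integral>x. (l n (y \<bullet> x) - l n (y1 \<bullet> x)) * f x \<partial>lborel) =
        (\<integral>x. (l n (y \<bullet> x) - ln (\<epsilon> n ^ 2) / 2) * f x - (l n (y1 \<bullet> x) - ln (\<epsilon> n ^ 2) / 2) * f x \<partial>lborel)"
      by (simp add: left_diff_distrib)
    also have "\<dots> = (\<integral>r. exp (- \<epsilon> n * r) * ((ft 0 f 0 - ft 0 f (r *\<^sub>R y)) / r) -
        exp (- \<epsilon> n * r) * ((ft 0 f 0 - ft 0 f (r *\<^sub>R y1)) / r) \<partial>lpos)"
      by (simp only: Bochner_Integration.integral_diff[OF int1 int1] Bochner_Integration.integral_diff[OF int2 int2] main)
    also have "\<dots> = (\<integral>r. exp (- \<epsilon> n * r) * ((ft 0 f (r *\<^sub>R y1) - ft 0 f (r *\<^sub>R y)) / r) \<partial>lpos)"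
      by (simp add: diff_divide_distrib right_diff_distrib)
    finally show ?thesis .
  qed
  have "(\<lambda>n. \<integral>x. (l n (y \<bullet> x) - l n (y1 \<bullet> x)) * f x \<partial>lborel) \<longlonglongrightarrow>
      (\<integral>x. ln \<bar>y \<bullet> x\<bar> * f x - ln \<bar>y1 \<bullet> x\<bar> * f x \<partial>lborel)"
  proof (rule integral_dominated_convergence)
    let ?b = "\<lambda>y x. \<bar>ln \<bar>y \<bullet> x\<bar> * f x\<bar> + norm y ^ 2 * \<bar>norm x ^ 2 * f x\<bar>"
    show "integrable lborel (\<lambda>x. ?b y x + ?b y1 x)"
      by (intro Bochner_Integration.integrable_add integrable_mult_right i2
          integrable_abs[OF integrable_ln_inner[OF f]] y)
    \<comment> \<open>Since 0 < \<epsilon> \<le> 1, the regularised logarithm lies between ln |z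
      \<bullet> x| and |z|^2 |x|^2, which gives a majorant independent of n.\<close>
    have l: "\<bar>l n (z \<bullet> x) * f x\<bar> \<le> ?b z x" if "z \<bullet> x \<noteq> 0" for n z x
    proof -
      have e2: "(\<epsilon> n)\<^sup>2 \<le> 1" "(\<epsilon> n)\<^sup>2 > 0" using e[of n] by (auto simp: power_le_one)
      have z: "(z \<bullet> x)\<^sup>2 > 0" using that by simp
      have "ln ((\<epsilon> n)\<^sup>2 + (z \<bullet> x)\<^sup>2) \<le> ln (1 + (z \<bullet> x)\<^sup>2)"
        using e2 z by (intro ln_mono) (auto intro: add_pos_pos)
      also have "\<dots> \<le> (z \<bullet> x)\<^sup>2" using z by (intro ln_add_one_self_le_self) simp
      also have "\<dots> \<le> norm z ^ 2 * norm x ^ 2" by (metis Cauchy_Schwarz_ineq power2_norm_eq_inner)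
      finally have u: "l n (z \<bullet> x) \<le> norm z ^ 2 * norm x ^ 2"
        by (simp add: l_def) (smt (verit) mult_nonneg_nonneg zero_le_power2)
      have "2 * ln \<bar>z \<bullet> x\<bar> = ln ((z \<bullet> x)\<^sup>2)" using that ln_realpow[of "\<bar>z \<bullet> x\<bar>" 2] by simp
      also have "\<dots> \<le> ln ((\<epsilon> n)\<^sup>2 + (z \<bullet> x)\<^sup>2)" using e2 z by (intro ln_mono) auto
      finally have "ln \<bar>z \<bullet> x\<bar> \<le> l n (z \<bullet> x)" by (simp add: l_def)
      with u have "\<bar>l n (z \<bullet> x)\<bar> \<le> \<bar>ln \<bar>z \<bullet> x\<bar>\<bar> + norm z ^ 2 * norm x ^ 2"
        by (smt (verit) mult_nonneg_nonneg zero_le_power2)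
      then have "\<bar>l n (z \<bullet> x)\<bar> * \<bar>f x\<bar> \<le> (\<bar>ln \<bar>z \<bullet> x\<bar>\<bar> + norm z ^ 2 * norm x ^ 2) * \<bar>f x\<bar>"
        by (rule mult_right_mono) simp
      then show ?thesis by (simp add: abs_mult algebra_simps)
    qed
    show "AE x in lborel. norm ((l n (y \<bullet> x) - l n (y1 \<bullet> x)) * f x) \<le> ?b y x + ?b y1 x" for n
      using AE_inner_nonzero[OF y(1)] AE_inner_nonzero[OF y(2)]
    proof eventually_elim
      case (elim x)
      have "norm ((l n (y \<bullet> x) - l n (y1 \<bullet> x)) * f x) \<le> \<bar>l n (y \<bullet> x) * f x\<bar> + \<bar>l n (y1 \<bullet> x) * f x\<bar>"
        unfolding left_diff_distrib real_norm_def by (rule abs_triangle_ineq4)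
      with l[OF elim(1), of n] l[OF elim(2), of n] show ?case by linarith
    qed
    have lim: "(\<lambda>n. l n s) \<longlonglongrightarrow> ln \<bar>s\<bar>" if "s \<noteq> 0" for s
    proof -
      have "(\<lambda>n. l n s) \<longlonglongrightarrow> ln (0\<^sup>2 + s\<^sup>2) / 2"
        unfolding l_def using that by (intro tendsto_intros e0) auto
      also have "ln (0\<^sup>2 + s\<^sup>2) / 2 = ln \<bar>s\<bar>" using that ln_realpow[of "\<bar>s\<bar>" 2] by simp
      finally show ?thesis .
    qed
    show "AE x in lborel. (\<lambda>n. (l n (y \<bullet> x) - l n (y1 \<bullet> x)) * f x) \<longlonglongrightarrow> ln \<bar>y \<bullet> x\<bar> * f x - ln \<bar>y1 \<bullet> x\<bar> * f x"
      using AE_inner_nonzero[OF y(1)] AE_inner_nonzero[OF y(2)]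
    proof eventually_elim
      case (elim x)
      show ?case
        unfolding left_diff_distrib[symmetric] by (intro tendsto_intros lim elim)
    qed
    show "(\<lambda>x. (l n (y \<bullet> x) - l n (y1 \<bullet> x)) * f x) \<in> borel_measurable lborel" for n
      unfolding l_def by measurable
  qed measurable
  moreover have "(\<lambda>n. \<integral>r. exp (- \<epsilon> n * r) * ((ft 0 f (r *\<^sub>R y1) - ft 0 f (r *\<^sub>R y)) / r) \<partial>lpos) \<longlonglongrightarrow>
      (\<integral>r. (ft 0 f (r *\<^sub>R y1) - ft 0 f (r *\<^sub>R y)) / r \<partial>lpos)"
  proof (rule integral_dominated_convergence)
    show "integrable lpos (\<lambda>r. \<bar>(ft 0 f (r *\<^sub>R y1) - ft 0 f (r *\<^sub>R y)) / r\<bar>)"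
      using integrable_abs[OF integrable_ft_diff[OF f y, of 1]] by simp
    show "AE r in lpos. norm (exp (- \<epsilon> n * r) * ((ft 0 f (r *\<^sub>R y1) - ft 0 f (r *\<^sub>R y)) / r)) \<le>
        \<bar>(ft 0 f (r *\<^sub>R y1) - ft 0 f (r *\<^sub>R y)) / r\<bar>" for n
    proof (rule AE_I2)
      fix r assume "r \<in> space lpos"
      then have "exp (- \<epsilon> n * r) \<le> 1" using e[of n] by simp
      then show "norm (exp (- \<epsilon> n * r) * ((ft 0 f (r *\<^sub>R y1) - ft 0 f (r *\<^sub>R y)) / r)) \<le>
        \<bar>(ft 0 f (r *\<^sub>R y1) - ft 0 f (r *\<^sub>R y)) / r\<bar>"
        unfolding real_norm_def abs_mult by (intro mult_left_le_one_le) auto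
    qed
    show "AE r in lpos. (\<lambda>n. exp (- \<epsilon> n * r) * ((ft 0 f (r *\<^sub>R y1) - ft 0 f (r *\<^sub>R y)) / r)) \<longlonglongrightarrow>
        (ft 0 f (r *\<^sub>R y1) - ft 0 f (r *\<^sub>R y)) / r"
    proof (rule AE_I2)
      fix r
      have "(\<lambda>n. exp (- \<epsilon> n * r) * ((ft 0 f (r *\<^sub>R y1) - ft 0 f (r *\<^sub>R y)) / r)) \<longlonglongrightarrow>
        exp (- 0 * r) * ((ft 0 f (r *\<^sub>R y1) - ft 0 f (r *\<^sub>R y)) / r)"
        by (intro tendsto_intros e0)
      then show "(\<lambda>n. exp (- \<epsilon> n * r) * ((ft 0 f (r *\<^sub>R y1) - ft 0 f (r *\<^sub>R y)) / r)) \<longlonglongrightarrow>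
        (ft 0 f (r *\<^sub>R y1) - ft 0 f (r *\<^sub>R y)) / r" by simp
    qed
  qed (intro lpos_measurable, measurable)+
  ultimately have "(\<integral>x. ln \<bar>y \<bullet> x\<bar> * f x - ln \<bar>y1 \<bullet> x\<bar> * f x \<partial>lborel) =
      (\<integral>r. (ft 0 f (r *\<^sub>R y1) - ft 0 f (r *\<^sub>R y)) / r \<partial>lpos)"
    unfolding eq by (rule LIMSEQ_unique)
  then show ?thesis
    using integrable_ln_inner[OF f y(1)] integrable_ln_inner[OF f y(2)] by simp
qed

section \<open>Hausdorff measure on the sphere\<close>

lemma ball_cball_measurable [measurable]:
  fixes x :: "'a::metric_space"
  shows "ball x r \<in> sets borel" "cball x r \<in> sets borel"
  by (simp_all add: borel_open borel_closed)

lemma hausdorff_outer_isometry_le: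
  fixes f :: "'a::metric_space \<Rightarrow> 'b::metric_space"
  assumes f: "\<And>x y. dist (f x) (f y) = dist x y"
  shows "hausdorff_outer k (f ` A) \<le> hausdorff_outer k A"
proof -
  have diam: "diameter (f ` C) = diameter C" for C
  proof -
    have "(\<lambda>(x, y). dist x y) ` (f ` C \<times> f ` C) = (\<lambda>(x, y). dist x y) ` (C \<times> C)"
      by (force simp: f)
    then show ?thesis by (simp add: diameter_def)
  qed
  have bdd: "bounded C \<Longrightarrow> bounded (f ` C)" for C
    unfolding bounded_def by (metis f imageE)
  have "hausdorff_content k \<delta> (f ` A) \<le> hausdorff_content k \<delta> A" for \<delta>
    unfolding hausdorff_content_def
  proof (rule INF_mono, clarify)
    fix C :: "nat \<Rightarrow> 'a set"
    assume C: "A \<subseteq> (\<Union>i. C i)" "\<forall>i. bounded (C i) \<and> diameter (C i) \<le> \<delta>"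
    have "f ` A \<subseteq> (\<Union>i. f ` C i)" using C(1) by blast
    then have "(\<lambda>i. f ` C i) \<in> {C. f ` A \<subseteq> (\<Union>i. C i) \<and> (\<forall>i. bounded (C i) \<and> diameter (C i) \<le> \<delta>)}"
      using C by (auto simp: diam bdd)
    moreover have "(\<Sum>i. hausdorff_weight k (f ` C i)) = (\<Sum>i. hausdorff_weight k (C i))"
    proof (rule suminf_cong)
      show "hausdorff_weight k (f ` C i) = hausdorff_weight k (C i)" for i
        by (cases "C i = {}") (simp_all add: hausdorff_weight_def diam)
    qed
    ultimately show "\<exists>D\<in>{C. f ` A \<subseteq> (\<Union>i. C i) \<and> (\<forall>i. bounded (C i) \<and> diameter (C i) \<le> \<delta>)}.
        (\<Sum>i. hausdorff_weight k (D i)) \<le> (\<Sum>i. hausdorff_weight k (C i))"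
      by (intro bexI[of _ "\<lambda>i. f ` C i"]) simp_all
  qed
  then show ?thesis unfolding hausdorff_outer_def by (intro SUP_mono) blast
qed

section \<open>Reflections and invariance of Lebesgue measure\<close>

definition reflection :: "'a::euclidean_space \<Rightarrow> 'a \<Rightarrow> 'a" where
  "reflection u x = x - (2 * (x \<bullet> u) / (u \<bullet> u)) *\<^sub>R u"

lemma linear_reflection: "linear (reflection u)"
  unfolding reflection_def
  by (rule linearI) (simp_all add: inner_add_left algebra_simps add_divide_distrib)

lemma reflection_involution: "reflection u (reflection u x) = x"
  by (cases "u = 0") (simp_all add: reflection_def inner_diff_left algebra_simps)

lemma norm_reflection [simp]: "norm (reflection u x) = norm x"
proof (cases "u = 0")
  case False
  have "reflection u x \<bullet> reflection u x = x \<bullet> x"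
    using False by (simp add: reflection_def inner_diff_left inner_diff_right inner_commute[of u x] field_simps)
  then show ?thesis by (simp add: norm_eq_sqrt_inner)
qed (simp add: reflection_def)

text \<open>Equal norms give 2 p \<bullet> (p - q) = |p - q|^2. Thus reflections move any point of a
  sphere to any other; for p = q division by zero yields the identity, which is correct.\<close>

lemma reflection_exchange:
  assumes "norm p = norm q"
  shows "reflection (p - q) p = q"
proof (cases "p = q")
  case False
  have pq: "p \<bullet> p = q \<bullet> q" using assms by (simp add: norm_eq_sqrt_inner)
  have "2 * (p \<bullet> (p - q)) = (p - q) \<bullet> (p - q)"
    using pq by (simp add: inner_diff_left inner_diff_right inner_commute)
  then show ?thesis using False by (simp add: reflection_def)
qed (simp add: reflection_def)

lemma dist_reflection: "dist (reflection u x) (reflection u y) = dist x y"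
  using linear_diff[OF linear_reflection[of u], of x y] by (simp add: dist_norm flip: norm_reflection[of u "x - y"])

lemma reflection_measurable [measurable]: "reflection u \<in> borel_measurable borel"
  by (intro borel_measurable_continuous_onI linear_continuous_on linear_reflection[unfolded linear_conv_bounded_linear])

lemma nn_integral_lborel_shift:
  fixes f :: "'a::euclidean_space \<Rightarrow> ennreal"
  assumes [measurable]: "f \<in> borel_measurable borel"
  shows "(\<integral>\<^sup>+x. f (x + c) \<partial>lborel) = (\<integral>\<^sup>+x. f x \<partial>lborel)"
proof -
  have "(\<integral>\<^sup>+x. f x \<partial>lborel) = (\<integral>\<^sup>+x. f x \<partial>distr lborel borel ((+) c))"
    by (simp add: lborel_distr_plus)
  also have "\<dots> = (\<integral>\<^sup>+x. f (x + c) \<partial>lborel)"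
    by (subst nn_integral_distr) (auto simp: add.commute)
  finally show ?thesis by simp
qed

lemma nn_integral_lborel_scale:
  fixes f :: "'a::euclidean_space \<Rightarrow> ennreal"
  assumes [measurable]: "f \<in> borel_measurable borel" and c: "c \<noteq> 0"
  shows "(\<integral>\<^sup>+x. f x \<partial>lborel) = ennreal (\<bar>c\<bar> ^ DIM('a)) * (\<integral>\<^sup>+x. f (c *\<^sub>R x) \<partial>lborel)"
proof -
  have "(\<integral>\<^sup>+x. f x \<partial>lborel) = (\<integral>\<^sup>+x. f x \<partial>density (distr lborel borel (\<lambda>x::'a. 0 + c *\<^sub>R x)) (\<lambda>_. \<bar>c\<bar> ^ DIM('a)))"
    by (subst lborel_affine[OF c, of 0]) simp
  also have "\<dots> = ennreal (\<bar>c\<bar> ^ DIM('a)) * (\<integral>\<^sup>+x. f (c *\<^sub>R x) \<partial>lborel)"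
    by (simp add: nn_integral_density nn_integral_distr nn_integral_cmult)
  finally show ?thesis .
qed

text \<open>Uniqueness of Haar measure: both iterated integrals of \<open>1\<^sub>A(f x) 1\<^sub>B(f x + y)\<close> are evaluated,
  for \<open>f\<close> a reflection and \<open>B\<close> the unit ball.\<close>

lemma emeasure_lborel_reflection:
  fixes A :: "'a::euclidean_space set"
  assumes [measurable]: "A \<in> sets borel"
  shows "emeasure lborel (reflection u -` A) = emeasure lborel A"
proof -
  let ?f = "reflection u" and ?B = "ball (0::'a) 1"
  have [measurable]: "?f -` A \<in> sets borel"
    using measurable_sets[OF reflection_measurable assms, of u] by simp
  have fB: "?f -` ?B = ?B" by auto
  have lin: "?f (x - ?f y) = ?f x - y" for x y
    by (simp add: linear_diff[OF linear_reflection] reflection_involution)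
  have 1: "(\<integral>\<^sup>+x. (\<integral>\<^sup>+y. indicator A (?f x) * indicator ?B (?f x + y) \<partial>lborel) \<partial>lborel) =
      emeasure lborel (?f -` A) * emeasure lborel ?B"
  proof -
    have "(\<integral>\<^sup>+y. indicator A (?f x) * indicator ?B (?f x + y) \<partial>lborel) = indicator (?f -` A) x * emeasure lborel ?B" for x
    proof -
      have "(\<integral>\<^sup>+y. indicator ?B (?f x + y) \<partial>lborel) = emeasure lborel ?B"
        using nn_integral_lborel_shift[OF borel_measurable_indicator, of ?B "?f x"] by (simp add: add.commute[of "?f x"])
      moreover have "indicator A (?f x) = (indicator (?f -` A) x :: ennreal)" by (simp add: indicator_def)
      moreover have "(\<integral>\<^sup>+y. indicator A (?f x) * indicator ?B (?f x + y) \<partial>lborel) =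
          indicator A (?f x) * (\<integral>\<^sup>+y. indicator ?B (?f x + y) \<partial>lborel)"
        by (rule nn_integral_cmult) measurable
      ultimately show ?thesis by simp
    qed
    then show ?thesis by (simp add: nn_integral_multc)
  qed
  have "(\<integral>\<^sup>+x. (\<integral>\<^sup>+y. indicator A (?f x) * indicator ?B (?f x + y) \<partial>lborel) \<partial>lborel) =
      (\<integral>\<^sup>+y. (\<integral>\<^sup>+x. indicator A (?f x) * indicator ?B (?f x + y) \<partial>lborel) \<partial>lborel)"
    by (rule lborel_pair.Fubini') measurable
  \<comment> \<open>The inner integral is translated by - f y. As \<open>f\<close> is linear and an
    involution, this replaces f x by f x - y and moves the shift from the ball to
    \<open>A\<close>.\<close>
  also have "\<dots> = (\<integral>\<^sup>+y. (\<integral>\<^sup>+x. indicator A (?f x - y) * indicator ?B (?f x) \<partial>lborel) \<partial>lborel)"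
  proof (rule nn_integral_cong)
    fix y
    have "(\<integral>\<^sup>+x. indicator A (?f x) * indicator ?B (?f x + y) \<partial>lborel) =
        (\<integral>\<^sup>+x. indicator A (?f (x + - ?f y)) * indicator ?B (?f (x + - ?f y) + y) \<partial>lborel :: ennreal)"
      by (rule nn_integral_lborel_shift[symmetric]) measurable
    then show "(\<integral>\<^sup>+x. indicator A (?f x) * indicator ?B (?f x + y) \<partial>lborel) =
        (\<integral>\<^sup>+x. indicator A (?f x - y) * indicator ?B (?f x) \<partial>lborel :: ennreal)"
      by (simp add: lin)
  qed
  also have "\<dots> = (\<integral>\<^sup>+x. (\<integral>\<^sup>+y. indicator A (?f x - y) * indicator ?B (?f x) \<partial>lborel) \<partial>lborel)"
    by (rule lborel_pair.Fubini') measurable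
  also have "\<dots> = (\<integral>\<^sup>+x. emeasure lborel A * indicator (?f -` ?B) x \<partial>lborel)"
  proof (rule nn_integral_cong)
    fix x
    have "(\<integral>\<^sup>+y. indicator A (?f x - y) \<partial>lborel) = (\<integral>\<^sup>+y. indicator A (?f x + y) \<partial>lborel :: ennreal)"
      using nn_integral_lborel_scale[of "\<lambda>y. indicator A (?f x + y)" "-1"] by simp
    also have "\<dots> = emeasure lborel A"
      using nn_integral_lborel_shift[of "indicator A" "?f x"] by (simp add: add.commute)
    finally have "(\<integral>\<^sup>+y. indicator A (?f x - y) \<partial>lborel) = emeasure lborel A" .
    moreover have "indicator ?B (?f x) = (indicator (?f -` ?B) x :: ennreal)" by (simp add: indicator_def)
    ultimately show "(\<integral>\<^sup>+y. indicator A (?f x - y) * indicator ?B (?f x) \<partial>lborel) =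
        emeasure lborel A * indicator (?f -` ?B) x"
      by (simp add: nn_integral_multc)
  qed
  also have "\<dots> = emeasure lborel A * emeasure lborel ?B"
    unfolding fB by (simp add: nn_integral_cmult)
  finally have "emeasure lborel (?f -` A) * emeasure lborel ?B = emeasure lborel A * emeasure lborel ?B"
    unfolding 1 .
  moreover have "unit_ball_vol (real DIM('a)) \<noteq> 0"
    by (rule less_imp_neq[THEN not_sym]) simp
  then have "emeasure lborel ?B \<noteq> 0" "emeasure lborel ?B \<noteq> \<infinity>"
    by (simp_all add: emeasure_ball)
  ultimately show ?thesis
    by (simp add: mult.commute[of _ "emeasure lborel ?B"] ennreal_mult_cancel_left)
qed

text \<open>Two measures that give all balls of a given radius the same mass are compared by integrating
  \<open>f x\<close> over the pairs with \<open>dist x y \<le> r\<close> in both orders and letting \<open>r\<close> tend to 0.\<close>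

lemma uniformly_distributed_Lipschitz:
  fixes \<mu> \<nu> :: "'a::euclidean_space measure" and f :: "'a \<Rightarrow> real"
  assumes fin: "finite_measure \<mu>" "finite_measure \<nu>"
    and sets [measurable_cong]: "sets \<mu> = sets borel" "sets \<nu> = sets borel"
    and S: "AE x in \<mu>. x \<in> S" "AE x in \<nu>. x \<in> S"
    and g: "\<And>x r. x \<in> S \<Longrightarrow> r > 0 \<Longrightarrow> measure \<mu> (cball x r) = g r"
    and h: "\<And>x r. x \<in> S \<Longrightarrow> r > 0 \<Longrightarrow> measure \<nu> (cball x r) = h r"
    and h0: "\<And>r. r > 0 \<Longrightarrow> h r > 0"
    and f: "\<And>x y. \<bar>f x - f y\<bar> \<le> L * dist x y" "\<And>x. \<bar>f x\<bar> \<le> 1"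
  shows "measure \<nu> UNIV * (\<integral>x. f x \<partial>\<mu>) = measure \<mu> UNIV * (\<integral>x. f x \<partial>\<nu>)"
proof -
  interpret M: finite_measure \<mu> by fact
  interpret N: finite_measure \<nu> by fact
  interpret P: pair_sigma_finite \<mu> \<nu> ..
  let ?k = "\<lambda>r (x::'a) y. indicator (cball x r) y :: real"
  have key: "\<bar>h r * (\<integral>x. f x \<partial>\<mu>) - g r * (\<integral>x. f x \<partial>\<nu>)\<bar> \<le> L * r * g r * measure \<nu> UNIV"
    if f: "\<And>x y. \<bar>f x - f y\<bar> \<le> L * dist x y" "\<And>x. \<bar>f x\<bar> \<le> 1" and r: "r > 0" for f :: "'a \<Rightarrow> real" and L r
  proof -
    have L0: "L \<ge> 0"
    proof -
      obtain b :: 'a where "b \<in> Basis" using nonempty_Basis by blast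
      then have "\<bar>f b - f 0\<bar> \<le> L" using f(1)[of b 0] by simp
      then show ?thesis by simp
    qed
    have "continuous_on UNIV f"
      unfolding continuous_on_iff
    proof (intro ballI allI impI)
      fix x e :: real assume "0 < e" fix x :: 'a
      show "\<exists>d>0. \<forall>x'\<in>UNIV. dist x' x < d \<longrightarrow> dist (f x') (f x) < e"
      proof (intro exI[of _ "e / (L + 1)"] conjI ballI impI)
        show "0 < e / (L + 1)" using L0 \<open>0 < e\<close> by simp
        fix x' assume d: "dist x' x < e / (L + 1)"
        have "dist (f x') (f x) \<le> L * dist x' x" using f(1)[of x' x] by (simp add: dist_real_def)
        also have "\<dots> \<le> (L + 1) * dist x' x" by (intro mult_right_mono) auto
        also have "\<dots> < e" using d L0 by (simp add: pos_less_divide_eq mult.commute)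
        finally show "dist (f x') (f x) < e" .
      qed
    qed
    then have [measurable]: "f \<in> borel_measurable borel" by (rule borel_measurable_continuous_onI)
    have k_sym: "?k r x y = ?k r y x" for x y by (simp add: indicator_def dist_commute)
    have [measurable]: "(\<lambda>p. ?k r (fst p) (snd p)) \<in> borel_measurable (borel \<Otimes>\<^sub>M borel)"
    proof -
      have eq: "(\<lambda>p. ?k r (fst p) (snd p)) = indicator {p. dist (fst p) (snd p) \<le> r}"
        by (auto simp: indicator_def)
      have m: "{p::'a \<times> 'a. dist (fst p) (snd p) \<le> r} \<in> sets (borel \<Otimes>\<^sub>M borel)"
        unfolding borel_prod by (intro borel_closed closed_Collect_le continuous_intros)
      show ?thesis unfolding eq by (rule borel_measurable_indicator[OF m])
    qed
    have [measurable]: "(\<lambda>p. ?k r (snd p) (fst p)) \<in> borel_measurable (borel \<Otimes>\<^sub>M borel)"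
      using \<open>(\<lambda>p. ?k r (fst p) (snd p)) \<in> borel_measurable (borel \<Otimes>\<^sub>M borel)\<close>
      by (subst k_sym)
    have iM: "integrable \<mu> (\<lambda>y. ?k r x y)" for x by (rule M.integrable_const_bound[of _ 1]) auto
    have fM: "integrable \<mu> f" by (rule M.integrable_const_bound[of _ 1]) (use f(2) in auto)
    have fN: "integrable \<nu> f" by (rule N.integrable_const_bound[of _ 1]) (use f(2) in auto)
    have fkM: "integrable \<mu> (\<lambda>x. f x * ?k r y x)" for y
      by (rule M.integrable_const_bound[of _ 1]) (use f(2) in \<open>auto simp: indicator_def\<close>)
    have "h r * (\<integral>x. f x \<partial>\<mu>) = (\<integral>x. f x * h r \<partial>\<mu>)" by simp
    also have "\<dots> = (\<integral>x. (\<integral>y. f x * ?k r y x \<partial>\<nu>) \<partial>\<mu>)"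
    proof (rule integral_cong_AE)
      show "AE x in \<mu>. f x * h r = (\<integral>y. f x * ?k r y x \<partial>\<nu>)"
        using S(1)
      proof eventually_elim
        case (elim x)
        have "(\<lambda>y. f x * ?k r y x) = (\<lambda>y. f x * ?k r x y)" by (rule ext) (simp add: k_sym[of x])
        then show ?case using h[OF elim r] by simp
      qed
    qed measurable
    also have "\<dots> = (\<integral>y. (\<integral>x. f x * ?k r y x \<partial>\<mu>) \<partial>\<nu>)"
    proof (rule P.Fubini_integral[symmetric])
      interpret MN: finite_measure "\<mu> \<Otimes>\<^sub>M \<nu>"
        by (rule finite_measure_pair_measure) fact+
      show "integrable (\<mu> \<Otimes>\<^sub>M \<nu>) (\<lambda>(x, y). f x * ?k r y x)"
      proof (rule MN.integrable_const_bound[of _ 1])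
        show "AE p in \<mu> \<Otimes>\<^sub>M \<nu>. norm (case p of (x, y) \<Rightarrow> f x * ?k r y x) \<le> 1"
          using f(2) by (auto simp: indicator_def)
      qed (simp add: case_prod_beta)
    qed
    finally have 1: "h r * (\<integral>x. f x \<partial>\<mu>) = (\<integral>y. (\<integral>x. f x * ?k r y x \<partial>\<mu>) \<partial>\<nu>)" .
    have i1: "integrable \<nu> (\<lambda>y. \<integral>x. f x * ?k r y x \<partial>\<mu>)"
    proof (rule N.integrable_const_bound[of _ "measure \<mu> UNIV"])
      show "AE y in \<nu>. norm (\<integral>x. f x * ?k r y x \<partial>\<mu>) \<le> measure \<mu> UNIV"
      proof (rule AE_I2)
        fix y
        have "norm (\<integral>x. f x * ?k r y x \<partial>\<mu>) \<le> (\<integral>x. 1 \<partial>\<mu>)"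
          by (rule Bochner_Integration.integral_norm_bound_integral[OF fkM]) (use f(2) in \<open>auto simp: indicator_def\<close>)
        then show "norm (\<integral>x. f x * ?k r y x \<partial>\<mu>) \<le> measure \<mu> UNIV"
          using sets_eq_imp_space_eq[OF sets(1)] by simp
      qed
      show "(\<lambda>y. \<integral>x. f x * ?k r y x \<partial>\<mu>) \<in> borel_measurable \<nu>" by measurable
    qed
    have "h r * (\<integral>x. f x \<partial>\<mu>) - g r * (\<integral>x. f x \<partial>\<nu>) = (\<integral>y. (\<integral>x. f x * ?k r y x \<partial>\<mu>) - g r * f y \<partial>\<nu>)"
      unfolding 1 using i1 fN by simp
    also have "\<bar>\<dots>\<bar> \<le> (\<integral>y. L * r * g r \<partial>\<nu>)"
    proof (rule order.trans[OF integral_abs_bound integral_mono_AE])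
      show "AE y in \<nu>. \<bar>(\<integral>x. f x * ?k r y x \<partial>\<mu>) - g r * f y\<bar> \<le> L * r * g r"
        using S(2)
      proof eventually_elim
        fix y assume y: "y \<in> S"
        have gy: "(\<integral>x. ?k r y x \<partial>\<mu>) = g r" using g[OF y r] by simp
        have "(\<integral>x. f x * ?k r y x \<partial>\<mu>) - g r * f y = (\<integral>x. f x * ?k r y x - f y * ?k r y x \<partial>\<mu>)"
          using fkM iM gy by (simp add: mult.commute)
        also have "\<bar>\<dots>\<bar> \<le> (\<integral>x. L * r * ?k r y x \<partial>\<mu>)"
        proof (rule integral_abs_bound_integral)
          fix x
          have "\<bar>f x - f y\<bar> * ?k r y x \<le> L * r * ?k r y x"
            using f(1)[of x y] mult_left_mono[OF _ L0, of "dist x y" r]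
            by (auto simp: indicator_def dist_commute)
          then show "\<bar>f x * ?k r y x - f y * ?k r y x\<bar> \<le> L * r * ?k r y x"
            by (simp add: left_diff_distrib[symmetric] abs_mult)
        qed (use fkM iM in auto)
        also have "\<dots> = L * r * g r" using gy by simp
        finally show "\<bar>(\<integral>x. f x * ?k r y x \<partial>\<mu>) - g r * f y\<bar> \<le> L * r * g r" .
      qed
    qed (use i1 fN in auto)
    also have "\<dots> = L * r * g r * measure \<nu> UNIV"
      using sets_eq_imp_space_eq[OF sets(2)] by simp
    finally show ?thesis .
  qed
  have sp: "space \<mu> = UNIV" "space \<nu> = UNIV"
    using sets_eq_imp_space_eq[OF sets(1)] sets_eq_imp_space_eq[OF sets(2)] by auto
  let ?m = "measure \<mu> UNIV" and ?n = "measure \<nu> UNIV"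
  \<comment> \<open>For the constant function 1 with Lipschitz constant 0 the error vanishes, so the
    ratio of \<open>g\<close> and \<open>h\<close> is exactly that of the total masses.\<close>
  have gh: "h r * ?m = g r * ?n" if "r > 0" for r
    using key[of "\<lambda>_. 1" 0, OF _ _ that] by (simp add: sp)
  let ?d = "\<bar>?n * (\<integral>x. f x \<partial>\<mu>) - ?m * (\<integral>x. f x \<partial>\<nu>)\<bar>"
  have "?d \<le> r * (L * ?m * ?n)" if r: "r > 0" for r
  proof -
    have "h r * ?d = \<bar>?n * (h r * (\<integral>x. f x \<partial>\<mu>)) - (h r * ?m) * (\<integral>x. f x \<partial>\<nu>)\<bar>"
      using h0[OF r] by (simp add: abs_mult[symmetric, of "h r" "_ - _"] right_diff_distrib mult_ac abs_if)
    also have "\<dots> = \<bar>?n * (h r * (\<integral>x. f x \<partial>\<mu>) - g r * (\<integral>x. f x \<partial>\<nu>))\<bar>"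
      unfolding gh[OF r] by (simp add: right_diff_distrib mult_ac)
    also have "\<dots> \<le> ?n * (L * r * g r * ?n)"
      unfolding abs_mult using key[OF f r] by (simp add: mult_left_mono)
    also have "\<dots> = h r * (r * (L * ?m * ?n))"
      using gh[OF r] by (simp add: mult_ac)
    finally show ?thesis using h0[OF r] by simp
  qed
  then have "?d \<le> 0 + e" if "e > 0" for e
  proof -
    let ?K = "\<bar>L * ?m * ?n\<bar> + 1"
    have "?d \<le> e / ?K * (L * ?m * ?n)" using \<open>\<And>r. r > 0 \<Longrightarrow> ?d \<le> r * (L * ?m * ?n)\<close>[of "e / ?K"] that by simp
    also have "\<dots> \<le> e / ?K * ?K" using that by (intro mult_left_mono) auto
    also have "\<dots> = 0 + e" by simp
    finally show ?thesis .
  qed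
  then have "?d \<le> 0" by (rule field_le_epsilon)
  then show ?thesis by simp
qed

text \<open>The Lipschitz functions min 1 (j dist (x, - U)) increase to the indicator of an open set
  U, so the identity passes to open sets. These are stable under intersection and generate the Borel
  sets.\<close>

lemma uniformly_distributed_unique:
  fixes \<mu> \<nu> :: "'a::euclidean_space measure"
  assumes fin: "finite_measure \<mu>" "finite_measure \<nu>"
    and sets: "sets \<mu> = sets borel" "sets \<nu> = sets borel"
    and S: "AE x in \<mu>. x \<in> S" "AE x in \<nu>. x \<in> S"
    and g: "\<And>x r. x \<in> S \<Longrightarrow> r > 0 \<Longrightarrow> measure \<mu> (cball x r) = g r"
    and h: "\<And>x r. x \<in> S \<Longrightarrow> r > 0 \<Longrightarrow> measure \<nu> (cball x r) = h r"
    and h0: "\<And>r. r > 0 \<Longrightarrow> h r > 0"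
  shows "density \<mu> (\<lambda>_. ennreal (measure \<nu> UNIV)) = density \<nu> (\<lambda>_. ennreal (measure \<mu> UNIV))"
proof -
  interpret M: finite_measure \<mu> by fact
  interpret N: finite_measure \<nu> by fact
  note [measurable_cong] = sets
  let ?m = "measure \<mu> UNIV" and ?n = "measure \<nu> UNIV"
  have open_eq: "?n * measure \<mu> U = ?m * measure \<nu> U" if U: "open U" for U
  \<comment> \<open>The whole space is treated apart: its complement is empty, and the distance to
    the empty set is 0 by convention.\<close>
  proof (cases "U = UNIV")
    case False
    have [measurable]: "U \<in> sets borel" using U by (rule borel_open)
    define f where "f j x = min 1 (real j * infdist x (- U))" for j x
    have f1: "\<bar>f j x\<bar> \<le> 1" for j x by (simp add: f_def infdist_nonneg)
    have fL: "\<bar>f j x - f j y\<bar> \<le> real j * dist x y" for j x y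
    proof -
      have "\<bar>min 1 a - min 1 b\<bar> \<le> \<bar>a - b\<bar>" for a b :: real by auto
      then have "\<bar>f j x - f j y\<bar> \<le> \<bar>real j * infdist x (- U) - real j * infdist y (- U)\<bar>"
        unfolding f_def by blast
      also have "\<dots> = real j * \<bar>infdist x (- U) - infdist y (- U)\<bar>"
        by (simp add: abs_mult right_diff_distrib[symmetric])
      also have "\<dots> \<le> real j * dist x y"
        by (intro mult_left_mono infdist_triangle_abs) auto
      finally show ?thesis .
    qed
    have [measurable]: "f j \<in> borel_measurable borel" for j
      unfolding f_def by (intro borel_measurable_continuous_onI continuous_intros)
    have lim: "(\<lambda>j. f j x) \<longlonglongrightarrow> indicator U x" for x
    proof (cases "x \<in> U")
      case True
      then have "infdist x (- U) > 0"
        using U False in_closed_iff_infdist_zero[of "- U" x] infdist_nonneg[of x "- U"] by (auto simp: less_le)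
      then obtain J where J: "1 < real J * infdist x (- U)" using reals_Archimedean3 by blast
      have "\<forall>j\<ge>J. f j x = 1"
      proof (intro allI impI)
        fix j assume "j \<ge> J"
        then have "real J * infdist x (- U) \<le> real j * infdist x (- U)"
          by (intro mult_right_mono) (auto simp: infdist_nonneg)
        with J show "f j x = 1" by (simp add: f_def)
      qed
      then have "eventually (\<lambda>j. f j x = 1) sequentially" by (auto simp: eventually_sequentially)
      then show ?thesis using True by (simp add: tendsto_eventually)
    qed (simp add: f_def)
    have mU: "(\<lambda>j. \<integral>x. f j x \<partial>\<mu>) \<longlonglongrightarrow> measure \<mu> U"
    proof -
      have "(\<lambda>j. \<integral>x. f j x \<partial>\<mu>) \<longlonglongrightarrow> (\<integral>x. indicator U x \<partial>\<mu>)"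
        by (rule integral_dominated_convergence[where w = "\<lambda>_. 1"]) (use f1 lim U in auto)
      then show ?thesis using U sets_eq_imp_space_eq[OF sets(1)] by simp
    qed
    have nU: "(\<lambda>j. \<integral>x. f j x \<partial>\<nu>) \<longlonglongrightarrow> measure \<nu> U"
    proof -
      have "(\<lambda>j. \<integral>x. f j x \<partial>\<nu>) \<longlonglongrightarrow> (\<integral>x. indicator U x \<partial>\<nu>)"
        by (rule integral_dominated_convergence[where w = "\<lambda>_. 1"]) (use f1 lim U in auto)
      then show ?thesis using U sets_eq_imp_space_eq[OF sets(2)] by simp
    qed
    have "?n * (\<integral>x. f j x \<partial>\<mu>) = ?m * (\<integral>x. f j x \<partial>\<nu>)" for j
      by (rule uniformly_distributed_Lipschitz[OF fin sets S g h h0 fL f1])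
    with tendsto_mult_left[OF mU, of ?n] tendsto_mult_left[OF nU, of ?m] show ?thesis
      by (simp add: LIMSEQ_unique)
  qed (simp add: mult.commute)
  show ?thesis
  proof (rule measure_eqI_generator_eq[where E = "{U. open U}" and \<Omega> = UNIV and A = "\<lambda>_. UNIV"])
    show "Int_stable {U::'a set. open U}" by (auto simp: Int_stable_def)
    show "sets (density \<mu> (\<lambda>_. ennreal ?n)) = sigma_sets UNIV {U. open U}"
      "sets (density \<nu> (\<lambda>_. ennreal ?m)) = sigma_sets UNIV {U. open U}"
      by (simp_all add: sets borel_def)
    fix U :: "'a set" assume "U \<in> {U. open U}"
    then have U: "open U" by simp
    then have "U \<in> sets \<mu>" "U \<in> sets \<nu>" by (simp_all add: sets)
    then show "emeasure (density \<mu> (\<lambda>_. ennreal ?n)) U = emeasure (density \<nu> (\<lambda>_. ennreal ?m)) U"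
      using open_eq[OF U] by (simp add: emeasure_density_const M.emeasure_eq_measure N.emeasure_eq_measure flip: ennreal_mult)
  next
    show "emeasure (density \<mu> (\<lambda>_. ennreal ?n)) UNIV \<noteq> \<infinity>"
      by (simp add: emeasure_density_const sets M.emeasure_eq_measure flip: ennreal_mult)
  qed auto
qed

section \<open>The cone measure on the sphere\<close>

definition punctured_ball :: "'a::euclidean_space set" where
  "punctured_ball = cball 0 1 - {0}"

lemma punctured_ball_measurable [measurable]: "punctured_ball \<in> sets borel"
  by (simp add: punctured_ball_def)

lemma sgn_measurable [measurable]: "sgn \<in> borel_measurable (borel :: 'a::euclidean_space measure)"
  unfolding sgn_div_norm[abs_def] by measurable

text \<open>A set on the sphere is measured by the volume of the cone over it inside the unit ball.
  The origin is removed since sgn 0 = 0 does not lie on the sphere.\<close>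

definition cone_measure :: "'a::euclidean_space measure" where
  "cone_measure = distr (density lborel (indicator punctured_ball)) borel sgn"

lemma sets_cone_measure [simp, measurable_cong]: "sets cone_measure = sets borel"
  by (simp add: cone_measure_def)

lemma emeasure_cone_measure:
  assumes [measurable]: "A \<in> sets borel"
  shows "emeasure cone_measure A = emeasure lborel (punctured_ball \<inter> sgn -` A)"
proof -
  have [measurable]: "sgn -` A \<in> sets borel"
    using measurable_sets[OF sgn_measurable assms] by simp
  show ?thesis
    unfolding cone_measure_def by (subst emeasure_distr) (auto simp: emeasure_restricted)
qed

lemma emeasure_punctured_ball: "emeasure lborel (punctured_ball::'a::euclidean_space set) < \<infinity>"
proof -
  have "emeasure lborel (punctured_ball::'a set) \<le> emeasure lborel (cball (0::'a) 1)"
    by (rule emeasure_mono) (auto simp: punctured_ball_def)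
  also have "\<dots> < \<infinity>" by (simp add: emeasure_cball)
  finally show ?thesis .
qed

lemma finite_cone_measure: "finite_measure (cone_measure::'a::euclidean_space measure)"
proof
  have "emeasure (cone_measure::'a measure) UNIV = emeasure lborel (punctured_ball::'a set)"
    by (simp add: emeasure_cone_measure)
  also have "\<dots> < \<infinity>" by (rule emeasure_punctured_ball)
  finally show "emeasure (cone_measure::'a measure) (space cone_measure) \<noteq> \<infinity>"
    by (simp add: cone_measure_def)
qed

text \<open>The reflection exchanging p and q commutes with \<open>sgn\<close>, so it maps the cone
  over one ball to the cone over the other, and it preserves Lebesgue measure.\<close>

lemma cone_measure_cball:
  fixes p q :: "'a::euclidean_space"
  assumes "norm p = 1" "norm q = 1"
  shows "emeasure cone_measure (cball p r) = emeasure cone_measure (cball q r)"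
proof -
  let ?f = "reflection (p - q)"
  have fp: "?f p = q" using assms by (intro reflection_exchange) simp
  have sg: "sgn (?f z) = ?f (sgn z)" for z
    by (simp add: sgn_div_norm linear_cmul[OF linear_reflection])
  have nz: "?f z = 0 \<longleftrightarrow> z = 0" for z using norm_reflection[of "p - q" z] by (metis norm_eq_zero)
  have "dist q (?f z) = dist p z" for z using dist_reflection[of "p - q" p z] fp by simp
  then have eq: "?f -` (punctured_ball \<inter> sgn -` cball q r) = punctured_ball \<inter> sgn -` cball p r"
    by (auto simp: punctured_ball_def sg nz)
  have m: "punctured_ball \<inter> sgn -` cball q r \<in> sets borel"
    using measurable_sets[OF sgn_measurable, of "cball q r"] by (intro sets.Int) auto
  have "emeasure cone_measure (cball p r) = emeasure lborel (?f -` (punctured_ball \<inter> sgn -` cball q r))"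
    unfolding eq by (rule emeasure_cone_measure) measurable
  also have "\<dots> = emeasure lborel (punctured_ball \<inter> sgn -` cball q r)"
    by (rule emeasure_lborel_reflection[OF m])
  also have "\<dots> = emeasure cone_measure (cball q r)"
    by (rule emeasure_cone_measure[symmetric]) measurable
  finally show ?thesis .
qed

lemma cone_measure_cball_pos:
  fixes p :: "'a::euclidean_space"
  assumes p: "norm p = 1" and r: "r > 0"
  shows "emeasure cone_measure (cball p r) > 0"
proof -
  \<comment> \<open>If |z - p/2| < e, then |z| > 1/4 and z differs from |z| p by at most 2e;
    dividing by |z| gives |sgn z - p| \<le> 8e \<le> r.\<close>
  define e where "e = min (1 / 4) (r / 8)"
  have e: "e > 0" "e \<le> 1 / 4" "8 * e \<le> r" using r by (auto simp: e_def)
  have "ball ((1 / 2) *\<^sub>R p) e \<subseteq> punctured_ball \<inter> sgn -` cball p r"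
  proof
    fix z assume "z \<in> ball ((1 / 2) *\<^sub>R p) e"
    then have d: "norm (z - (1 / 2) *\<^sub>R p) < e" by (simp add: dist_norm norm_minus_commute)
    have h: "norm ((1 / 2) *\<^sub>R p) = 1 / 2" using p by simp
    have nz: "\<bar>norm z - 1 / 2\<bar> < e" using d norm_triangle_ineq3[of z "(1 / 2) *\<^sub>R p"] h by simp
    then have z: "norm z > 1 / 4" "norm z < 1" using e by auto
    have "norm (z - norm z *\<^sub>R p) \<le> norm (z - (1 / 2) *\<^sub>R p) + norm ((1 / 2) *\<^sub>R p - norm z *\<^sub>R p)"
      using norm_triangle_ineq[of "z - (1 / 2) *\<^sub>R p" "(1 / 2) *\<^sub>R p - norm z *\<^sub>R p"] by simp
    also have "norm ((1 / 2) *\<^sub>R p - norm z *\<^sub>R p) = \<bar>norm z - 1 / 2\<bar>"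
      using p by (simp add: abs_minus_commute flip: scaleR_diff_left)
    finally have "norm (z - norm z *\<^sub>R p) \<le> 2 * e" using d nz by linarith
    also have "\<dots> \<le> r * (1 / 4)" using e by simp
    also have "\<dots> \<le> r * norm z" using z r by (intro mult_left_mono) auto
    finally have "norm (z - norm z *\<^sub>R p) / norm z \<le> r" using z by (subst pos_divide_le_eq) auto
    moreover have "norm (z - norm z *\<^sub>R p) / norm z = norm (sgn z - p)"
    proof -
      have "sgn z - p = (z - norm z *\<^sub>R p) /\<^sub>R norm z"
        using z(1) zero_less_norm_iff[of z] by (cases "z = 0") (simp_all add: sgn_div_norm scaleR_diff_right)
      then show ?thesis by (simp add: divide_inverse mult.commute)
    qed
    ultimately show "z \<in> punctured_ball \<inter> sgn -` cball p r"
      using z by (auto simp: punctured_ball_def dist_norm norm_minus_commute)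
  qed
  moreover have "punctured_ball \<inter> sgn -` cball p r \<in> sets borel"
    using measurable_sets[OF sgn_measurable, of "cball p r"] by (intro sets.Int) auto
  ultimately have "emeasure lborel (ball ((1 / 2) *\<^sub>R p) e) \<le> emeasure cone_measure (cball p r)"
    by (simp add: emeasure_cone_measure emeasure_mono)
  moreover have "emeasure lborel (ball ((1 / 2) *\<^sub>R p) e) > 0"
    using e by (simp add: emeasure_ball)
  ultimately show ?thesis by (rule less_le_trans[rotated])
qed

section \<open>Finite and positive Hausdorff measure of the sphere\<close>

lemma power_diff_le:
  fixes a b :: real
  assumes "0 \<le> b" "b \<le> a"
  shows "a ^ n - b ^ n \<le> (a - b) * (real n * a ^ (n - 1))"
proof -
  have "(\<Sum>i<n. b ^ (n - Suc i) * a ^ i) \<le> (\<Sum>i<n. a ^ (n - 1))"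
  proof (rule sum_mono)
    fix i assume "i \<in> {..<n}"
    then have "n - 1 = (n - Suc i) + i" by auto
    then have "a ^ (n - 1) = a ^ (n - Suc i) * a ^ i" by (simp add: power_add)
    then show "b ^ (n - Suc i) * a ^ i \<le> a ^ (n - 1)"
      using assms by (simp add: mult_right_mono power_mono)
  qed
  then show ?thesis
    unfolding power_diff_sumr2 using assms by (intro mult_left_mono) auto
qed

text \<open>The balls of radius \<delta>/2 about the points are disjoint and lie in a shell of
  thickness \<delta> around the sphere, whose volume is of order \<delta>. Division by \<delta>^d
  leaves the exponent d-1.\<close>

lemma separated_subset_sphere_card:
  fixes X :: "'a::euclidean_space set"
  assumes X: "finite X" "X \<subseteq> sphere 0 1" and d: "0 < \<delta>" "\<delta> \<le> 1"
    and sep: "\<And>x y. x \<in> X \<Longrightarrow> y \<in> X \<Longrightarrow> x \<noteq> y \<Longrightarrow> \<delta> \<le> dist x y"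
  shows "real (card X) * \<delta> ^ (DIM('a) - 1) \<le> real DIM('a) * 4 ^ DIM('a)"
proof -
  let ?d = "DIM('a)" and ?s = "\<delta> / 2"
  let ?w = "unit_ball_vol (real ?d)"
  have w: "?w > 0" by simp
  let ?U = "\<Union>x\<in>X. ball x ?s"
  have disj: "disjoint_family_on (\<lambda>x. ball x ?s) X"
  proof (clarsimp simp: disjoint_family_on_def)
    fix x y assume xy: "x \<in> X" "y \<in> X" "x \<noteq> y"
    have False if "z \<in> ball x ?s" "z \<in> ball y ?s" for z
      using that sep[OF xy] dist_triangle2[of x y z] by (simp add: dist_commute)
    then show "ball x ?s \<inter> ball y ?s = {}" by blast
  qed
  have "real (card X) * (?w * ?s ^ ?d) = (\<Sum>x\<in>X. measure lborel (ball x ?s))"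
    using d by (simp add: content_ball)
  also have "\<dots> = measure lborel ?U"
    using X(1) disj d by (intro measure_finite_Union[symmetric]) (auto simp: emeasure_ball)
  also have "\<dots> \<le> measure lborel (ball (0::'a) (1 + ?s) - ball 0 (1 - ?s))"
  proof (rule measure_mono_fmeasurable)
    show "?U \<subseteq> ball 0 (1 + ?s) - ball 0 (1 - ?s)"
    proof clarify
      fix x z assume "x \<in> X" and z: "z \<in> ball x ?s"
      then have "norm x = 1" using X(2) by auto
      moreover have "\<bar>norm x - norm z\<bar> < ?s"
        using z norm_triangle_ineq3[of x z] by (simp add: dist_norm)
      ultimately have "1 - norm z < ?s" "norm z - 1 < ?s" unfolding abs_less_iff by simp_all
      then show "z \<in> ball 0 (1 + ?s) - ball 0 (1 - ?s)" by simp
    qed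
    show "ball (0::'a) (1 + ?s) - ball 0 (1 - ?s) \<in> fmeasurable lborel"
      using d by (intro fmeasurable.Diff) (auto simp: fmeasurable_def emeasure_ball)
  qed (auto intro!: borel_open)
  also have "\<dots> = measure lborel (ball (0::'a) (1 + ?s)) - measure lborel (ball (0::'a) (1 - ?s))"
    using d by (intro measure_Diff) (auto simp: emeasure_ball intro: subset_ball)
  also have "\<dots> = ?w * ((1 + ?s) ^ ?d - (1 - ?s) ^ ?d)"
    using d by (simp add: content_ball right_diff_distrib)
  also have "\<dots> \<le> ?w * (\<delta> * (real ?d * 2 ^ (?d - 1)))"
  proof (intro mult_left_mono)
    have "(1 + ?s) ^ ?d - (1 - ?s) ^ ?d \<le> ((1 + ?s) - (1 - ?s)) * (real ?d * (1 + ?s) ^ (?d - 1))"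
      using d by (intro power_diff_le) auto
    also have "\<dots> \<le> \<delta> * (real ?d * 2 ^ (?d - 1))"
      using d by (intro mult_mono power_mono) auto
    finally show "(1 + ?s) ^ ?d - (1 - ?s) ^ ?d \<le> \<delta> * (real ?d * 2 ^ (?d - 1))" .
  qed (use w in simp)
  finally have "real (card X) * ?s ^ ?d \<le> \<delta> * (real ?d * 2 ^ (?d - 1))"
    using w by (simp add: mult.left_commute[of _ ?w])
  moreover obtain k where k: "?d = Suc k" using DIM_positive[where 'a = 'a] gr0_implies_Suc by blast
  ultimately have "\<delta> * (real (card X) * \<delta> ^ k) \<le> \<delta> * (real ?d * (2 ^ k * 2 ^ Suc k))"
    using d by (simp add: power_divide field_simps)
  then have "real (card X) * \<delta> ^ k \<le> real ?d * (2 ^ k * 2 ^ Suc k)"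
    using d(1) by (rule mult_left_le_imp_le)
  also have "\<dots> \<le> real ?d * 4 ^ ?d"
    unfolding k by (simp add: power_add[symmetric] mult_2[symmetric] power_mult)
  finally show ?thesis by (simp add: k)
qed

text \<open>A \<delta>-separated subset of maximal cardinality is a \<delta>-net: an uncovered point
  could be added to it. The cardinality bound guarantees that a maximum exists.\<close>

lemma sphere_cover:
  fixes \<delta> :: real
  assumes d: "0 < \<delta>" "\<delta> \<le> 1"
  obtains X :: "'a::euclidean_space set" where "finite X" "sphere 0 1 \<subseteq> (\<Union>x\<in>X. cball x \<delta>)"
    "real (card X) * \<delta> ^ (DIM('a) - 1) \<le> real DIM('a) * 4 ^ DIM('a)"
proof -
  define P where "P n \<longleftrightarrow> (\<exists>X::'a set. finite X \<and> X \<subseteq> sphere 0 1 \<and> card X = n \<and>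
    (\<forall>x\<in>X. \<forall>y\<in>X. x \<noteq> y \<longrightarrow> \<delta> \<le> dist x y))" for n
  have "P 0" unfolding P_def by (intro exI[of _ "{}"]) auto
  moreover have "\<forall>n. P n \<longrightarrow> n \<le> nat \<lfloor>real DIM('a) * 4 ^ DIM('a) / \<delta> ^ (DIM('a) - 1)\<rfloor>"
  proof (intro allI impI)
    fix n assume "P n"
    then obtain X :: "'a set" where X: "finite X" "X \<subseteq> sphere 0 1" "card X = n"
      "\<And>x y. x \<in> X \<Longrightarrow> y \<in> X \<Longrightarrow> x \<noteq> y \<Longrightarrow> \<delta> \<le> dist x y" by (auto simp: P_def)
    have "real n \<le> real DIM('a) * 4 ^ DIM('a) / \<delta> ^ (DIM('a) - 1)"
      using separated_subset_sphere_card[OF X(1,2) d X(4)] X(3) d by (simp add: pos_le_divide_eq)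
    then show "n \<le> nat \<lfloor>real DIM('a) * 4 ^ DIM('a) / \<delta> ^ (DIM('a) - 1)\<rfloor>" by (rule le_nat_floor)
  qed
  ultimately obtain n where n: "P n" "\<And>j. P j \<Longrightarrow> j \<le> n"
    using Greatest_le_nat[of P] GreatestI_nat[of P] by metis
  then obtain X :: "'a set" where X: "finite X" "X \<subseteq> sphere 0 1" "card X = n"
      "\<And>x y. x \<in> X \<Longrightarrow> y \<in> X \<Longrightarrow> x \<noteq> y \<Longrightarrow> \<delta> \<le> dist x y" by (auto simp: P_def)
  have "sphere 0 1 \<subseteq> (\<Union>x\<in>X. cball x \<delta>)"
  proof
    fix z :: 'a assume z: "z \<in> sphere 0 1"
    show "z \<in> (\<Union>x\<in>X. cball x \<delta>)"
    proof (rule ccontr)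
      assume "z \<notin> (\<Union>x\<in>X. cball x \<delta>)"
      then have far: "\<And>x. x \<in> X \<Longrightarrow> \<delta> < dist x z" by auto
      then have "z \<notin> X" using d by force
      have "P (Suc n)"
        unfolding P_def using X z far \<open>z \<notin> X\<close>
        by (intro exI[of _ "insert z X"]) (auto simp: dist_commute less_imp_le)
      then show False using n(2)[of "Suc n"] by simp
    qed
  qed
  then show ?thesis using that[OF X(1)] separated_subset_sphere_card[OF X(1,2) d X(4)] by blast
qed

lemma hausdorff_sphere_finite:
  "emeasure (hausdorff_measure (DIM('a) - 1)) (sphere (0::'a::euclidean_space) 1) < \<infinity>"
proof -
  let ?k = "DIM('a) - 1"
  define K where "K = unit_ball_vol (real ?k) * (real DIM('a) * 4 ^ DIM('a))"
  have content: "hausdorff_content ?k \<delta>' (sphere (0::'a) 1) \<le> ennreal K" if d': "\<delta>' > 0" for \<delta>'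
  proof -
    define \<delta> where "\<delta> = min 1 (\<delta>' / 2)"
    have d: "0 < \<delta>" "\<delta> \<le> 1" "2 * \<delta> \<le> \<delta>'" using d' by (auto simp: \<delta>_def)
    obtain X :: "'a set" where X: "finite X" "sphere 0 1 \<subseteq> (\<Union>x\<in>X. cball x \<delta>)"
      "real (card X) * \<delta> ^ ?k \<le> real DIM('a) * 4 ^ DIM('a)"
      using sphere_cover[OF d(1,2)] by blast
    obtain e where e: "bij_betw e {..<card X} X"
      using X(1) by (metis bij_betw_from_nat_into_finite)
    define C where "C i = (if i < card X then cball (e i) \<delta> else {})" for i
    have diam: "diameter (cball x \<delta>) = 2 * \<delta>" for x :: 'a
      using d by simp
    have "sphere 0 1 \<subseteq> (\<Union>i. C i)"
    proof
      fix z :: 'a assume "z \<in> sphere 0 1"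
      then obtain x where "x \<in> X" "z \<in> cball x \<delta>" using X(2) by blast
      moreover from this obtain i where "i < card X" "e i = x"
        using bij_betw_imp_surj_on[OF e] by (metis imageE lessThan_iff)
      ultimately have "z \<in> C i" by (simp add: C_def)
      then show "z \<in> (\<Union>i. C i)" by blast
    qed
    moreover have "bounded (C i) \<and> diameter (C i) \<le> \<delta>'" for i
      using d d' diam by (auto simp: C_def)
    ultimately have "hausdorff_content ?k \<delta>' (sphere (0::'a) 1) \<le> (\<Sum>i. hausdorff_weight ?k (C i))"
      unfolding hausdorff_content_def by (intro INF_lower) auto
    also have "\<dots> = (\<Sum>i<card X. hausdorff_weight ?k (C i))"
      by (rule suminf_finite) (auto simp: C_def hausdorff_weight_def)
    also have "\<dots> = (\<Sum>i<card X. ennreal (unit_ball_vol (real ?k) * \<delta> ^ ?k))"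
      using d by (intro sum.cong) (auto simp: C_def hausdorff_weight_def diam)
    also have "\<dots> = ennreal (unit_ball_vol (real ?k) * (real (card X) * \<delta> ^ ?k))"
      using d by (simp add: ennreal_of_nat_eq_real_of_nat ennreal_mult[symmetric] mult_ac)
    also have "\<dots> \<le> ennreal K"
      unfolding K_def using X(3) by (intro ennreal_leI mult_left_mono) auto
    finally show ?thesis .
  qed
  have "emeasure (hausdorff_measure ?k) (sphere (0::'a) 1) = hausdorff_outer ?k (sphere (0::'a) 1)"
    by (intro emeasure_hausdorff_measure) (simp add: borel_closed)
  also have "\<dots> \<le> ennreal K"
    unfolding hausdorff_outer_def using content by (intro SUP_least) auto
  also have "\<dots> < \<infinity>" by simp
  finally show ?thesis .
qed

text \<open>The projection of the sphere to the ball in one dimension less does not increase distances.\<close>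

lemma hausdorff_sphere_prod_pos:
  "emeasure (hausdorff_measure DIM('a)) (sphere (0::'a::euclidean_space \<times> real) 1) > 0"
proof -
  let ?k = "DIM('a)" and ?S = "sphere (0::'a \<times> real) 1"
  let ?w = "unit_ball_vol (real ?k)"
  have w: "?w > 0" by simp
  have "ennreal (?w / 2 ^ ?k) \<le> hausdorff_content ?k 1 ?S"
    unfolding hausdorff_content_def
  proof (rule INF_greatest, clarify)
    fix C :: "nat \<Rightarrow> ('a \<times> real) set"
    assume C: "?S \<subseteq> (\<Union>i. C i)" "\<forall>i. bounded (C i) \<and> diameter (C i) \<le> 1"
    \<comment> \<open>A set of diameter s projects into the closed ball of radius s about any one of
      its projected points. The weight is built from s/2, so the volume of this ball is 2^k times
      the weight; this is the factor in the lower bound.\<close>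
    define D where "D i = (if C i = {} then {} else cball (fst (SOME p. p \<in> C i)) (diameter (C i)))" for i
    have sub: "fst p \<in> D i" if p: "p \<in> C i" for p i
    proof -
      let ?q = "SOME p. p \<in> C i"
      have q: "?q \<in> C i" using p by (rule someI)
      have "dist (fst ?q) (fst p) \<le> dist ?q p" by (rule dist_fst_le)
      also have "\<dots> \<le> diameter (C i)" using C q p by (intro diameter_bounded_bound) auto
      finally show ?thesis using p by (auto simp: D_def)
    qed
    have diam0: "0 \<le> diameter (C i)" for i using C by (intro diameter_ge_0) auto
    have D [measurable]: "D i \<in> sets borel" for i by (simp add: D_def)
    have "cball (0::'a) 1 \<subseteq> (\<Union>i. D i)"
    proof
      fix u :: 'a assume "u \<in> cball 0 1"
      then have u: "norm u ^ 2 \<le> 1" by (simp add: power_le_one)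
      then have "(u, sqrt (1 - norm u ^ 2)) \<in> ?S"
        by (simp add: norm_Pair)
      then obtain i where "(u, sqrt (1 - norm u ^ 2)) \<in> C i" using C by blast
      from sub[OF this] show "u \<in> (\<Union>i. D i)" by auto
    qed
    then have "emeasure lborel (cball (0::'a) 1) \<le> emeasure lborel (\<Union>i. D i)"
      by (rule emeasure_mono) measurable
    also have "\<dots> \<le> (\<Sum>i. emeasure lborel (D i))"
      using D by (intro emeasure_subadditive_countably) auto
    also have "\<dots> = (\<Sum>i. ennreal (2 ^ ?k) * hausdorff_weight ?k (C i))"
    proof (rule suminf_cong)
      fix i
      show "emeasure lborel (D i) = ennreal (2 ^ ?k) * hausdorff_weight ?k (C i)"
        using diam0[of i]
        by (cases "C i = {}")
          (simp_all add: D_def hausdorff_weight_def emeasure_cball power_divide flip: ennreal_mult)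
    qed
    also have "\<dots> = ennreal (2 ^ ?k) * (\<Sum>i. hausdorff_weight ?k (C i))"
      by (rule ennreal_suminf_cmult)
    finally have le: "ennreal ?w \<le> ennreal (2 ^ ?k) * (\<Sum>i. hausdorff_weight ?k (C i))"
      by (simp add: emeasure_cball)
    have "ennreal (?w / 2 ^ ?k) = ennreal (1 / 2 ^ ?k) * ennreal ?w"
      by (simp add: ennreal_mult[symmetric])
    also have "\<dots> \<le> ennreal (1 / 2 ^ ?k) * (ennreal (2 ^ ?k) * (\<Sum>i. hausdorff_weight ?k (C i)))"
      using le by (rule mult_left_mono) simp
    also have "\<dots> = (\<Sum>i. hausdorff_weight ?k (C i))"
      by (simp add: mult.assoc[symmetric] ennreal_mult[symmetric])
    finally show "ennreal (?w / 2 ^ ?k) \<le> (\<Sum>i. hausdorff_weight ?k (C i))" .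
  qed
  also have "\<dots> \<le> hausdorff_outer ?k ?S" by (rule hausdorff_content_le_outer) simp
  also have "\<dots> = emeasure (hausdorff_measure ?k) ?S"
    by (intro emeasure_hausdorff_measure[symmetric]) (simp add: borel_closed)
  finally show ?thesis using w by (simp add: less_le_trans[rotated])
qed

text \<open>Reflections show that the Hausdorff measure on the sphere and the cone measure both give
  the same mass to all balls of equal radius centred on the sphere. Hence they are proportional,
  with the quotient of the total masses as constant; \<open>pos\<close> makes it positive.\<close>

lemma integral_sphere_hausdorff:
  assumes pos: "emeasure (hausdorff_measure (DIM('a) - 1)) (sphere (0::'a::euclidean_space) 1) > 0"
  obtains C where "C > 0" "\<And>f :: 'a \<Rightarrow> real. f \<in> borel_measurable borel \<Longrightarrow>
    (LINT \<xi>:sphere 0 1|hausdorff_measure (DIM('a) - 1). f \<xi>) = C * (\<integral>z. indicator punctured_ball z * f (sgn z) \<partial>lborel)"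
proof -
  let ?H = "hausdorff_measure (DIM('a) - 1) :: 'a measure" and ?S = "sphere (0::'a) 1"
  define \<mu> where "\<mu> = density ?H (indicator ?S)"
  have [measurable]: "?S \<in> sets borel" by (simp add: borel_closed)
  have S: "?S \<in> sets ?H" by simp
  have mu: "emeasure \<mu> A = emeasure ?H (?S \<inter> A)" if "A \<in> sets borel" for A
    unfolding \<mu>_def using that S by (subst emeasure_restricted) auto
  have sets_mu: "sets \<mu> = sets borel" by (simp add: \<mu>_def)
  have fin: "finite_measure \<mu>"
    using mu[of UNIV] hausdorff_sphere_finite[where 'a = 'a]
    by (intro finite_measureI) (simp add: \<mu>_def)
  interpret M: finite_measure \<mu> by (rule fin)
  interpret N: finite_measure "cone_measure :: 'a measure" by (rule finite_cone_measure)
  have "emeasure \<mu> UNIV > 0" using mu[of UNIV] pos by simp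
  then have m0: "measure \<mu> UNIV > 0" by (simp add: M.emeasure_eq_measure)
  have H_cball: "emeasure \<mu> (cball p r) \<le> emeasure \<mu> (cball q r)" if "p \<in> ?S" "q \<in> ?S" for p q r
  proof -
    let ?f = "reflection (q - p)"
    have fq: "?f q = p" using that by (intro reflection_exchange) simp
    have "dist p (?f z) = dist q z" for z using dist_reflection[of "q - p" q z] fq by simp
    then have "?S \<inter> cball p r \<subseteq> ?f ` (?S \<inter> cball q r)"
      by (intro subsetI image_eqI[where f = ?f, OF reflection_involution[symmetric]])
        (metis (no_types) IntE IntI mem_cball mem_sphere_0 norm_reflection reflection_involution)
    then have "hausdorff_outer (DIM('a) - 1) (?S \<inter> cball p r) \<le> hausdorff_outer (DIM('a) - 1) (?f ` (?S \<inter> cball q r))"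
      by (rule hausdorff_outer_mono)
    also have "\<dots> \<le> hausdorff_outer (DIM('a) - 1) (?S \<inter> cball q r)"
      by (rule hausdorff_outer_isometry_le[OF dist_reflection])
    finally show ?thesis by (simp add: mu emeasure_hausdorff_measure)
  qed
  obtain b :: 'a where b: "b \<in> Basis" using nonempty_Basis by blast
  then have bS: "b \<in> ?S" by simp
  have AE_mu: "AE x in \<mu>. x \<in> ?S"
    unfolding \<mu>_def by (subst AE_density) (auto simp: indicator_def)
  have AE_cone: "AE x in cone_measure. x \<in> ?S"
    unfolding cone_measure_def
    by (subst AE_distr_iff) (auto simp: AE_density punctured_ball_def indicator_def norm_sgn)
  have g: "measure \<mu> (cball x r) = measure \<mu> (cball b r)" if "x \<in> ?S" for x r
    using antisym[OF H_cball[OF that bS, of r] H_cball[OF bS that, of r]] by (simp add: measure_def)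
  have h: "measure cone_measure (cball x r) = measure cone_measure (cball b r)" if "x \<in> ?S" for x r
    using cone_measure_cball[of x b r] that bS by (simp add: measure_def)
  have h0: "measure cone_measure (cball b r) > 0" if "r > 0" for r
    using cone_measure_cball_pos[OF _ that, of b] bS by (simp add: N.emeasure_eq_measure)
  let ?m = "measure \<mu> UNIV" and ?n = "measure (cone_measure :: 'a measure) UNIV"
  have n0: "?n > 0"
  proof -
    have "measure cone_measure (cball b 1) \<le> ?n" by (rule N.finite_measure_mono) auto
    with h0[of 1] show ?thesis by linarith
  qed
  have eq: "density \<mu> (\<lambda>_. ennreal ?n) = density cone_measure (\<lambda>_. ennreal ?m)"
    by (rule uniformly_distributed_unique[OF fin finite_cone_measure sets_mu sets_cone_measure AE_mu AE_cone g h h0])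
  show ?thesis
  proof (rule that)
    show "?m / ?n > 0" using m0 n0 by simp
    fix f :: "'a \<Rightarrow> real" assume [measurable]: "f \<in> borel_measurable borel"
    have fmu: "f \<in> borel_measurable \<mu>" using sets_mu by (simp cong: measurable_cong_sets)
    have "?n * (LINT \<xi>:?S|?H. f \<xi>) = ?n * (\<integral>\<xi>. f \<xi> \<partial>density ?H (\<lambda>\<xi>. ennreal (indicator ?S \<xi>)))"
      unfolding set_lebesgue_integral_def by (subst integral_density) auto
    also have "\<dots> = ?n * (\<integral>\<xi>. f \<xi> \<partial>\<mu>)" by (simp add: \<mu>_def ennreal_indicator)
    also have "\<dots> = (\<integral>\<xi>. f \<xi> \<partial>density \<mu> (\<lambda>_. ennreal ?n))"
      using fmu by (subst integral_density) auto
    also have "\<dots> = ?m * (\<integral>\<xi>. f \<xi> \<partial>cone_measure)"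
      unfolding eq by (subst integral_density) auto
    also have "(\<integral>\<xi>. f \<xi> \<partial>cone_measure) = (\<integral>z. f (sgn z) \<partial>density lborel (\<lambda>z. ennreal (indicator punctured_ball z)))"
      unfolding cone_measure_def by (subst integral_distr) (auto simp: ennreal_indicator)
    also have "\<dots> = (\<integral>z. indicator punctured_ball z * f (sgn z) \<partial>lborel)"
      by (subst integral_density) auto
    finally show "(LINT \<xi>:?S|?H. f \<xi>) = ?m / ?n * (\<integral>z. indicator punctured_ball z * f (sgn z) \<partial>lborel)"
      using n0 by (simp add: field_simps)
  qed
qed

section \<open>Polar coordinates and John's formula\<close>

lemma nn_integral_power_exp_power:
  assumes M: "M > 0" and \<rho>: "\<rho> > 0"
  shows "(\<integral>\<^sup>+r. ennreal (r ^ (M - 1) * exp (- \<rho> * r ^ M)) * indicator {0..} r \<partial>lborel) = ennreal (1 / (real M * \<rho>))"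
proof -
  let ?F = "\<lambda>r. - exp (- \<rho> * r ^ M) / (real M * \<rho>)"
  have "(\<integral>\<^sup>+r. ennreal (r ^ (M - 1) * exp (- \<rho> * r ^ M)) * indicator {0..} r \<partial>lborel) = ennreal (0 - ?F 0)"
  proof (rule nn_integral_FTC_atLeast[where F = ?F])
    fix r :: real
    show "(?F has_real_derivative r ^ (M - 1) * exp (- \<rho> * r ^ M)) (at r)"
      using M \<rho> by (auto intro!: derivative_eq_intros)
  next
    have "filterlim (\<lambda>r::real. \<rho> * r ^ M) at_top at_top"
      using M \<rho> by (intro filterlim_tendsto_pos_mult_at_top[OF tendsto_const] filterlim_pow_at_top filterlim_ident)
    then have "((\<lambda>r. exp (- \<rho> * r ^ M)) \<longlongrightarrow> 0) at_top"
      by (intro filterlim_compose[OF exp_at_bot]) (simp add: filterlim_uminus_at_bot)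
    then have "((\<lambda>r. - exp (- \<rho> * r ^ M) / (real M * \<rho>)) \<longlongrightarrow> - 0 / (real M * \<rho>)) at_top"
      using M \<rho> by (intro tendsto_intros) auto
    then show "(?F \<longlongrightarrow> 0) at_top" by simp
  qed auto
  then show ?thesis using M by (simp add: power_0_left)
qed

lemma nn_integral_power_tail:
  assumes s: "s > 0" and d: "d > 0"
  shows "(\<integral>\<^sup>+r. ennreal (real d * s ^ d / r ^ Suc d) * indicator {s..} r \<partial>lborel) = 1"
proof -
  let ?F = "\<lambda>r::real. - (s ^ d * inverse r ^ d)"
  have "(\<integral>\<^sup>+r. ennreal (real d * s ^ d / r ^ Suc d) * indicator {s..} r \<partial>lborel) = ennreal (0 - ?F s)"
  proof (rule nn_integral_FTC_atLeast[where F = ?F])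
    fix r :: real assume "s \<le> r"
    with s have r: "r > 0" by simp
    obtain k where k: "d = Suc k" using d gr0_implies_Suc by blast
    show "(?F has_real_derivative real d * s ^ d / r ^ Suc d) (at r)"
    proof -
      have "((\<lambda>r. inverse r ^ Suc k) has_real_derivative - (real (Suc k) / r ^ Suc (Suc k))) (at r)"
        by (rule DERIV_cong[OF DERIV_power[OF DERIV_inverse]]) (use r in \<open>auto simp: field_simps\<close>)
      from DERIV_minus[OF DERIV_cmult[OF this, of "s ^ Suc k"]] show ?thesis
        unfolding k by (simp add: mult.commute)
    qed
    show "0 \<le> real d * s ^ d / r ^ Suc d" using r s by simp
  next
    have "((\<lambda>r::real. inverse r) \<longlongrightarrow> 0) at_top"
      by (rule tendsto_inverse_0_at_top[OF filterlim_ident])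
    then have "(?F \<longlongrightarrow> - (s ^ d * 0 ^ d)) at_top" by (intro tendsto_intros)
    then show "(?F \<longlongrightarrow> 0) at_top" using d by (simp add: power_0_left)
  qed measurable
  then show ?thesis using s by (simp add: power_mult_distrib[symmetric])
qed

section \<open>Spherical integrals as integrals over the whole space\<close>

locale elliptic_polynomial =
  fixes Q :: "'a::euclidean_space \<Rightarrow> real" and m a :: nat and c :: real
  assumes Q_poly: "real_polynomial_function Q" and c_gt_0: "c > 0"
    and Q_ge: "\<And>x. Q x \<ge> c * norm x ^ (2 * m)"
    and Q_scale: "\<And>t x. Q (t *\<^sub>R x) = t ^ (2 * m) * Q x"
    and m_ge: "m \<ge> 1" and m_less: "2 * m < DIM('a)"
begin

text \<open>Equal to Q on the unit sphere, but of degree 2(m+a), the degree that the radial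
  integration needs.\<close>

definition R :: "'a \<Rightarrow> real" where
  "R x = norm x ^ (2 * a) * Q x"

lemma Q_pos: "x \<noteq> 0 \<Longrightarrow> Q x > 0"
  using Q_ge[of x] c_gt_0 by (metis less_le_trans mult_pos_pos zero_less_norm_iff zero_less_power)

lemma R_pos: "x \<noteq> 0 \<Longrightarrow> R x > 0"
  unfolding R_def using Q_pos by simp

lemma R_scale: "R (t *\<^sub>R x) = t ^ (2 * (m + a)) * R x"
  unfolding R_def Q_scale by (simp add: power_mult_distrib power_even_abs power_add distrib_left mult_ac)

lemma R_poly: "real_polynomial_function R"
  unfolding R_def[abs_def] by (intro real_polynomial_function.intros(4) Q_poly real_polynomial_function_norm_power)

lemma R_lower: "R x \<ge> c * norm x ^ 2 - c"
proof -
  have "norm x ^ 2 - 1 \<le> norm x ^ (2 * (m + a))"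
  proof (cases "norm x \<le> 1")
    case True
    then have "norm x ^ 2 \<le> 1" by (simp add: power_le_one)
    moreover have "0 \<le> norm x ^ (2 * (m + a))" by simp
    ultimately show ?thesis by linarith
  next
    case False
    then have "norm x ^ 2 \<le> norm x ^ (2 * (m + a))" using m_ge by (intro power_increasing) auto
    then show ?thesis by simp
  qed
  then have "c * (norm x ^ 2 - 1) \<le> c * norm x ^ (2 * (m + a))" using c_gt_0 by (intro mult_left_mono) auto
  also have "\<dots> = norm x ^ (2 * a) * (c * norm x ^ (2 * m))" by (simp add: power_add algebra_simps)
  also have "\<dots> \<le> R x" unfolding R_def by (intro mult_left_mono Q_ge) auto
  finally show ?thesis by (simp add: right_diff_distrib)
qed

sublocale exp_weight R c
  by unfold_locales (use R_poly c_gt_0 R_lower in auto)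

lemma Q_measurable [measurable]: "Q \<in> borel_measurable borel"
  by (intro borel_measurable_continuous_onI continuous_on_polymonial_function)
    (use Q_poly in \<open>simp add: real_polynomial_function_eq\<close>)

lemma R_measurable [measurable]: "R \<in> borel_measurable borel"
  unfolding R_def[abs_def] by measurable

lemma poly_exp_norm_power: "poly_exp R (\<lambda>x. norm x ^ (2 * b) * exp (- R x))"
  unfolding poly_exp_def
  by (intro exI[of _ "\<lambda>x. norm x ^ (2 * b)"] conjI refl real_polynomial_function_norm_power)

text \<open>Insert the weight \<open>d |x|\<^sup>d / r\<^bsup>d+1\<^esup>\<close> on \<open>r \<ge> |x|\<close>, whose integral over \<open>r\<close> is 1, exchange the
  integrals and substitute \<open>x = r z\<close>.\<close>

lemma nn_integral_polar:
  assumes q: "DIM('a) + q = 2 * (m + a)" and A [measurable]: "A \<in> sets borel"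
  shows "(\<integral>\<^sup>+x. ennreal (norm x ^ q * exp (- R x)) * indicator A (sgn x) \<partial>lborel) =
    (\<integral>\<^sup>+z. ennreal (real DIM('a) / (real (2 * (m + a)) * Q (sgn z)) * indicator punctured_ball z) * indicator A (sgn z) \<partial>lborel)"
proof -
  let ?d = "DIM('a)" and ?M = "2 * (m + a)"
  have M: "?M > 0" using m_ge by simp
  let ?W = "\<lambda>x. ennreal (norm x ^ q * exp (- R x)) * (indicator A (sgn x) :: ennreal)"
  let ?K = "\<lambda>(x::'a) r. ennreal (real ?d * norm x ^ ?d / r ^ Suc ?d) * (indicator {norm x..} r :: ennreal)"
  let ?L = "\<lambda>z r. ennreal (real ?d * norm z ^ ?M) * indicator (cball 0 1) z * indicator A (sgn z) *
    (ennreal (r ^ (?M - 1) * exp (- R z * r ^ ?M)) * (indicator {0..} r :: ennreal))"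
  have KM: "(\<lambda>(x, r). ?K x r) \<in> borel_measurable (borel \<Otimes>\<^sub>M borel)"
  proof -
    have "(\<lambda>(x, r). ?K x r) = (\<lambda>(x::'a, r). ennreal (real ?d * norm x ^ ?d / r ^ Suc ?d) * (if norm x \<le> r then 1 else 0))"
      by (auto simp: indicator_def fun_eq_iff)
    also have "\<dots> \<in> borel_measurable (borel \<Otimes>\<^sub>M borel)" by measurable
    finally show ?thesis .
  qed
  have [measurable]: "(\<lambda>(x, r). ?W x * ?K x r) \<in> borel_measurable (lborel \<Otimes>\<^sub>M lborel)"
    using KM by (simp add: case_prod_beta) 
  have "(\<integral>\<^sup>+x. ?W x \<partial>lborel) = (\<integral>\<^sup>+x. (\<integral>\<^sup>+r. ?W x * ?K x r \<partial>lborel) \<partial>lborel)"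
  proof (rule nn_integral_cong_AE)
    have "AE x in lborel. x \<noteq> (0::'a)" by (rule AE_lborel_singleton)
    then show "AE x in lborel. ?W x = (\<integral>\<^sup>+r. ?W x * ?K x r \<partial>lborel)"
    proof eventually_elim
      case (elim x)
      have "(\<integral>\<^sup>+r. ?W x * ?K x r \<partial>lborel) = ?W x * (\<integral>\<^sup>+r. ?K x r \<partial>lborel)"
        by (rule nn_integral_cmult) measurable
      also have "(\<integral>\<^sup>+r. ?K x r \<partial>lborel) = 1"
        using elim by (intro nn_integral_power_tail) auto
      finally show ?case by simp
    qed
  qed
  also have "\<dots> = (\<integral>\<^sup>+r. (\<integral>\<^sup>+x. ?W x * ?K x r \<partial>lborel) \<partial>lborel)"
    by (rule lborel_pair.Fubini') measurable
  also have "\<dots> = (\<integral>\<^sup>+r. (\<integral>\<^sup>+z. ?L z r \<partial>lborel) \<partial>lborel)"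
  proof (rule nn_integral_cong_AE)
    have "AE r in lborel. r \<noteq> (0::real)" by (rule AE_lborel_singleton)
    then show "AE r in lborel. (\<integral>\<^sup>+x. ?W x * ?K x r \<partial>lborel) = (\<integral>\<^sup>+z. ?L z r \<partial>lborel)"
    proof eventually_elim
      case (elim r)
      show ?case
      proof (cases "r > 0")
        case False
        then have "r < 0" using elim by simp
        then have "indicator {norm x..} r = (0::ennreal)" "indicator {0..} r = (0::ennreal)" for x :: 'a
          using less_le_trans[of r 0 "norm x"] by (auto simp: indicator_def)
        then show ?thesis by simp
      next
        case True
        have "(\<lambda>x::'a. indicator {norm x..} r :: ennreal) = indicator (cball 0 r)"
          by (auto simp: indicator_def)
        then have [measurable]: "(\<lambda>x::'a. indicator {norm x..} r :: ennreal) \<in> borel_measurable borel"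
          by simp
        have m: "(\<lambda>x. ?W x * ?K x r) \<in> borel_measurable borel" by measurable
        have m2: "(\<lambda>z. ?W (r *\<^sub>R z) * ?K (r *\<^sub>R z) r) \<in> borel_measurable lborel"
          by (rule measurable_compose[OF _ m]) measurable
        have "(\<integral>\<^sup>+x. ?W x * ?K x r \<partial>lborel) = ennreal (\<bar>r\<bar> ^ ?d) * (\<integral>\<^sup>+z. ?W (r *\<^sub>R z) * ?K (r *\<^sub>R z) r \<partial>lborel)"
          by (rule nn_integral_lborel_scale[OF m]) (use True in simp)
        also have "\<dots> = (\<integral>\<^sup>+z. ennreal (r ^ ?d) * (?W (r *\<^sub>R z) * ?K (r *\<^sub>R z) r) \<partial>lborel)"
          by (simp only: nn_integral_cmult[OF m2] abs_of_pos[OF True])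
        also have "\<dots> = (\<integral>\<^sup>+z. ?L z r \<partial>lborel)"
        proof (rule nn_integral_cong)
          fix z :: 'a
          have s: "sgn (r *\<^sub>R z) = sgn z" using True by (simp add: sgn_scaleR)
          have i: "(indicator {norm (r *\<^sub>R z)..} r :: ennreal) = indicator (cball 0 1) z"
            using True mult_left_le_one_le[of r "norm z"] by (auto simp: indicator_def mult_le_cancel_left1)
          \<comment> \<open>The powers of r are r^d from the substitution, r^q from the weight, and
            1/r from the inserted factor. By \<open>q\<close> they combine to r^(M-1), the power
            that makes the exponential integrable in closed form.\<close>
          have "r ^ ?d * ((norm (r *\<^sub>R z) ^ q * exp (- R (r *\<^sub>R z))) * (real ?d * norm (r *\<^sub>R z) ^ ?d / r ^ Suc ?d)) =
              real ?d * norm z ^ (?d + q) * (r ^ (?d + q) / r * exp (- R z * r ^ ?M))"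
            using True by (simp add: R_scale power_mult_distrib power_add field_simps)
          also have "\<dots> = real ?d * norm z ^ ?M * (r ^ (?M - 1) * exp (- R z * r ^ ?M))"
          proof -
            have "r ^ ?M / r = r ^ (?M - 1)"
              by (metis M True less_irrefl nonzero_mult_div_cancel_right power_minus_mult)
            then show ?thesis unfolding q by (simp only:)
          qed
          finally have "ennreal (r ^ ?d) * (ennreal (norm (r *\<^sub>R z) ^ q * exp (- R (r *\<^sub>R z))) *
              ennreal (real ?d * norm (r *\<^sub>R z) ^ ?d / r ^ Suc ?d)) =
              ennreal (real ?d * norm z ^ ?M) * ennreal (r ^ (?M - 1) * exp (- R z * r ^ ?M))"
            using True by (simp only: ennreal_mult[symmetric] mult_nonneg_nonneg zero_le_power norm_ge_zero exp_ge_zero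
                divide_nonneg_nonneg of_nat_0_le_iff less_imp_le)
          then show "ennreal (r ^ ?d) * (?W (r *\<^sub>R z) * ?K (r *\<^sub>R z) r) = ?L z r"
            unfolding s i using True by (simp add: indicator_def)
        qed
        finally show ?thesis .
      qed
    qed
  qed
  also have "\<dots> = (\<integral>\<^sup>+z. (\<integral>\<^sup>+r. ?L z r \<partial>lborel) \<partial>lborel)"
    by (rule lborel_pair.Fubini'[symmetric]) measurable
  also have "\<dots> = (\<integral>\<^sup>+z. ennreal (real ?d / (real ?M * Q (sgn z)) * indicator punctured_ball z) * indicator A (sgn z) \<partial>lborel)"
  proof (rule nn_integral_cong_AE)
    have "AE z in lborel. z \<noteq> (0::'a)" by (rule AE_lborel_singleton)
    then show "AE z in lborel. (\<integral>\<^sup>+r. ?L z r \<partial>lborel) =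
        ennreal (real ?d / (real ?M * Q (sgn z)) * indicator punctured_ball z) * indicator A (sgn z)"
    proof eventually_elim
      case (elim z)
      have Rz: "R z > 0" using R_pos[OF elim] .
      \<comment> \<open>The factor |z|^M of R cancels the one collected in front of the radial
        integral, so 1 / Q(sgn z) remains.\<close>
      have RQ: "R z = norm z ^ ?M * Q (sgn z)"
      proof -
        have "R z = R (norm z *\<^sub>R sgn z)" using elim by (simp add: sgn_div_norm)
        also have "\<dots> = norm z ^ ?M * R (sgn z)" by (rule R_scale)
        also have "R (sgn z) = Q (sgn z)" using elim by (simp add: R_def norm_sgn)
        finally show ?thesis .
      qed
      have "(\<integral>\<^sup>+r. ?L z r \<partial>lborel) = ennreal (real ?d * norm z ^ ?M) * indicator (cball 0 1) z * indicator A (sgn z) *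
          (\<integral>\<^sup>+r. ennreal (r ^ (?M - 1) * exp (- R z * r ^ ?M)) * indicator {0..} r \<partial>lborel)"
        by (rule nn_integral_cmult) measurable
      also have "(\<integral>\<^sup>+r. ennreal (r ^ (?M - 1) * exp (- R z * r ^ ?M)) * indicator {0..} r \<partial>lborel) =
          ennreal (1 / (real ?M * R z))"
        by (rule nn_integral_power_exp_power[OF M Rz])
      also have "ennreal (real ?d * norm z ^ ?M) * indicator (cball 0 1) z * indicator A (sgn z) * ennreal (1 / (real ?M * R z)) =
          (ennreal (real ?d * norm z ^ ?M) * ennreal (1 / (real ?M * R z))) * indicator (cball 0 1) z * indicator A (sgn z)"
        by (simp only: mult_ac)
      also have "ennreal (real ?d * norm z ^ ?M) * ennreal (1 / (real ?M * R z)) = ennreal (real ?d / (real ?M * Q (sgn z)))"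
        using Rz elim by (subst ennreal_mult[symmetric]) (auto simp: RQ)
      finally show ?case using elim by (simp add: punctured_ball_def indicator_def)
    qed
  qed
  finally show ?thesis .
qed

text \<open>The set version says that two densities have the same image under \<open>sgn\<close>. As
  an equality of measures it covers signed and unbounded integrands, such as the logarithm, without
  an integrability condition.\<close>

lemma integral_polar:
  assumes q: "DIM('a) + q = 2 * (m + a)" and [measurable]: "\<phi> \<in> borel_measurable borel"
  shows "(\<integral>x. \<phi> (sgn x) * (norm x ^ q * exp (- R x)) \<partial>lborel) =
    real DIM('a) / real (2 * (m + a)) * (\<integral>z. indicator punctured_ball z * (\<phi> (sgn z) / Q (sgn z)) \<partial>lborel)"
proof -
  let ?d = "DIM('a)" and ?M = "2 * (m + a)"
  let ?W = "\<lambda>x. norm x ^ q * exp (- R x)"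
  let ?V = "\<lambda>z. real ?d / (real ?M * Q (sgn z)) * indicator punctured_ball z"
  have V0: "?V z \<ge> 0" for z
    using Q_pos[of "sgn z"] by (auto simp: indicator_def punctured_ball_def sgn_zero_iff less_imp_le)
  have eq: "distr (density lborel ?W) borel sgn = distr (density lborel ?V) borel sgn"
  proof (rule measure_eqI)
    fix A assume "A \<in> sets (distr (density lborel ?W) borel sgn)"
    then have A [measurable]: "A \<in> sets borel" by simp
    have [measurable]: "sgn -` A \<in> sets borel" using measurable_sets[OF sgn_measurable A] by simp
    have i: "indicator (sgn -` A) x = (indicator A (sgn x) :: ennreal)" for x :: 'a by (simp add: indicator_def)
    show "emeasure (distr (density lborel ?W) borel sgn) A = emeasure (distr (density lborel ?V) borel sgn) A"
      using nn_integral_polar[OF q A]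
      by (simp add: emeasure_distr emeasure_density i)
  qed simp
  have "(\<integral>x. \<phi> (sgn x) * ?W x \<partial>lborel) = (\<integral>x. \<phi> (sgn x) \<partial>density lborel ?W)"
    by (subst integral_density) (auto simp: mult.commute)
  also have "\<dots> = (\<integral>\<xi>. \<phi> \<xi> \<partial>distr (density lborel ?W) borel sgn)"
    by (subst integral_distr) auto
  also have "\<dots> = (\<integral>x. \<phi> (sgn x) \<partial>density lborel ?V)"
    unfolding eq by (subst integral_distr) auto
  also have "\<dots> = (\<integral>z. ?V z * \<phi> (sgn z) \<partial>lborel)"
    using V0 by (subst integral_density) auto
  also have "\<dots> = (\<integral>z. real ?d / real ?M * (indicator punctured_ball z * (\<phi> (sgn z) / Q (sgn z))) \<partial>lborel)"
    by (intro Bochner_Integration.integral_cong) auto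
  finally show ?thesis by (simp only: integral_mult_right_zero)
qed

text \<open>Both parities are handled at once: \<open>e\<close> is the exponent of the singular
  density 1/r^e for \<psi>, and the relation for \<open>k\<close> says 2k - e = d-1-2m, the final
  power of r.\<close>

lemma neg_laplacian_sphere_integral:
  assumes pos: "emeasure (hausdorff_measure (DIM('a) - 1)) (sphere (0::'a) 1) > 0"
    and e: "e = 1 \<or> e = 2" and k: "2 * k + 2 * m + 1 = DIM('a) + e" and ka: "k \<le> a"
    and \<psi>: "\<psi> = (if e = 2 then abs else (\<lambda>s. ln \<bar>s\<bar>))"
  shows "\<exists>A>0. \<forall>y. y \<noteq> 0 \<longrightarrow> ((\<lambda>f y. - laplacian f y) ^^ k)
      (\<lambda>y. LINT \<xi>:sphere 0 1|hausdorff_measure (DIM('a) - 1). \<psi> (y \<bullet> \<xi>) / Q \<xi>) y =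
    - A * radial (DIM('a) - 1 - 2 * m) 0 (\<lambda>x. norm x ^ (2 * a) * exp (- R x)) y"
proof -
  let ?d = "DIM('a)"
  define b where "b = a - k"
  define P where "P x = norm x ^ (2 * b) * exp (- R x)" for x
  have P: "poly_exp R P" unfolding P_def[abs_def] by (rule poly_exp_norm_power)
  \<comment> \<open>For e = 2 the extra factor |x| turns |y \<bullet> sgn x| into |y \<bullet> x|;
    for e = 1 none is added, because the logarithm splits additively.\<close>
  define q where "q = e - 1 + 2 * b"
  have q: "?d + q = 2 * (m + a)" using e k ka by (auto simp: q_def b_def)
  obtain C where C: "C > 0" "\<And>f :: 'a \<Rightarrow> real. f \<in> borel_measurable borel \<Longrightarrow>
    (LINT \<xi>:sphere 0 1|hausdorff_measure (?d - 1). f \<xi>) = C * (\<integral>z. indicator punctured_ball z * f (sgn z) \<partial>lborel)"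
    using integral_sphere_hausdorff[OF pos] by blast
  define C1 where "C1 = C * (real (2 * (m + a)) / real ?d)"
  have C1: "C1 > 0" using C(1) m_ge by (simp add: C1_def)
  define F where "F y = (LINT \<xi>:sphere 0 1|hausdorff_measure (?d - 1). \<psi> (y \<bullet> \<xi>) / Q \<xi>)" for y
  have [measurable]: "\<psi> \<in> borel_measurable borel" unfolding \<psi> by auto
  have F: "F y = C1 * (\<integral>x. \<psi> (y \<bullet> sgn x) * (norm x ^ q * exp (- R x)) \<partial>lborel)" for y
    unfolding F_def
    using C(2)[of "\<lambda>\<xi>. \<psi> (y \<bullet> \<xi>) / Q \<xi>"] integral_polar[OF q, of "\<lambda>\<xi>. \<psi> (y \<bullet> \<xi>)"] m_ge
    by (simp add: C1_def)
  have abs_sgn: "\<bar>y \<bullet> sgn x\<bar> = \<bar>y \<bullet> x\<bar> / norm x" for y x :: 'a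
    by (simp add: sgn_div_norm abs_mult divide_inverse mult.commute)
  obtain y1 :: 'a where "y1 \<in> Basis" using nonempty_Basis by blast
  then have y1: "y1 \<noteq> 0" by (simp add: nonzero_Basis)
  have "\<exists>A>0. \<forall>y. y \<noteq> 0 \<longrightarrow> F y - F y1 = A * (\<integral>r. (ft 0 P (r *\<^sub>R y1) - ft 0 P (r *\<^sub>R y)) / r ^ e \<partial>lpos)"
  proof (cases "e = 2")
    case True
    obtain A where A: "A > 0" "\<And>f y y1. poly_exp R f \<Longrightarrow> y \<noteq> 0 \<Longrightarrow> y1 \<noteq> 0 \<Longrightarrow>
      (\<integral>x. \<bar>y \<bullet> x\<bar> * f x \<partial>lborel) - (\<integral>x. \<bar>y1 \<bullet> x\<bar> * f x \<partial>lborel) =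
      A * (\<integral>r. (ft 0 f (r *\<^sub>R y1) - ft 0 f (r *\<^sub>R y)) / r\<^sup>2 \<partial>lpos)"
      using abs_plane_wave by blast
    have "\<psi> (y \<bullet> sgn x) * (norm x ^ q * exp (- R x)) = \<bar>y \<bullet> x\<bar> * P x" for y x
      using True by (cases "x = 0") (simp_all add: \<psi> abs_sgn q_def P_def)
    then have "F y - F y1 = C1 * A * (\<integral>r. (ft 0 P (r *\<^sub>R y1) - ft 0 P (r *\<^sub>R y)) / r ^ e \<partial>lpos)" if "y \<noteq> 0" for y
      unfolding F using A(2)[OF P that y1] True by (simp add: right_diff_distrib[symmetric])
    then show ?thesis using C1 A(1) by (intro exI[of _ "C1 * A"]) auto
  next
    case False
    with e have e1: "e = 1" by simp
    \<comment> \<open>The part ln |x| of the logarithm does not depend on y and cancels against the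
      same term at \<open>y1\<close>.\<close>
    have W: "\<psi> (y \<bullet> sgn x) * (norm x ^ q * exp (- R x)) = ln (\<bar>y \<bullet> x\<bar> / norm x) * P x" for y x
      using e1 by (simp add: \<psi> abs_sgn q_def P_def)
    have "F y - F y1 = C1 * (\<integral>r. (ft 0 P (r *\<^sub>R y1) - ft 0 P (r *\<^sub>R y)) / r ^ e \<partial>lpos)" if y: "y \<noteq> 0" for y
    proof -
      have "F y - F y1 = C1 * ((\<integral>x. ln (\<bar>y \<bullet> x\<bar> / norm x) * P x \<partial>lborel) - (\<integral>x. ln (\<bar>y1 \<bullet> x\<bar> / norm x) * P x \<partial>lborel))"
        unfolding F W by (simp add: right_diff_distrib)
      also have "(\<integral>x. ln (\<bar>y \<bullet> x\<bar> / norm x) * P x \<partial>lborel) - (\<integral>x. ln (\<bar>y1 \<bullet> x\<bar> / norm x) * P x \<partial>lborel) =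
          (\<integral>x. ln (\<bar>y \<bullet> x\<bar> / norm x) * P x - ln (\<bar>y1 \<bullet> x\<bar> / norm x) * P x \<partial>lborel)"
        using integrable_ln_inner_norm[OF P y] integrable_ln_inner_norm[OF P y1] by simp
      also have "\<dots> = (\<integral>x. ln \<bar>y \<bullet> x\<bar> * P x - ln \<bar>y1 \<bullet> x\<bar> * P x \<partial>lborel)"
      proof (rule integral_cong_AE)
        show "AE x in lborel. ln (\<bar>y \<bullet> x\<bar> / norm x) * P x - ln (\<bar>y1 \<bullet> x\<bar> / norm x) * P x =
            ln \<bar>y \<bullet> x\<bar> * P x - ln \<bar>y1 \<bullet> x\<bar> * P x"
          using AE_inner_nonzero[OF y] AE_inner_nonzero[OF y1]
        proof eventually_elim
          case (elim x)
          then have "x \<noteq> 0" by auto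
          with elim show ?case by (simp add: ln_div algebra_simps)
        qed
      qed (use poly_exp_measurable[OF P] in measurable)
      also have "\<dots> = (\<integral>r. (ft 0 P (r *\<^sub>R y1) - ft 0 P (r *\<^sub>R y)) / r \<partial>lpos)"
        using integrable_ln_inner[OF P y] integrable_ln_inner[OF P y1] ln_plane_wave[OF P y y1] by simp
      finally show ?thesis by (simp add: e1)
    qed
    then show ?thesis using C1 by (intro exI[of _ C1]) auto
  qed
  then obtain A where A: "A > 0" "\<And>y. y \<noteq> 0 \<Longrightarrow> F y = F y1 + A * (\<integral>r. (ft 0 P (r *\<^sub>R y1) - ft 0 P (r *\<^sub>R y)) / r ^ e \<partial>lpos)"
    by (metis add.commute diff_add_cancel)
  \<comment> \<open>2m < d forces at least one Laplacian, as the removal of the reference point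
    requires.\<close>
  obtain j where j: "k = Suc j" using k e m_less by (cases k) auto
  have "((\<lambda>f y. - laplacian f y) ^^ k) F y = - A * radial (?d - 1 - 2 * m) 0 (\<lambda>x. norm x ^ (2 * a) * exp (- R x)) y"
    if y: "y \<noteq> 0" for y
  proof -
    have "((\<lambda>f y. - laplacian f y) ^^ k) F y = - A * radial (2 * k - e) 0 (\<lambda>x. norm x ^ (2 * k) * P x) y"
      unfolding j by (rule neg_laplacian_iterate[OF P e y1 A(2) y])
    also have "2 * k - e = ?d - 1 - 2 * m" using k by simp
    also have "(\<lambda>x. norm x ^ (2 * k) * P x) = (\<lambda>x. norm x ^ (2 * a) * exp (- R x))"
    proof -
      have "2 * a = 2 * k + 2 * b" using ka by (simp add: b_def)
      then show ?thesis by (simp only: P_def power_add mult.assoc)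
    qed
    finally show ?thesis .
  qed
  then show ?thesis using A(1) unfolding F_def[abs_def] by blast
qed

text \<open>Odd dimension is the case e = 2, even dimension e = 1. The minus sign in front of John's
  formula meets the one produced by the Laplacians, so the factor is positive. The condition on
  \<open>a\<close> gives k \<le> a in both parities.\<close>

lemma john_fundamental_solution_radial:
  assumes pos: "emeasure (hausdorff_measure (DIM('a) - 1)) (sphere (0::'a) 1) > 0"
    and a: "DIM('a) + 1 \<le> 2 * m + 2 * a"
  obtains A where "A > 0" "\<And>y. y \<noteq> 0 \<Longrightarrow> john_fundamental_solution m Q y =
    A * radial (DIM('a) - 1 - 2 * m) 0 (\<lambda>x. norm x ^ (2 * a) * exp (- R x)) y"
proof (cases "odd DIM('a)")
  case True
  let ?d = "DIM('a)" and ?k = "(DIM('a) + 1 - 2 * m) div 2"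
  have k: "2 * ?k + 2 * m + 1 = ?d + 2" "?k \<le> a" using True m_less a by (auto elim!: oddE)
  obtain A where A: "A > 0" "\<And>y. y \<noteq> 0 \<Longrightarrow> ((\<lambda>f y. - laplacian f y) ^^ ?k)
      (\<lambda>y. LINT \<xi>:sphere 0 1|hausdorff_measure (?d - 1). \<bar>y \<bullet> \<xi>\<bar> / Q \<xi>) y =
    - A * radial (?d - 1 - 2 * m) 0 (\<lambda>x. norm x ^ (2 * a) * exp (- R x)) y"
    using neg_laplacian_sphere_integral[OF pos _ k refl] by auto
  show ?thesis
    by (rule that[of "A / (4 * (2 * pi) ^ (?d - 1))"])
      (use A True in \<open>auto simp: john_fundamental_solution_def Let_def\<close>)
next
  case False
  let ?d = "DIM('a)" and ?k = "(DIM('a) - 2 * m) div 2"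
  have k: "2 * ?k + 2 * m + 1 = ?d + 1" "?k \<le> a" using False m_less a by (auto elim!: evenE)
  obtain A where A: "A > 0" "\<And>y. y \<noteq> 0 \<Longrightarrow> ((\<lambda>f y. - laplacian f y) ^^ ?k)
      (\<lambda>y. LINT \<xi>:sphere 0 1|hausdorff_measure (?d - 1). ln \<bar>y \<bullet> \<xi>\<bar> / Q \<xi>) y =
    - A * radial (?d - 1 - 2 * m) 0 (\<lambda>x. norm x ^ (2 * a) * exp (- R x)) y"
    using neg_laplacian_sphere_integral[OF pos _ k refl] by auto
  show ?thesis
    by (rule that[of "A / (2 * pi) ^ ?d"])
      (use A False in \<open>auto simp: john_fundamental_solution_def Let_def\<close>)
qed

end

section \<open>Descent to the hyperplane\<close>

lemma prod_list_scaleR_inner: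
  "(\<Prod>b\<leftarrow>is. (t *\<^sub>R \<xi>) \<bullet> b) = t ^ length is * (\<Prod>b\<leftarrow>is. \<xi> \<bullet> b)"
  by (induction "is") (simp_all add: mult_ac)

lemma real_polynomial_function_prod_list: "real_polynomial_function (\<lambda>\<xi>. \<Prod>b\<leftarrow>is. \<xi> \<bullet> b)"
  by (induction "is")
    (auto intro: real_polynomial_function.intros(2,4) real_polynomial_function_inner)

lemma finite_multi_indices: "finite (multi_indices k :: 'a::euclidean_space list set)"
proof -
  have "multi_indices k = {is :: 'a list. set is \<subseteq> Basis \<and> length is = k}" by (auto simp: multi_indices_def)
  then show ?thesis by (simp add: finite_lists_length_eq)
qed

lemma elliptic_operator_polynomial:
  fixes Q :: "'a::euclidean_space \<Rightarrow> real"
  assumes "elliptic_operator m Q L"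
  shows "real_polynomial_function Q" "\<And>t \<xi>. Q (t *\<^sub>R \<xi>) = t ^ (2 * m) * Q \<xi>"
    "\<exists>c>0. \<forall>\<xi>. Q \<xi> \<ge> c * norm \<xi> ^ (2 * m)"
proof -
  obtain A where Q: "Q = (\<lambda>\<xi>. \<Sum>is\<in>multi_indices (2 * m). A is * (\<Prod>b\<leftarrow>is. \<xi> \<bullet> b))"
    using assms unfolding elliptic_operator_def by blast
  show "real_polynomial_function Q"
    unfolding Q by (intro real_polynomial_function_sum finite_multi_indices real_polynomial_function.intros(2,4)
        real_polynomial_function_prod_list)
  show "Q (t *\<^sub>R \<xi>) = t ^ (2 * m) * Q \<xi>" for t \<xi>
    unfolding Q sum_distrib_left prod_list_scaleR_inner
    by (intro sum.cong) (auto simp: multi_indices_def)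
  show "\<exists>c>0. \<forall>\<xi>. Q \<xi> \<ge> c * norm \<xi> ^ (2 * m)"
    using assms unfolding elliptic_operator_def by blast
qed

lemma norm_Pair_power_le:
  fixes u :: "'a::euclidean_space" and w :: real
  shows "norm (u, w) ^ (2 * m) \<le> 2 ^ m * (norm u ^ (2 * m) + w ^ (2 * m))"
proof -
  define M where "M = max (norm u ^ 2) (w ^ 2)"
  have M: "M \<ge> 0" "norm u ^ 2 \<le> M" "w ^ 2 \<le> M" by (auto simp: M_def le_max_iff_disj)
  have "norm (u, w) ^ (2 * m) = (norm u ^ 2 + w ^ 2) ^ m"
    by (simp add: power_mult norm_Pair)
  also have "\<dots> \<le> (2 * M) ^ m" using M by (intro power_mono) auto
  also have "\<dots> = 2 ^ m * M ^ m" by (rule power_mult_distrib)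
  also have "M ^ m \<le> norm u ^ (2 * m) + w ^ (2 * m)"
    by (auto simp: M_def max_def power_mult)
  finally show ?thesis by simp
qed

lemma elliptic_operator_extend:
  fixes Q' :: "'a::euclidean_space \<Rightarrow> real"
  assumes "elliptic_operator m Q' L'"
  shows "\<exists>L. elliptic_operator m (\<lambda>p::'a \<times> real. Q' (fst p) + snd p ^ (2 * m)) L"
proof -
  obtain A' c where Q': "Q' = (\<lambda>\<xi>. \<Sum>is\<in>multi_indices (2 * m). A' is * (\<Prod>b\<leftarrow>is. \<xi> \<bullet> b))"
    and c: "c > 0" "\<And>\<xi>. Q' \<xi> \<ge> c * norm \<xi> ^ (2 * m)"
    using assms unfolding elliptic_operator_def by blast
  let ?I = "multi_indices (2 * m) :: ('a \<times> real) list set" and ?I' = "multi_indices (2 * m) :: 'a list set"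
  let ?E = "\<lambda>b::'a. (b, 0::real)" and ?r = "replicate (2 * m) (0::'a, 1::real)"
  \<comment> \<open>Indices whose entries are all horizontal inherit the old coefficient, and the
    index that repeats the last basis vector receives 1. The two contributions are added, so
    overlaps need no separate case.\<close>
  define A where "A is = (if set is \<subseteq> ?E ` Basis then A' (map fst is) else 0) + (if is = ?r then 1 else 0)" for "is"
  have Q: "Q' (fst p) + snd p ^ (2 * m) = (\<Sum>is\<in>?I. A is * (\<Prod>b\<leftarrow>is. p \<bullet> b))" for p
  proof -
    have "(\<Sum>is\<in>?I. (if set is \<subseteq> ?E ` Basis then A' (map fst is) else 0) * (\<Prod>b\<leftarrow>is. p \<bullet> b)) =
        (\<Sum>is\<in>map ?E ` ?I'. A' (map fst is) * (\<Prod>b\<leftarrow>is. p \<bullet> b))"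
    proof (rule sum.mono_neutral_cong_right)
      show "map ?E ` ?I' \<subseteq> ?I" by (fastforce simp: multi_indices_def Basis_prod_def)
      show "\<forall>is\<in>?I - map ?E ` ?I'. (if set is \<subseteq> ?E ` Basis then A' (map fst is) else 0) * (\<Prod>b\<leftarrow>is. p \<bullet> b) = 0"
      proof
        fix "is" :: "('a \<times> real) list" assume i: "is \<in> ?I - map ?E ` ?I'"
        have "\<not> set is \<subseteq> ?E ` Basis"
        proof
          assume s: "set is \<subseteq> ?E ` Basis"
          then have "is = map ?E (map fst is)" by (auto simp: map_idI[symmetric] intro!: map_idI[symmetric])
          moreover have "map fst is \<in> ?I'" using s i by (auto simp: multi_indices_def)
          ultimately show False using i by blast
        qed
        then show "(if set is \<subseteq> ?E ` Basis then A' (map fst is) else 0) * (\<Prod>b\<leftarrow>is. p \<bullet> b) = 0" by simp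
      qed
      fix "is" assume "is \<in> map ?E ` ?I'"
      then have "set is \<subseteq> ?E ` Basis" by (fastforce simp: multi_indices_def)
      then show "(if set is \<subseteq> ?E ` Basis then A' (map fst is) else 0) * (\<Prod>b\<leftarrow>is. p \<bullet> b) =
          A' (map fst is) * (\<Prod>b\<leftarrow>is. p \<bullet> b)" by simp
    qed (rule finite_multi_indices)
    also have "\<dots> = (\<Sum>is\<in>?I'. A' is * (\<Prod>b\<leftarrow>is. fst p \<bullet> b))"
    proof (subst sum.reindex)
      show "inj_on (map ?E) ?I'" by (intro inj_onI) (auto dest!: map_injective simp: inj_def)
      show "sum ((\<lambda>is. A' (map fst is) * (\<Prod>b\<leftarrow>is. p \<bullet> b)) \<circ> map ?E) ?I' = (\<Sum>is\<in>?I'. A' is * (\<Prod>b\<leftarrow>is. fst p \<bullet> b))"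
        by (cases p) (simp add: o_def)
    qed
    also have "\<dots> = Q' (fst p)" by (simp add: Q')
    finally have 1: "(\<Sum>is\<in>?I. (if set is \<subseteq> ?E ` Basis then A' (map fst is) else 0) * (\<Prod>b\<leftarrow>is. p \<bullet> b)) = Q' (fst p)" .
    have "?r \<in> ?I" by (auto simp: multi_indices_def Basis_prod_def)
    have "(\<Sum>is\<in>?I. (if is = ?r then 1 else 0) * (\<Prod>b\<leftarrow>is. p \<bullet> b)) = (\<Sum>is\<in>?I. if is = ?r then (\<Prod>b\<leftarrow>?r. p \<bullet> b) else 0)"
      by (intro sum.cong) auto
    also have "\<dots> = (\<Prod>b\<leftarrow>?r. p \<bullet> b)"
      using \<open>?r \<in> ?I\<close> by (simp add: sum.delta[OF finite_multi_indices])
    also have "\<dots> = snd p ^ (2 * m)"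
      by (cases p) (simp add: prod_list_replicate)
    finally show ?thesis
      unfolding A_def distrib_right sum.distrib 1 by simp
  qed
  have ell: "(min c 1 / 2 ^ m) * norm p ^ (2 * m) \<le> Q' (fst p) + snd p ^ (2 * m)" for p
  proof -
    obtain u w where p: "p = (u, w)" by (cases p)
    have w: "0 \<le> w ^ (2 * m)" by (simp add: power_mult)
    have "(min c 1 / 2 ^ m) * norm p ^ (2 * m) \<le> (min c 1 / 2 ^ m) * (2 ^ m * (norm u ^ (2 * m) + w ^ (2 * m)))"
      unfolding p using c(1) by (intro mult_left_mono norm_Pair_power_le) auto
    also have "\<dots> = min c 1 * norm u ^ (2 * m) + min c 1 * w ^ (2 * m)" by (simp add: distrib_left)
    also have "\<dots> \<le> c * norm u ^ (2 * m) + 1 * w ^ (2 * m)"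
      using w by (intro add_mono mult_right_mono) auto
    also have "\<dots> \<le> Q' u + w ^ (2 * m)" using c(2)[of u] by simp
    finally show ?thesis by (simp add: p)
  qed
  show ?thesis
    unfolding elliptic_operator_def
  proof (intro exI conjI)
    show "(\<lambda>p. Q' (fst p) + snd p ^ (2 * m)) = (\<lambda>\<xi>. \<Sum>is\<in>?I. A is * (\<Prod>b\<leftarrow>is. \<xi> \<bullet> b))"
      using Q by (rule ext)
    show "0 < min c 1 / 2 ^ m" using c(1) by simp
    show "\<forall>p. min c 1 / 2 ^ m * norm p ^ (2 * m) \<le> Q' (fst p) + snd p ^ (2 * m)" using ell by blast
  qed (rule refl)
qed

section \<open>Partial transforms on the slices of the last coordinate\<close>

lemma exp_norm_Pair_le:
  fixes u :: "'a::euclidean_space" and w :: real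
  shows "exp (- norm (u, w)) \<le> exp (- (1 / 2) * \<bar>w\<bar>) * exp (- (1 / 2) * norm u)"
proof -
  have "norm u \<le> norm (u, w)" "\<bar>w\<bar> \<le> norm (u, w)"
    using norm_fst_le[of u w] norm_snd_le[of w u] by auto
  then show ?thesis by (simp add: exp_add[symmetric])
qed

lemma (in exp_weight) poly_exp_continuous: "poly_exp R f \<Longrightarrow> isCont f x"
proof -
  assume "poly_exp R f"
  then obtain p where p: "real_polynomial_function p" "f = (\<lambda>x. p x * exp (- R x))"
    by (auto simp: poly_exp_def)
  show ?thesis unfolding p(2)
    by (intro continuous_intros continuous_real_polymonial_function p R_poly)
qed

locale exp_weight_prod = exp_weight R c for R :: "'a::euclidean_space \<times> real \<Rightarrow> real" and c
begin

text \<open>The derivatives are taken in the horizontal direction (x, 0), so they commute with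
  freezing the last coordinate w. Half of the exponential decay is spent on the integral over u, the
  other half is kept in w.\<close>

lemma slice_decay:
  assumes f: "poly_exp R f"
  obtains C where "\<And>r w. \<bar>(r *\<^sub>R x) \<bullet> x\<bar> ^ N * \<bar>ft 0 (\<lambda>u. f (u, w)) (r *\<^sub>R x)\<bar> \<le> C * exp (- (1 / 2) * \<bar>w\<bar>)"
proof -
  obtain F where F: "F 0 = f" "\<And>i. poly_exp R (F i)"
    "\<And>i p t. ((\<lambda>s. F i (p + s *\<^sub>R (x, 0))) has_real_derivative F (Suc i) (p + t *\<^sub>R (x, 0))) (at t)"
    using poly_exp_tower[OF f] by blast
  have "\<exists>B. \<forall>p. \<bar>F i p\<bar> \<le> B * exp (- norm p)" for i
    using poly_exp_bound[OF F(2)] by metis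
  then obtain B where B: "\<And>i p. \<bar>F i p\<bar> \<le> B i * exp (- norm p)" by metis
  have B0: "B i \<ge> 0" for i using B[of i 0] by simp
  have "\<bar>(r *\<^sub>R x) \<bullet> x\<bar> ^ N * \<bar>ft 0 (\<lambda>u. F 0 (u, w)) (r *\<^sub>R x)\<bar> \<le>
      (B (0 + N) * exp (- (1 / 2) * \<bar>w\<bar>)) * (\<integral>u. exp (- (1 / 2) * norm u) \<partial>(lborel :: 'a measure))" for r w
  proof (rule ft_decay[where F = "\<lambda>i u. F i (u, w)" and B = "\<lambda>i. B i * exp (- (1 / 2) * \<bar>w\<bar>)"])
    show "(\<lambda>u. F i (u, w)) \<in> borel_measurable borel" for i
      by (rule measurable_compose[OF _ poly_exp_measurable[OF F(2)]]) measurable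
    show "\<bar>F i (u, w)\<bar> \<le> B i * exp (- (1 / 2) * \<bar>w\<bar>) * exp (- (1 / 2) * norm u)" for i u
      using order.trans[OF B mult_left_mono[OF exp_norm_Pair_le B0]] by (simp add: mult.assoc)
    show "((\<lambda>s. F i (u + s *\<^sub>R x, w)) has_real_derivative F (Suc i) (u + t *\<^sub>R x, w)) (at t)" for i u t
      using F(3)[of i "(u, w)" t] by simp
  qed simp
  then show ?thesis
    by (intro that[of "B (0 + N) * (\<integral>u. exp (- (1 / 2) * norm u) \<partial>(lborel :: 'a measure))"])
      (simp add: F(1) mult_ac)
qed

text \<open>Boundedness for r \<le> 1 and decay for r \<ge> 1 combine into one majorant. It is
  uniform in the power \<open>q\<close>, since the descent uses several powers with the same
  constant.\<close>

lemma slice_bound: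
  assumes f: "poly_exp R f" and x: "x \<noteq> 0"
  obtains C where "C \<ge> 0" "\<And>r w q. 0 < r \<Longrightarrow> q \<le> N \<Longrightarrow>
    \<bar>r ^ q * ft 0 (\<lambda>u. f (u, w)) (r *\<^sub>R x)\<bar> \<le> C / (1 + r\<^sup>2) * exp (- (1 / 2) * \<bar>w\<bar>)"
proof -
  obtain C0 where C0: "\<And>r w. \<bar>(r *\<^sub>R x) \<bullet> x\<bar> ^ 0 * \<bar>ft 0 (\<lambda>u. f (u, w)) (r *\<^sub>R x)\<bar> \<le> C0 * exp (- (1 / 2) * \<bar>w\<bar>)"
    using slice_decay[OF f, of x 0] by blast
  obtain C1 where C1: "\<And>r w. \<bar>(r *\<^sub>R x) \<bullet> x\<bar> ^ (N + 2) * \<bar>ft 0 (\<lambda>u. f (u, w)) (r *\<^sub>R x)\<bar> \<le> C1 * exp (- (1 / 2) * \<bar>w\<bar>)"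
    using slice_decay[OF f, of x "N + 2"] by blast
  let ?k = "(x \<bullet> x) ^ (N + 2)"
  have k: "?k > 0" using x by simp
  let ?C = "2 * max \<bar>C0\<bar> \<bar>C1 / ?k\<bar>"
  have "\<bar>r ^ q * ft 0 (\<lambda>u. f (u, w)) (r *\<^sub>R x)\<bar> \<le> ?C / (1 + r\<^sup>2) * exp (- (1 / 2) * \<bar>w\<bar>)"
    if r: "0 < r" and q: "q \<le> N" for r w q
  proof -
    let ?F = "ft 0 (\<lambda>u. f (u, w)) (r *\<^sub>R x)" and ?e = "exp (- (1 / 2) * \<bar>w\<bar>)"
    have "\<bar>r ^ q * ?F / ?e\<bar> \<le> ?C / (1 + r\<^sup>2)"
    proof (rule lpos_bound[OF r])
      assume r1: "r \<le> 1"
      have "\<bar>r ^ q\<bar> * \<bar>?F\<bar> \<le> 1 * (C0 * ?e)"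
        using C0[of r w] r r1 by (intro mult_mono) (auto simp: power_le_one)
      then show "\<bar>r ^ q * ?F / ?e\<bar> \<le> C0" by (simp add: abs_mult pos_divide_le_eq)
    next
      assume r1: "1 \<le> r"
      have "?k * (r\<^sup>2 * (r ^ q * \<bar>?F\<bar>)) = r ^ (q + 2) * ?k * \<bar>?F\<bar>" by (simp add: power_add power2_eq_square)
      also have "\<dots> \<le> r ^ (N + 2) * ?k * \<bar>?F\<bar>"
        using r1 q k by (intro mult_right_mono power_increasing) auto
      also have "\<dots> = \<bar>(r *\<^sub>R x) \<bullet> x\<bar> ^ (N + 2) * \<bar>?F\<bar>"
        using r by (simp add: power_mult_distrib abs_mult power_add)
      also have "\<dots> \<le> C1 * ?e" by (rule C1)
      finally have "?k * (r\<^sup>2 * \<bar>r ^ q * ?F / ?e\<bar>) \<le> C1"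
        using r by (simp add: abs_mult pos_divide_le_eq)
      then show "r\<^sup>2 * \<bar>r ^ q * ?F / ?e\<bar> \<le> C1 / ?k"
        using k by (simp only: pos_le_divide_eq mult.commute)
    qed
    then show ?thesis by (simp add: abs_mult pos_divide_le_eq)
  qed
  moreover have "?C \<ge> 0" by (intro mult_nonneg_nonneg) (auto simp: le_max_iff_disj)
  ultimately show ?thesis by (intro that)
qed

text \<open>Adding the values at t and - t cancels the product of sines in cos (A + B) + cos (A -
  B); what remains is a pure cosine transform in w of the slice transforms.\<close>

lemma ft_slice:
  assumes f: "poly_exp R f"
  shows "ft 0 f (r *\<^sub>R (x, t)) + ft 0 f (r *\<^sub>R (x, - t)) =
    2 * (\<integral>w. cos (t * (r * w)) * ft 0 (\<lambda>u. f (u, w)) (r *\<^sub>R x) \<partial>lborel)"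
proof -
  have [measurable]: "f \<in> borel_measurable (borel \<Otimes>\<^sub>M borel)"
    using poly_exp_measurable[OF f] by (simp add: borel_prod)
  have i: "integrable lborel (\<lambda>p. cos (y \<bullet> p) * f p)" for y
    by (rule Bochner_Integration.integrable_bound[OF poly_exp_integrable[OF f]])
      (use poly_exp_measurable[OF f] in \<open>auto simp: abs_mult mult_left_le_one_le\<close>)
  let ?g = "\<lambda>u w. 2 * (cos (t * (r * w)) * (cos ((r *\<^sub>R x) \<bullet> u) * f (u, w)))"
  have "cos ((r *\<^sub>R (x, t)) \<bullet> p) * f p + cos ((r *\<^sub>R (x, - t)) \<bullet> p) * f p = case_prod ?g p" for p
  proof -
    obtain u w where p: "p = (u, w)" by (cases p)
    have "(r *\<^sub>R (x, t)) \<bullet> p = (r *\<^sub>R x) \<bullet> u + t * (r * w)" "(r *\<^sub>R (x, - t)) \<bullet> p = (r *\<^sub>R x) \<bullet> u - t * (r * w)"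
      by (simp_all add: p)
    then show ?thesis by (simp add: p cos_add cos_diff algebra_simps)
  qed
  then have eq: "(\<lambda>p. cos ((r *\<^sub>R (x, t)) \<bullet> p) * f p + cos ((r *\<^sub>R (x, - t)) \<bullet> p) * f p) = case_prod ?g" by blast
  have int: "integrable (lborel \<Otimes>\<^sub>M lborel) (case_prod ?g)"
    unfolding lborel_prod eq[symmetric] by (intro Bochner_Integration.integrable_add i)
  have "ft 0 f (r *\<^sub>R (x, t)) + ft 0 f (r *\<^sub>R (x, - t)) =
      (\<integral>p. cos ((r *\<^sub>R (x, t)) \<bullet> p) * f p + cos ((r *\<^sub>R (x, - t)) \<bullet> p) * f p \<partial>lborel)"
    unfolding ft_def add_0_right by (rule Bochner_Integration.integral_add[OF i i, symmetric])
  also have "\<dots> = integral\<^sup>L (lborel \<Otimes>\<^sub>M lborel) (case_prod ?g)" unfolding eq lborel_prod ..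
  also have "\<dots> = (\<integral>w. (\<integral>u. ?g u w \<partial>lborel) \<partial>lborel)"
    by (rule lborel_pair.integral_snd[OF int, symmetric])
  also have "\<dots> = 2 * (\<integral>w. cos (t * (r * w)) * ft 0 (\<lambda>u. f (u, w)) (r *\<^sub>R x) \<partial>lborel)"
    unfolding ft_def by simp
  finally show ?thesis .
qed

lemma slice_measurable:
  assumes f: "poly_exp R f"
  shows "(\<lambda>(r, w). ft 0 (\<lambda>u. f (u, w)) (r *\<^sub>R x)) \<in> borel_measurable (borel \<Otimes>\<^sub>M borel)"
proof -
  have [measurable]: "f \<in> borel_measurable (borel \<Otimes>\<^sub>M borel)"
    using poly_exp_measurable[OF f] by (simp add: borel_prod)
  show ?thesis unfolding ft_def by measurable
qed

lemma slice_tendsto: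
  assumes f: "poly_exp R f" and w: "w \<longlonglongrightarrow> 0"
  shows "(\<lambda>n. ft 0 (\<lambda>u. f (u, w n)) y) \<longlonglongrightarrow> ft 0 (\<lambda>u. f (u, 0)) y"
proof -
  have [measurable]: "f \<in> borel_measurable (borel \<Otimes>\<^sub>M borel)"
    using poly_exp_measurable[OF f] by (simp add: borel_prod)
  obtain C where C: "\<And>p. \<bar>f p\<bar> \<le> C * exp (- norm p)" using poly_exp_bound[OF f] by blast
  have C0: "C \<ge> 0" using C[of 0] by simp
  show ?thesis
    unfolding ft_def
  proof (rule integral_dominated_convergence)
    show "integrable lborel (\<lambda>u::'a. C * exp (- (1 / 2) * norm u))"
      by (intro integrable_mult_right integrable_exp_norm) simp
    show "AE u in lborel. (\<lambda>n. cos (y \<bullet> u + 0) * f (u, w n)) \<longlonglongrightarrow> cos (y \<bullet> u + 0) * f (u, 0)"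
    proof (rule AE_I2)
      fix u :: 'a
      have "(\<lambda>n. f (u, w n)) \<longlonglongrightarrow> f (u, 0)"
        by (rule isCont_tendsto_compose[OF poly_exp_continuous[OF f]]) (intro tendsto_intros w)
      then show "(\<lambda>n. cos (y \<bullet> u + 0) * f (u, w n)) \<longlonglongrightarrow> cos (y \<bullet> u + 0) * f (u, 0)"
        by (intro tendsto_intros)
    qed
    show "AE u in lborel. norm (cos (y \<bullet> u + 0) * f (u, w n)) \<le> C * exp (- (1 / 2) * norm u)" for n
    proof (rule AE_I2)
      fix u :: 'a
      have "\<bar>cos (y \<bullet> u + 0)\<bar> * \<bar>f (u, w n)\<bar> \<le> 1 * (C * exp (- norm (u, w n)))"
        by (intro mult_mono C) auto
      also have "C * exp (- norm (u, w n)) \<le> C * (1 * exp (- (1 / 2) * norm u))"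
        using C0 exp_norm_Pair_le[of u "w n"]
        by (intro mult_left_mono order.trans[OF exp_norm_Pair_le] mult_right_mono) auto
      finally show "norm (cos (y \<bullet> u + 0) * f (u, w n)) \<le> C * exp (- (1 / 2) * norm u)"
        by (simp add: abs_mult)
    qed
  qed measurable
qed

text \<open>Integrating against \<open>exp (- \<delta> t)\<close> over \<open>t > 0\<close> turns the factor \<open>cos (r t w)\<close>
  into the Poisson kernel \<open>\<delta> / (\<delta>\<^sup>2 + (r w)\<^sup>2)\<close>, which concentrates at \<open>w = 0\<close> as \<open>\<delta>\<close> tends to 0.\<close>

lemma radial_descent:
  assumes f: "poly_exp R f" and x: "x \<noteq> 0"
    and nonneg: "\<And>t. radial (Suc p) 0 f (x, t) \<ge> 0"
  shows "radial p 0 (\<lambda>u. f (u, 0)) x \<ge> 0"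
proof -
  define \<Psi> where "\<Psi> r w = ft 0 (\<lambda>u. f (u, w)) (r *\<^sub>R x)" for r w
  have \<Psi>m: "(\<lambda>(r, w). \<Psi> r w) \<in> borel_measurable (borel \<Otimes>\<^sub>M borel)"
    unfolding \<Psi>_def by (rule slice_measurable[OF f])
  have [measurable (raw)]: "(\<lambda>z. \<Psi> (g z) (h z)) \<in> borel_measurable N"
    if [measurable]: "g \<in> borel_measurable N" "h \<in> borel_measurable N" for g h and N :: "'z measure"
  proof -
    have "(\<lambda>z. (g z, h z)) \<in> N \<rightarrow>\<^sub>M borel \<Otimes>\<^sub>M borel" by measurable
    from measurable_compose[OF this \<Psi>m] show ?thesis by simp
  qed
  obtain C where C: "C \<ge> 0" "\<And>r w q. 0 < r \<Longrightarrow> q \<le> Suc p \<Longrightarrow>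
    \<bar>r ^ q * \<Psi> r w\<bar> \<le> C / (1 + r\<^sup>2) * exp (- (1 / 2) * \<bar>w\<bar>)"
    using slice_bound[OF f x, of "Suc p"] unfolding \<Psi>_def by blast
  have \<Psi>C: "\<bar>\<Psi> r w\<bar> \<le> C * exp (- (1 / 2) * \<bar>w\<bar>)" if "0 < r" for r w
  proof -
    have "\<bar>\<Psi> r w\<bar> \<le> C / (1 + r\<^sup>2) * exp (- (1 / 2) * \<bar>w\<bar>)" using C(2)[OF that, of 0 w] by simp
    also have "\<dots> \<le> C / 1 * exp (- (1 / 2) * \<bar>w\<bar>)"
      using C(1) by (intro mult_right_mono divide_left_mono) (auto simp: add_pos_nonneg)
    finally show ?thesis by simp
  qed
  have iw: "integrable lborel (\<lambda>w::real. exp (- (1 / 2) * \<bar>w\<bar>))"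
    using integrable_exp_norm[of "1 / 2", where 'a = real] by simp
  define J where "J = (\<integral>w. exp (- (1 / 2) * \<bar>w\<bar>) \<partial>(lborel :: real measure))"
  define \<Phi> where "\<Phi> r t = ft 0 f (r *\<^sub>R (x, t)) + ft 0 f (r *\<^sub>R (x, - t))" for r t
  have \<Phi>: "\<Phi> r t = 2 * (\<integral>w. cos (t * (r * w)) * \<Psi> r w \<partial>lborel)" for r t
    unfolding \<Phi>_def \<Psi>_def by (rule ft_slice[OF f])
  have \<Phi>_bound: "\<bar>r ^ Suc p * \<Phi> r t\<bar> \<le> 2 * C * J / (1 + r\<^sup>2)" if r: "0 < r" for r t
  proof -
    have "\<bar>r ^ Suc p * \<Phi> r t\<bar> = 2 * \<bar>\<integral>w. cos (t * (r * w)) * (r ^ Suc p * \<Psi> r w) \<partial>lborel\<bar>"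
    proof -
      have "(\<integral>w. cos (t * (r * w)) * (r ^ Suc p * \<Psi> r w) \<partial>lborel) = r ^ Suc p * (\<integral>w. cos (t * (r * w)) * \<Psi> r w \<partial>lborel)"
        by (simp only: mult.left_commute[of _ "r ^ Suc p"] integral_mult_right_zero)
      then show ?thesis by (simp add: \<Phi> abs_mult)
    qed
    also have "\<dots> \<le> 2 * (\<integral>w. C / (1 + r\<^sup>2) * exp (- (1 / 2) * \<bar>w\<bar>) \<partial>lborel)"
    proof (intro mult_left_mono order.trans[OF integral_abs_bound] Bochner_Integration.integral_mono')
      fix w :: real
      have "\<bar>cos (t * (r * w))\<bar> * \<bar>r ^ Suc p * \<Psi> r w\<bar> \<le> 1 * (C / (1 + r\<^sup>2) * exp (- (1 / 2) * \<bar>w\<bar>))"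
        by (intro mult_mono C(2) r) auto
      then show "\<bar>cos (t * (r * w)) * (r ^ Suc p * \<Psi> r w)\<bar> \<le> C / (1 + r\<^sup>2) * exp (- (1 / 2) * \<bar>w\<bar>)"
        by (simp only: abs_mult mult_1)
      show "0 \<le> C / (1 + r\<^sup>2) * exp (- (1 / 2) * \<bar>w\<bar>)" using C(1) by (simp add: add_pos_nonneg)
    qed (use iw in \<open>auto intro!: integrable_mult_right\<close>)
    also have "\<dots> = 2 * C * J / (1 + r\<^sup>2)" by (simp add: J_def)
    finally show ?thesis .
  qed
  have S: "radial (Suc p) 0 f (x, t) + radial (Suc p) 0 f (x, - t) = (\<integral>r. r ^ Suc p * \<Phi> r t \<partial>lpos)" for t
  proof -
    have "(x, t) \<noteq> 0" "(x, - t) \<noteq> 0" using x by (auto simp: zero_prod_def)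
    from radial_integrable_power[OF f this(1), of "Suc p" 0] radial_integrable_power[OF f this(2), of "Suc p" 0]
    show ?thesis
      unfolding radial_def \<Phi>_def distrib_left by (rule Bochner_Integration.integral_add[symmetric])
  qed
  \<comment> \<open>The nonnegative function of t is integrated against exp (- \<delta> t). Two
    exchanges of integrals then move the t-integral innermost, where it is explicit.\<close>
  have key: "0 \<le> (\<integral>r. r ^ p * (\<integral>z. \<Psi> r (\<delta> * z / r) / (1 + z\<^sup>2) \<partial>lborel) \<partial>lpos)" if d: "\<delta> > 0" for \<delta>
  proof -
    have S0: "0 \<le> (\<integral>r. r ^ Suc p * \<Phi> r t \<partial>lpos)" for t
      unfolding S[symmetric] by (intro add_nonneg_nonneg nonneg)
    have "0 \<le> (\<integral>t. exp (- \<delta> * t) * (\<integral>r. r ^ Suc p * \<Phi> r t \<partial>lpos) \<partial>lpos)"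
      by (rule integral_nonneg_AE[OF AE_I2[OF mult_nonneg_nonneg[OF exp_ge_zero S0]]])
    also have "\<dots> = (\<integral>t. (\<integral>r. exp (- \<delta> * t) * (r ^ Suc p * \<Phi> r t) \<partial>lpos) \<partial>lpos)" by simp
    also have "\<dots> = (\<integral>r. (\<integral>t. exp (- \<delta> * t) * (r ^ Suc p * \<Phi> r t) \<partial>lpos) \<partial>lpos)"
    proof (rule Fubini_product_bound(2)[symmetric, OF sigma_finite_lpos sigma_finite_lpos])
      have "(\<lambda>(t, r). ft 0 f (r *\<^sub>R (x, s * t))) \<in> borel_measurable (borel \<Otimes>\<^sub>M borel)" for s
      proof -
        have "(\<lambda>z. (snd z) *\<^sub>R (x, s * fst z)) \<in> borel_measurable (borel \<Otimes>\<^sub>M borel)"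
          unfolding borel_prod by (intro borel_measurable_continuous_onI continuous_intros)
        from measurable_compose[OF this ft_measurable[OF f]] show ?thesis by (simp add: case_prod_beta)
      qed
      from this[of 1] this[of "-1"] have "(\<lambda>(t, r). exp (- \<delta> * t) * (r ^ Suc p * \<Phi> r t)) \<in> borel_measurable (borel \<Otimes>\<^sub>M borel)"
        unfolding \<Phi>_def by (simp add: case_prod_beta)
      moreover have "(\<lambda>z. (fst z, snd z)) \<in> lpos \<Otimes>\<^sub>M lpos \<rightarrow>\<^sub>M borel \<Otimes>\<^sub>M borel"
        by (intro measurable_Pair measurable_compose[OF measurable_fst] measurable_compose[OF measurable_snd] lpos_measurable) auto
      ultimately show "(\<lambda>(t, r). exp (- \<delta> * t) * (r ^ Suc p * \<Phi> r t)) \<in> borel_measurable (lpos \<Otimes>\<^sub>M lpos)"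
        using measurable_compose by fastforce
      show "integrable lpos (\<lambda>t. exp (- \<delta> * t))" by (rule integrable_lpos_exp[OF d])
      show "integrable lpos (\<lambda>r. 2 * C * J / (1 + r\<^sup>2))" by (rule integrable_lpos_inverse_square)
      fix t r assume "r \<in> space lpos"
      then have "r > 0" by simp
      then show "\<bar>exp (- \<delta> * t) * (r ^ Suc p * \<Phi> r t)\<bar> \<le> exp (- \<delta> * t) * (2 * C * J / (1 + r\<^sup>2))"
        unfolding abs_mult[of "exp _"] using \<Phi>_bound[of r t] by (simp only: abs_exp_cancel) (rule mult_left_mono, auto)
    qed
    also have "\<dots> = (\<integral>r. 2 * (r ^ p * (\<integral>z. \<Psi> r (\<delta> * z / r) / (1 + z\<^sup>2) \<partial>lborel)) \<partial>lpos)"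
    proof (rule Bochner_Integration.integral_cong[OF refl])
      fix r assume "r \<in> space lpos"
      then have r: "r > 0" by simp
      have "(\<integral>t. exp (- \<delta> * t) * (r ^ Suc p * \<Phi> r t) \<partial>lpos) =
          (\<integral>t. 2 * r ^ Suc p * (\<integral>w. exp (- \<delta> * t) * cos (t * (r * w)) * \<Psi> r w \<partial>lborel) \<partial>lpos)"
        by (simp add: \<Phi> mult_ac flip: integral_mult_right_zero)
      also have "\<dots> = 2 * r ^ Suc p * (\<integral>t. (\<integral>w. exp (- \<delta> * t) * cos (t * (r * w)) * \<Psi> r w \<partial>lborel) \<partial>lpos)"
        by (rule integral_mult_right_zero)
      also have "(\<integral>t. (\<integral>w. exp (- \<delta> * t) * cos (t * (r * w)) * \<Psi> r w \<partial>lborel) \<partial>lpos) =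
          (\<integral>w. (\<integral>t. exp (- \<delta> * t) * cos (t * (r * w)) * \<Psi> r w \<partial>lpos) \<partial>lborel)"
      proof (rule Fubini_product_bound(2)[OF _ sigma_finite_lpos])
        show "(\<lambda>(w, t). exp (- \<delta> * t) * cos (t * (r * w)) * \<Psi> r w) \<in> borel_measurable (lborel \<Otimes>\<^sub>M lpos)"
          by (rule measurable_lborel_lpos) measurable
        show "integrable lborel (\<lambda>w. C * exp (- (1 / 2) * \<bar>w\<bar>))" using iw by (rule integrable_mult_right)
        show "integrable lpos (\<lambda>t. exp (- \<delta> * t))" by (rule integrable_lpos_exp[OF d])
        fix w t :: real
        have "\<bar>exp (- \<delta> * t) * cos (t * (r * w))\<bar> * \<bar>\<Psi> r w\<bar> \<le> (exp (- \<delta> * t) * 1) * (C * exp (- (1 / 2) * \<bar>w\<bar>))"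
          by (intro mult_mono \<Psi>C r) (auto simp: abs_mult)
        then show "\<bar>exp (- \<delta> * t) * cos (t * (r * w)) * \<Psi> r w\<bar> \<le> (C * exp (- (1 / 2) * \<bar>w\<bar>)) * exp (- \<delta> * t)"
          by (simp only: abs_mult mult_1_right mult_ac)
      qed (rule sigma_finite_lborel)
      also have "\<dots> = (\<integral>w. \<delta> / (\<delta>\<^sup>2 + (r * w)\<^sup>2) * \<Psi> r w \<partial>lborel)"
        using integral_lpos_exp_cos[OF d, of "r * _" 0] by simp
      \<comment> \<open>The substitution w = \<delta> z / r normalises the Poisson kernel to 1 / (1
        + z^2). Its factor 1/r lowers the power of r from p+1 to p, the shift between the two
        dimensions.\<close>
      also have "\<dots> = \<bar>\<delta> / r\<bar> *\<^sub>R (\<integral>z. \<delta> / (\<delta>\<^sup>2 + (r * (0 + \<delta> / r * z))\<^sup>2) * \<Psi> r (0 + \<delta> / r * z) \<partial>lborel)"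
        by (rule lborel_integral_real_affine) (use d r in auto)
      also have "(\<lambda>z. \<delta> / (\<delta>\<^sup>2 + (r * (0 + \<delta> / r * z))\<^sup>2) * \<Psi> r (0 + \<delta> / r * z)) = (\<lambda>z. 1 / \<delta> * (\<Psi> r (\<delta> * z / r) / (1 + z\<^sup>2)))"
      proof
        fix z :: real
        have "\<delta>\<^sup>2 + (r * (0 + \<delta> / r * z))\<^sup>2 = \<delta>\<^sup>2 * (1 + z\<^sup>2)" using r by (simp add: power_mult_distrib distrib_left)
        moreover have "\<delta> / (\<delta>\<^sup>2 * (1 + z\<^sup>2)) = 1 / \<delta> / (1 + z\<^sup>2)" using d by (simp add: power2_eq_square)
        ultimately show "\<delta> / (\<delta>\<^sup>2 + (r * (0 + \<delta> / r * z))\<^sup>2) * \<Psi> r (0 + \<delta> / r * z) = 1 / \<delta> * (\<Psi> r (\<delta> * z / r) / (1 + z\<^sup>2))"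
          by simp
      qed
      also have "\<bar>\<delta> / r\<bar> *\<^sub>R (\<integral>z. 1 / \<delta> * (\<Psi> r (\<delta> * z / r) / (1 + z\<^sup>2)) \<partial>lborel) =
          1 / r * (\<integral>z. \<Psi> r (\<delta> * z / r) / (1 + z\<^sup>2) \<partial>lborel)"
        unfolding integral_mult_right_zero using d r by simp
      finally show "(\<integral>t. exp (- \<delta> * t) * (r ^ Suc p * \<Phi> r t) \<partial>lpos) =
          2 * (r ^ p * (\<integral>z. \<Psi> r (\<delta> * z / r) / (1 + z\<^sup>2) \<partial>lborel))"
        using d r by simp
    qed
    finally show ?thesis by simp
  qed
  define \<delta> where "\<delta> n = 1 / real (Suc n)" for n
  have d: "\<delta> n > 0" for n by (simp add: \<delta>_def)
  have d0: "\<delta> \<longlonglongrightarrow> 0" unfolding \<delta>_def[abs_def] by (rule LIMSEQ_Suc[OF lim_1_over_n, unfolded inverse_eq_divide])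
  define I where "I = (\<integral>z. 1 / (1 + z\<^sup>2) \<partial>(lborel :: real measure))"
  \<comment> \<open>A product majorant in r and z that does not involve \<delta>, used for dominated
    convergence in both the inner and the outer integral.\<close>
  have inner_bound: "\<bar>r ^ p * (\<Psi> r w / (1 + z\<^sup>2))\<bar> \<le> C / (1 + r\<^sup>2) * (1 / (1 + z\<^sup>2))" if r: "0 < r" for r w z
  proof -
    have "\<bar>r ^ p * \<Psi> r w\<bar> \<le> C / (1 + r\<^sup>2) * exp (- (1 / 2) * \<bar>w\<bar>)" by (rule C(2)[OF r]) simp
    also have "\<dots> \<le> C / (1 + r\<^sup>2) * 1" using C(1) by (intro mult_left_mono) (auto simp: add_pos_nonneg)
    finally have "\<bar>r ^ p * \<Psi> r w\<bar> / (1 + z\<^sup>2) \<le> C / (1 + r\<^sup>2) / (1 + z\<^sup>2)"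
      by (intro divide_right_mono) (auto simp: add_nonneg_nonneg)
    then show ?thesis by (simp add: abs_mult)
  qed
  have i2: "integrable lborel (\<lambda>z::real. C / (1 + r\<^sup>2) * (1 / (1 + z\<^sup>2)))" for r
    by (rule integrable_mult_right[OF integrable_inverse_square])
  have "(\<lambda>n. \<integral>r. (\<integral>z. r ^ p * (\<Psi> r (\<delta> n * z / r) / (1 + z\<^sup>2)) \<partial>lborel) \<partial>lpos) \<longlonglongrightarrow>
      (\<integral>r. (\<integral>z. r ^ p * (\<Psi> r 0 / (1 + z\<^sup>2)) \<partial>lborel) \<partial>lpos)"
  proof (rule integral_dominated_convergence)
    show "integrable lpos (\<lambda>r. C * I / (1 + r\<^sup>2))" by (rule integrable_lpos_inverse_square)
    show "AE r in lpos. (\<lambda>n. \<integral>z. r ^ p * (\<Psi> r (\<delta> n * z / r) / (1 + z\<^sup>2)) \<partial>lborel) \<longlonglongrightarrow>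
        (\<integral>z. r ^ p * (\<Psi> r 0 / (1 + z\<^sup>2)) \<partial>lborel)"
    proof (rule AE_I2)
      fix r assume "r \<in> space lpos"
      then have r: "r > 0" by simp
      show "(\<lambda>n. \<integral>z. r ^ p * (\<Psi> r (\<delta> n * z / r) / (1 + z\<^sup>2)) \<partial>lborel) \<longlonglongrightarrow>
        (\<integral>z. r ^ p * (\<Psi> r 0 / (1 + z\<^sup>2)) \<partial>lborel)"
      proof (rule integral_dominated_convergence[OF _ _ i2[of r]])
        show "AE z in lborel. (\<lambda>n. r ^ p * (\<Psi> r (\<delta> n * z / r) / (1 + z\<^sup>2))) \<longlonglongrightarrow> r ^ p * (\<Psi> r 0 / (1 + z\<^sup>2))"
        proof (rule AE_I2)
          fix z :: real
          have "(\<lambda>n. \<delta> n * z / r) \<longlonglongrightarrow> 0 * z / r" by (intro tendsto_intros d0) (use r in auto)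
          then have "(\<lambda>n. \<delta> n * z / r) \<longlonglongrightarrow> 0" by simp
          then have "(\<lambda>n. \<Psi> r (\<delta> n * z / r)) \<longlonglongrightarrow> \<Psi> r 0"
            unfolding \<Psi>_def by (rule slice_tendsto[OF f])
          then show "(\<lambda>n. r ^ p * (\<Psi> r (\<delta> n * z / r) / (1 + z\<^sup>2))) \<longlonglongrightarrow> r ^ p * (\<Psi> r 0 / (1 + z\<^sup>2))"
            by (intro tendsto_intros) (auto simp: add_nonneg_eq_0_iff)
        qed
        show "AE z in lborel. norm (r ^ p * (\<Psi> r (\<delta> n * z / r) / (1 + z\<^sup>2))) \<le> C / (1 + r\<^sup>2) * (1 / (1 + z\<^sup>2))" for n
          using inner_bound[OF r] by simp
      qed measurable
    qed
    show "AE r in lpos. norm (\<integral>z. r ^ p * (\<Psi> r (\<delta> n * z / r) / (1 + z\<^sup>2)) \<partial>lborel) \<le> C * I / (1 + r\<^sup>2)" for n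
    proof (rule AE_I2)
      fix r assume "r \<in> space lpos"
      then have r: "r > 0" by simp
      have "norm (\<integral>z. r ^ p * (\<Psi> r (\<delta> n * z / r) / (1 + z\<^sup>2)) \<partial>lborel) \<le> (\<integral>z. C / (1 + r\<^sup>2) * (1 / (1 + z\<^sup>2)) \<partial>lborel)"
      proof (rule Bochner_Integration.integral_norm_bound_integral[OF _ i2])
        show "integrable lborel (\<lambda>z. r ^ p * (\<Psi> r (\<delta> n * z / r) / (1 + z\<^sup>2)))"
        proof (rule Bochner_Integration.integrable_bound[OF i2[of r]])
          show "AE z in lborel. norm (r ^ p * (\<Psi> r (\<delta> n * z / r) / (1 + z\<^sup>2))) \<le> norm (C / (1 + r\<^sup>2) * (1 / (1 + z\<^sup>2)))"
            unfolding real_norm_def by (intro AE_I2 order.trans[OF inner_bound[OF r] abs_ge_self])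
        qed measurable
      qed (use inner_bound[OF r] in simp)
      also have "\<dots> = C / (1 + r\<^sup>2) * I" unfolding I_def by (rule integral_mult_right_zero)
      finally show "norm (\<integral>z. r ^ p * (\<Psi> r (\<delta> n * z / r) / (1 + z\<^sup>2)) \<partial>lborel) \<le> C * I / (1 + r\<^sup>2)" by simp
    qed
    show "(\<lambda>r. \<integral>z. r ^ p * (\<Psi> r 0 / (1 + z\<^sup>2)) \<partial>lborel) \<in> borel_measurable lpos"
      by (rule lpos_measurable) measurable
    show "(\<lambda>r. \<integral>z. r ^ p * (\<Psi> r (\<delta> n * z / r) / (1 + z\<^sup>2)) \<partial>lborel) \<in> borel_measurable lpos" for n
      by (rule lpos_measurable) measurable
  qed
  moreover have "0 \<le> (\<integral>r. (\<integral>z. r ^ p * (\<Psi> r (\<delta> n * z / r) / (1 + z\<^sup>2)) \<partial>lborel) \<partial>lpos)" for n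
    using key[OF d[of n]] by (simp only: integral_mult_right_zero)
  ultimately have "0 \<le> (\<integral>r. (\<integral>z. r ^ p * (\<Psi> r 0 / (1 + z\<^sup>2)) \<partial>lborel) \<partial>lpos)"
    by (intro LIMSEQ_le_const) auto
  also have "\<dots> = (\<integral>r. I * (r ^ p * \<Psi> r 0) \<partial>lpos)"
  proof (rule Bochner_Integration.integral_cong[OF refl])
    fix r :: real
    have "(\<integral>z. r ^ p * (\<Psi> r 0 / (1 + z\<^sup>2)) \<partial>lborel) = (\<integral>z. (r ^ p * \<Psi> r 0) * (1 / (1 + z\<^sup>2)) \<partial>(lborel::real measure))"
      by simp
    also have "\<dots> = (r ^ p * \<Psi> r 0) * I" unfolding I_def by (rule integral_mult_right_zero)
    finally show "(\<integral>z. r ^ p * (\<Psi> r 0 / (1 + z\<^sup>2)) \<partial>lborel) = I * (r ^ p * \<Psi> r 0)" by (simp only: mult.commute)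
  qed
  also have "\<dots> = I * radial p 0 (\<lambda>u. f (u, 0)) x"
    unfolding radial_def \<Psi>_def by (rule integral_mult_right_zero)
  finally have "0 \<le> I * radial p 0 (\<lambda>u. f (u, 0)) x" .
  \<comment> \<open>The integral \<open>I\<close> is pi; the bound 1/2 on [0,1] already gives the
    positivity that allows dividing by it.\<close>
  moreover have "I > 0"
  proof -
    have "0 < (\<integral>z. (1 / 2 :: real) * indicator {0..1} z \<partial>(lborel :: real measure))" by simp
    also have "\<dots> \<le> I"
      unfolding I_def
    proof (rule integral_mono)
      fix z :: real
      have "1 / 2 \<le> 1 / (1 + z\<^sup>2)" if "z \<in> {0..1}"
        using that by (intro divide_left_mono) (auto simp: power_le_one add_pos_nonneg)
      then show "1 / 2 * indicator {0..1} z \<le> 1 / (1 + z\<^sup>2)"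
        by (auto simp: indicator_def add_nonneg_nonneg)
    qed (use integrable_inverse_square in auto)
    finally show ?thesis .
  qed
  ultimately show ?thesis by (simp add: zero_le_mult_iff)
qed

end

section \<open>The sphere in dimension n-1 and the conclusion\<close>

lemma neg_laplacian_zero: "((\<lambda>f y. - laplacian f y) ^^ k) (\<lambda>_. 0) = (\<lambda>_. 0)"
  by (induction k) (simp_all add: laplacian_def directional_deriv_def)

text \<open>Used in contraposition: a nonzero value of John's solution shows that the sphere has
  positive measure. This supplies positivity in the lower dimension, where the space is not written
  as a product and the projection lemma does not apply.\<close>

lemma john_fundamental_solution_null_sphere:
  fixes Q :: "'a::euclidean_space \<Rightarrow> real"
  assumes "emeasure (hausdorff_measure (DIM('a) - 1)) (sphere (0::'a) 1) = 0"
  shows "john_fundamental_solution m Q y = 0"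
proof -
  have "sphere (0::'a) 1 \<in> null_sets (hausdorff_measure (DIM('a) - 1))"
    using assms by (simp add: null_sets_def borel_closed)
  then have "AE \<xi> in hausdorff_measure (DIM('a) - 1). \<xi> \<notin> sphere (0::'a) 1" by (rule AE_not_in)
  then have "(LINT \<xi>:sphere (0::'a) 1|hausdorff_measure (DIM('a) - 1). g \<xi>) = 0" for g :: "'a \<Rightarrow> real"
    unfolding set_lebesgue_integral_def
    by (intro integral_eq_zero_AE) (auto elim!: eventually_mono simp: indicator_def)
  then show ?thesis
    by (simp add: john_fundamental_solution_def Let_def neg_laplacian_zero)
qed

theorem proposition2p8:
  fixes m n :: nat
    and Q' :: "real ^ 'k \<Rightarrow> real"
    and L' :: "(real ^ 'k \<Rightarrow> real) \<Rightarrow> real ^ 'k \<Rightarrow> real"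
    and x' :: "real ^ 'k"
  assumes "m \<ge> 1" and "n > 2 * m + 1" and "CARD('k) = n - 1"
    and "elliptic_operator m Q' L'"
    and "x' \<noteq> 0" and "john_fundamental_solution m Q' x' < 0"
  shows "\<exists>(Q :: (real ^ 'k) \<times> real \<Rightarrow> real) L x\<^sub>n.
           elliptic_operator m Q L \<and> (x', x\<^sub>n) \<noteq> 0 \<and> john_fundamental_solution m Q (x', x\<^sub>n) < 0"
proof -
  let ?Q = "\<lambda>p::(real ^ 'k) \<times> real. Q' (fst p) + snd p ^ (2 * m)"
  let ?d = "DIM(real ^ 'k)"
  have d: "2 * m < ?d" using assms(2,3) by simp
  have dn: "DIM((real ^ 'k) \<times> real) = ?d + 1" by simp
  obtain L where L: "elliptic_operator m ?Q L" using elliptic_operator_extend[OF assms(4)] by blast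
  obtain c where c: "c > 0" "\<And>\<xi>. Q' \<xi> \<ge> c * norm \<xi> ^ (2 * m)"
    using elliptic_operator_polynomial(3)[OF assms(4)] by blast
  obtain c2 where c2: "c2 > 0" "\<And>\<xi>. ?Q \<xi> \<ge> c2 * norm \<xi> ^ (2 * m)"
    using elliptic_operator_polynomial(3)[OF L] by blast
  \<comment> \<open>One value for both dimensions, large enough for DIM + 1 \<le> 2m + 2a in
    dimensions d and d+1.\<close>
  define a where "a = ?d + 2"
  interpret E': elliptic_polynomial Q' m a c
    by unfold_locales (use elliptic_operator_polynomial[OF assms(4)] c assms(1) d in auto)
  interpret E: elliptic_polynomial ?Q m a c2
    by unfold_locales (use elliptic_operator_polynomial[OF L] c2 assms(1) d in auto)
  interpret EP: exp_weight_prod E.R c2 ..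
  have "emeasure (hausdorff_measure (?d - 1)) (sphere (0::real ^ 'k) 1) \<noteq> 0"
    using john_fundamental_solution_null_sphere[where 'a = "real ^ 'k"] assms(6) by force
  then have pos': "emeasure (hausdorff_measure (?d - 1)) (sphere (0::real ^ 'k) 1) > 0"
    by (simp add: zero_less_iff_neq_zero)
  have pos: "emeasure (hausdorff_measure (DIM((real ^ 'k) \<times> real) - 1)) (sphere (0::(real ^ 'k) \<times> real) 1) > 0"
    using hausdorff_sphere_prod_pos[where 'a = "real ^ 'k"] unfolding dn by simp
  obtain A' where A': "A' > 0" "\<And>y. y \<noteq> 0 \<Longrightarrow> john_fundamental_solution m Q' y =
    A' * radial (?d - 1 - 2 * m) 0 (\<lambda>x. norm x ^ (2 * a) * exp (- E'.R x)) y"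
    using E'.john_fundamental_solution_radial[OF pos'] unfolding a_def by (auto simp del: DIM_cart)
  let ?h = "\<lambda>x. norm x ^ (2 * a) * exp (- E.R x)"
  have ex: "Suc (?d - 1 - 2 * m) = DIM((real ^ 'k) \<times> real) - 1 - 2 * m" unfolding dn using d by simp
  obtain A where A: "A > 0" "\<And>y. y \<noteq> 0 \<Longrightarrow> john_fundamental_solution m ?Q y =
    A * radial (Suc (?d - 1 - 2 * m)) 0 ?h y"
    unfolding ex using E.john_fundamental_solution_radial[OF pos] unfolding a_def dn by (auto simp del: DIM_cart DIM_prod)
  have nz: "(x', t) \<noteq> 0" for t :: real using assms(5) by (simp add: zero_prod_def)
  have "\<exists>t. radial (Suc (?d - 1 - 2 * m)) 0 ?h (x', t) < 0"
  proof (rule ccontr)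
    assume "\<not> ?thesis"
    then have "radial (Suc (?d - 1 - 2 * m)) 0 ?h (x', t) \<ge> 0" for t by (simp add: not_less)
    from EP.radial_descent[OF E.poly_exp_norm_power assms(5) this]
    have "radial (?d - 1 - 2 * m) 0 (\<lambda>u. ?h (u, 0)) x' \<ge> 0" .
    \<comment> \<open>On the hyperplane the added term vanishes because m \<ge> 1, and the norm is
      that of u; with the common \<open>a\<close> the two weights agree exactly.\<close>
    moreover have "?h (u, 0) = norm u ^ (2 * a) * exp (- E'.R u)" for u
      using assms(1) by (simp add: E.R_def E'.R_def)
    ultimately have "radial (?d - 1 - 2 * m) 0 (\<lambda>x. norm x ^ (2 * a) * exp (- E'.R x)) x' \<ge> 0"
      by (simp only:)
    then have "john_fundamental_solution m Q' x' \<ge> 0"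
      unfolding A'(2)[OF assms(5)] using A'(1) by (intro mult_nonneg_nonneg) auto
    with assms(6) show False by simp
  qed
  then obtain t where "radial (Suc (?d - 1 - 2 * m)) 0 ?h (x', t) < 0" by blast
  then have "john_fundamental_solution m ?Q (x', t) < 0"
    using A nz by (simp add: mult_pos_neg)
  with L nz show ?thesis by blast
qed

end
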